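(* Let $n>3$ and let $Z$ be a zero-dimensional subscheme of $\mathbb{P}^{n-1}$ with the Weak Lefschetz Property (WLP). Suppose that $$\Delta^2H(R/I_Z,d)=\Delta^2H(R/I_Z,d+1)=s$$ for some $d$ with $r_2(R/I_Z)>d>r_3(R/I_Z)$. Then $\langle (I_Z)_{\le d}\rangle$ is a saturated ideal defining a two-dimensional subscheme of degree $s$ in $\mathbb{P}^{n-1}$, and it is $d$-regular.
   Context: $K$ is a field of characteristic $0$, $R=K[x_1,\dots,x_n]$ with the standard grading, $\mathbb{P}^{n-1}=\operatorname{Proj} R$. $I_Z\subset R$ is the saturated homogeneous ideal of $Z$, $H(R/I,t)=\dim_K(R/I)_t$, $\Delta H(R/I,t)=H(R/I,t)-H(R/I,t-1)$, and $\Delta^2H(R/I,t)=\Delta H(R/I,t)-\Delta H(R/I,t-1)$. For a homogeneous ideal $I$ and $s\ge\dim(R/I)$, $r_s(R/I)=\max\{k : H(R/(I+J),k)\ne 0\}$, where $J$ is generated by $s$ general linear forms. $Z$ has WLP if, for general linear forms $L_1,L_2$ and $A=R/(I_Z+(L_1))$, the multiplication map $\times L_2: A_t\to A_{t+1}$ has maximal rank (is injective or surjective) for every $t$. $\langle (I_Z)_{\le d}\rangle$ is the ideal generated by the elements of $I_Z$ of degree $\le d$. A homogeneous ideal is $m$-regular if for all $p\ge 0$ every $p$-th syzygy in its minimal free resolution has degree $\le m+p$. *)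

theory Defs
  imports Complex_Main "HOL-Library.Cardinality" "HOL-Library.Poly_Mapping" "HOL-Computational_Algebra.Polynomial"
begin

section \<open>The graded polynomial ring\<close>

text \<open>
  \<open>('x, 'k) mpoly\<close> is the polynomial ring over \<open>'k\<close> in variables indexed by the type \<open>'x\<close>;
  for finite \<open>'x\<close> it is \<open>K[x\<^sub>1, \<dots>, x\<^sub>n]\<close> with \<open>n = CARD('x)\<close>. Its ideals are the submodules of
  the ring over itself, so \<open>module.subspace times\<close> means ``is an ideal'' and
  \<open>module.span times S\<close> is the ideal generated by \<open>S\<close>.
\<close>

type_synonym ('x, 'k) mpoly = "('x \<Rightarrow>\<^sub>0 nat) \<Rightarrow>\<^sub>0 'k"

lemma module_times: "module (times :: 'a::comm_ring_1 \<Rightarrow> 'a \<Rightarrow> 'a)"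
  by unfold_locales (simp_all add: algebra_simps)

definition scalar_mult :: "'k::comm_ring_1 \<Rightarrow> ('x, 'k) mpoly \<Rightarrow> ('x, 'k) mpoly" where
  "scalar_mult c f = Poly_Mapping.single 0 c * f"

lemma vector_space_scalar_mult:
  "vector_space (scalar_mult :: 'k::field \<Rightarrow> ('x, 'k) mpoly \<Rightarrow> ('x, 'k) mpoly)"
  by unfold_locales
    (simp_all add: scalar_mult_def algebra_simps single_add mult_single flip: mult.assoc)

definition mon_deg :: "('x \<Rightarrow>\<^sub>0 nat) \<Rightarrow> nat" where
  "mon_deg m = (\<Sum>x\<in>Poly_Mapping.keys m. Poly_Mapping.lookup m x)"

definition forms :: "nat \<Rightarrow> ('x, 'k::zero) mpoly set" where
  "forms t = {f. \<forall>m\<in>Poly_Mapping.keys f. mon_deg m = t}"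

definition linear_form :: "('x::finite \<Rightarrow> 'k::comm_ring_1) \<Rightarrow> ('x, 'k) mpoly" where
  "linear_form a = (\<Sum>x\<in>UNIV. Poly_Mapping.single (Poly_Mapping.single x 1) (a x))"

definition mpoly_eval :: "('v, 'k::comm_ring_1) mpoly \<Rightarrow> ('v \<Rightarrow> 'k) \<Rightarrow> 'k" where
  "mpoly_eval F c = (\<Sum>m\<in>Poly_Mapping.keys F.
     Poly_Mapping.lookup F m * (\<Prod>v\<in>Poly_Mapping.keys m. c v ^ Poly_Mapping.lookup m v))"


section \<open>Homogeneous ideals\<close>

definition homogeneous_ideal :: "('x, 'k::comm_ring_1) mpoly set \<Rightarrow> bool" where
  "homogeneous_ideal I \<longleftrightarrow> (\<exists>S. S \<subseteq> (\<Union>t. forms t) \<and> I = module.span times S)"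

definition irrelevant_ideal :: "('x, 'k::comm_ring_1) mpoly set" where
  "irrelevant_ideal = {f. Poly_Mapping.lookup f 0 = 0}"

text \<open>
  The saturation of \<open>I\<close> consists of all \<open>f\<close> that are multiplied into \<open>I\<close> by some power of
  the irrelevant ideal; the \<open>k\<close>-th power is generated by the monomials of degree \<open>k\<close>.
\<close>

definition saturated :: "('x, 'k::comm_ring_1) mpoly set \<Rightarrow> bool" where
  "saturated I \<longleftrightarrow>
     (\<forall>f. (\<exists>k. \<forall>m. mon_deg m = k \<longrightarrow> Poly_Mapping.single m 1 * f \<in> I) \<longrightarrow> f \<in> I)"

definition truncated_ideal :: "('x, 'k::comm_ring_1) mpoly set \<Rightarrow> nat \<Rightarrow> ('x, 'k) mpoly set" where
  "truncated_ideal I d =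
     module.span times {f \<in> I. \<forall>m\<in>Poly_Mapping.keys f. mon_deg m \<le> d}"


section \<open>Hilbert functions\<close>

text \<open>
  \<open>quotient_basis V W B\<close>: the residue classes modulo the subspace \<open>W\<close> of the elements of \<open>B\<close> are
  pairwise distinct and form a basis of the image of the subspace \<open>V\<close> in the quotient by \<open>W\<close>.
\<close>

definition quotient_basis ::
    "('x, 'k::field) mpoly set \<Rightarrow> ('x, 'k) mpoly set \<Rightarrow> ('x, 'k) mpoly set \<Rightarrow> bool" where
  "quotient_basis V W B \<longleftrightarrow> B \<subseteq> V \<and>
     \<not> module.dependent scalar_mult B \<and>
     module.span scalar_mult B \<inter> W = {0} \<and>
     (\<forall>v\<in>V. \<exists>b\<in>module.span scalar_mult B. v - b \<in> W)"

definition quotient_dim :: "('x, 'k::field) mpoly set \<Rightarrow> ('x, 'k) mpoly set \<Rightarrow> nat" where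
  "quotient_dim V W = card (SOME B. quotient_basis V W B)"

text \<open>\<open>hilbert_fun I t\<close> is the dimension of the degree \<open>t\<close> component of \<open>R/I\<close>.\<close>

definition hilbert_fun :: "('x, 'k::field) mpoly set \<Rightarrow> nat \<Rightarrow> nat" where
  "hilbert_fun I t = quotient_dim (forms t) I"

text \<open>First difference, for functions extended by zero to negative arguments.\<close>

definition diff_fun :: "(nat \<Rightarrow> int) \<Rightarrow> nat \<Rightarrow> int" where
  "diff_fun h t = (if t = 0 then h 0 else h t - h (t - 1))"

definition hilbert_diff2 :: "('x, 'k::field) mpoly set \<Rightarrow> nat \<Rightarrow> int" where
  "hilbert_diff2 I = diff_fun (diff_fun (\<lambda>t. int (hilbert_fun I t)))"


section \<open>Projective subschemes\<close>

text \<open>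
  A closed subscheme of projective space is represented by its saturated homogeneous ideal.
  The points of the subscheme defined by a homogeneous ideal \<open>I\<close> are the homogeneous primes
  containing \<open>I\<close> but not the irrelevant ideal; its dimension is the supremum of the lengths of
  chains of points.
\<close>

definition proj_points :: "('x, 'k::comm_ring_1) mpoly set \<Rightarrow> ('x, 'k) mpoly set set" where
  "proj_points I = {P. homogeneous_ideal P \<and> P \<noteq> UNIV \<and>
     (\<forall>f g. f * g \<in> P \<longrightarrow> f \<in> P \<or> g \<in> P) \<and> I \<subseteq> P \<and> \<not> irrelevant_ideal \<subseteq> P}"

definition point_chain ::
    "('x, 'k::comm_ring_1) mpoly set \<Rightarrow> nat \<Rightarrow> (nat \<Rightarrow> ('x, 'k) mpoly set) \<Rightarrow> bool" where
  "point_chain I k P \<longleftrightarrow> (\<forall>i\<le>k. P i \<in> proj_points I) \<and> (\<forall>i<k. P i \<subset> P (Suc i))"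

text \<open>In particular, a subscheme of dimension \<open>0\<close> is nonempty.\<close>

definition has_proj_dim :: "('x, 'k::comm_ring_1) mpoly set \<Rightarrow> nat \<Rightarrow> bool" where
  "has_proj_dim I r \<longleftrightarrow> (\<exists>P. point_chain I r P) \<and> \<not> (\<exists>P. point_chain I (Suc r) P)"

text \<open>
  The degree is \<open>r!\<close> times the leading coefficient of the Hilbert polynomial, where \<open>r\<close> is the
  dimension.
\<close>

definition has_proj_degree :: "('x, 'k::field) mpoly set \<Rightarrow> int \<Rightarrow> bool" where
  "has_proj_degree I e \<longleftrightarrow>
     (\<exists>r (p :: rat poly). has_proj_dim I r \<and>
        (\<forall>\<^sub>F t in sequentially. of_nat (hilbert_fun I t) = poly p (of_nat t)) \<and>
        of_int e = fact r * lead_coeff p)"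


section \<open>General linear forms\<close>

text \<open>
  \<open>L i = \<Sum>x. c (i, x) * x\<close> for \<open>i < s\<close>: a property holds for \<open>s\<close> general linear forms if it holds
  for all coefficient vectors \<open>c\<close> in a nonempty Zariski-open subset of the affine space of dimension
  \<open>s * n\<close>. Equivalently over an infinite field, it holds off the zero set of one nonzero
  polynomial \<open>F\<close> in the coefficients.
\<close>

definition for_general_forms ::
    "nat \<Rightarrow> ((nat \<Rightarrow> ('x::finite, 'k::field) mpoly) \<Rightarrow> bool) \<Rightarrow> bool" where
  "for_general_forms s Q \<longleftrightarrow>
     (\<exists>F :: (nat \<times> 'x, 'k) mpoly. F \<noteq> 0 \<and>
        (\<forall>m\<in>Poly_Mapping.keys F. Poly_Mapping.keys m \<subseteq> {..<s} \<times> UNIV) \<and>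
        (\<forall>c. mpoly_eval F c \<noteq> 0 \<longrightarrow> Q (\<lambda>i. linear_form (\<lambda>x. c (i, x)))))"

definition add_forms ::
    "('x, 'k::comm_ring_1) mpoly set \<Rightarrow> nat \<Rightarrow> (nat \<Rightarrow> ('x, 'k) mpoly) \<Rightarrow> ('x, 'k) mpoly set" where
  "add_forms I s L = module.span times (I \<union> L ` {..<s})"

text \<open>
  \<open>red_max s I\<close> is the invariant \<open>r\<^sub>s(R/I)\<close>: the value, common to \<open>s\<close> general linear forms, of the
  largest degree in which \<open>R/(I + J)\<close> is nonzero.
\<close>

definition red_max :: "nat \<Rightarrow> ('x::finite, 'k::field) mpoly set \<Rightarrow> nat" where
  "red_max s I = (THE r. for_general_forms s (\<lambda>L.
     hilbert_fun (add_forms I s L) r \<noteq> 0 \<and>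
     (\<forall>k. hilbert_fun (add_forms I s L) k \<noteq> 0 \<longrightarrow> k \<le> r)))"

text \<open>
  Multiplication by \<open>L\<close> from degree \<open>t\<close> to degree \<open>t + 1\<close> of \<open>R/I\<close>, in terms of representatives.
\<close>

definition mult_injective :: "('x, 'k::comm_ring_1) mpoly set \<Rightarrow> ('x, 'k) mpoly \<Rightarrow> nat \<Rightarrow> bool" where
  "mult_injective I L t \<longleftrightarrow> (\<forall>f\<in>forms t. L * f \<in> I \<longrightarrow> f \<in> I)"

definition mult_surjective :: "('x, 'k::comm_ring_1) mpoly set \<Rightarrow> ('x, 'k) mpoly \<Rightarrow> nat \<Rightarrow> bool" where
  "mult_surjective I L t \<longleftrightarrow> (\<forall>g\<in>forms (Suc t). \<exists>f\<in>forms t. g - L * f \<in> I)"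

definition weak_lefschetz :: "('x::finite, 'k::field) mpoly set \<Rightarrow> bool" where
  "weak_lefschetz I \<longleftrightarrow> for_general_forms 2 (\<lambda>L. \<forall>t.
     mult_injective (add_forms I 1 L) (L 1) t \<or> mult_surjective (add_forms I 1 L) (L 1) t)"


section \<open>Castelnuovo-Mumford regularity\<close>

text \<open>
  A minimal graded free resolution \<open>\<dots> \<rightarrow> F\<^sub>1 \<rightarrow> F\<^sub>0 \<rightarrow> I \<rightarrow> 0\<close> of the ideal \<open>I\<close>. Here \<open>F\<^sub>p\<close> is free on
  \<open>b p\<close> generators, the \<open>j\<close>-th one (a \<open>p\<close>-th syzygy) having degree \<open>a p j\<close>. The map from \<open>F\<^sub>0\<close> sends
  the \<open>j\<close>-th generator to \<open>g j\<close>, and \<open>M p\<close> is the matrix of the map from \<open>F\<^sub>p\<^sub>+\<^sub>1\<close> to \<open>F\<^sub>p\<close>. The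
  conditions say that the maps are homogeneous of degree 0, that the sequence is exact at
  \<open>I\<close>, at \<open>F\<^sub>0\<close> and at the remaining \<open>F\<^sub>p\<close>, and (minimality) that all entries of the matrices lie in
  the irrelevant ideal.
\<close>

definition minimal_free_resolution ::
    "('x, 'k::comm_ring_1) mpoly set \<Rightarrow> (nat \<Rightarrow> nat) \<Rightarrow> (nat \<Rightarrow> nat \<Rightarrow> nat) \<Rightarrow>
     (nat \<Rightarrow> ('x, 'k) mpoly) \<Rightarrow> (nat \<Rightarrow> nat \<Rightarrow> nat \<Rightarrow> ('x, 'k) mpoly) \<Rightarrow> bool" where
  "minimal_free_resolution I b a g M \<longleftrightarrow>
     (\<forall>j<b 0. g j \<in> forms (a 0 j)) \<and>
     (\<forall>p. \<forall>i<b p. \<forall>j<b (Suc p). \<forall>m\<in>Poly_Mapping.keys (M p i j).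
        a p i + mon_deg m = a (Suc p) j) \<and>
     I = {\<Sum>j<b 0. c j * g j | c. True} \<and>
     (\<forall>c. (\<Sum>j<b 0. c j * g j) = 0 \<longleftrightarrow>
        (\<exists>e. \<forall>i<b 0. c i = (\<Sum>j<b 1. M 0 i j * e j))) \<and>
     (\<forall>p c. (\<forall>i<b p. (\<Sum>j<b (Suc p). M p i j * c j) = 0) \<longleftrightarrow>
        (\<exists>e. \<forall>j<b (Suc p). c j = (\<Sum>k<b (Suc (Suc p)). M (Suc p) j k * e k))) \<and>
     (\<forall>p. \<forall>i<b p. \<forall>j<b (Suc p). M p i j \<in> irrelevant_ideal)"

definition regular_ideal :: "nat \<Rightarrow> ('x, 'k::comm_ring_1) mpoly set \<Rightarrow> bool" where
  "regular_ideal m I \<longleftrightarrow>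
     (\<exists>b a g M. minimal_free_resolution I b a g M \<and> (\<forall>p. \<forall>j<b p. a p j \<le> m + p))"

end

theory Submission
  imports Defs "HOL-Library.FuncSet" "HOL-Library.Function_Algebras"
begin

text \<open>
  Let \<open>L\<^sub>1, L\<^sub>2, L\<^sub>3\<close> be general linear forms. As \<open>I\<^sub>Z\<close> is saturated, \<open>L\<^sub>1\<close> is a nonzerodivisor on
  \<open>R/I\<^sub>Z\<close>. As \<open>r\<^sub>2 > d\<close>, the Weak Lefschetz Property makes \<open>L\<^sub>2\<close> injective on \<open>R/(I\<^sub>Z, L\<^sub>1)\<close> up to degree \<open>d\<close>,
  so that the Hilbert function of \<open>R/(I\<^sub>Z, L\<^sub>1, L\<^sub>2)\<close> is \<open>\<Delta>\<^sup>2H\<close> there and takes the value \<open>s\<close> in degrees \<open>d\<close> and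
  \<open>d + 1\<close>. As \<open>d > r\<^sub>3\<close>, multiplication by \<open>L\<^sub>3\<close> between these two degrees is surjective, hence bijective.

  The ideal \<open>J\<close> generated by the elements of \<open>I\<^sub>Z\<close> of degree at most \<open>d\<close> agrees with \<open>I\<^sub>Z\<close> in degree \<open>d\<close>, so
  the three injectivity statements hold for \<open>J\<close> in degree \<open>d\<close>. Since \<open>J\<close> is generated in degrees at most
  \<open>d\<close>, they propagate to all larger degrees, where they say that \<open>L\<^sub>1, L\<^sub>2, L\<^sub>3\<close> behave like a regular
  sequence. This bounds the degrees of all syzygies of \<open>J\<close>, shows that \<open>J\<close> is saturated, and gives
  \<open>\<Delta>\<^sup>2H(R/J, t) = s\<close> for large \<open>t\<close>, that is, dimension two and degree \<open>s\<close>.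
\<close>

\<comment> \<open>The three forms alone cannot carry the propagation: an element of \<open>J\<close>
  of degree above \<open>d\<close> is a combination of elements of \<open>J\<close> one degree lower
  with coefficients from the whole irrelevant ideal. Hence they are completed to a basis of the
  linear forms. The added forms satisfy the condition in degree \<open>d\<close> trivially, because
  modulo \<open>J\<close> and the first three forms nothing is left there. Injectivity in one degree
  is exchanged for a statement about the intersection of \<open>J\<close> with the ideals of initial
  segments of the basis. This is a vanishing of Tor, so it passes to syzygy modules with a shift by
  one, which is the origin of the bound \<open>d + p\<close>. Two obstacles lie in the definitions.
  \<open>red_max\<close> is a definite description, so a generic value must be produced before the
  hypotheses on it say anything; this is semicontinuity of rank. Dimension is measured by chains of
  primes, whereas the argument handles Hilbert functions; orders of growth, compared along prime
  ideals, connect the two in both directions.\<close>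
alias lookup = Poly_Mapping.lookup
alias keys = Poly_Mapping.keys
alias single = Poly_Mapping.single

interpretation vs: vector_space
  "scalar_mult :: 'k::field \<Rightarrow> ('x, 'k) mpoly \<Rightarrow> ('x, 'k) mpoly"
  by (rule vector_space_scalar_mult)

interpretation idl: module "times :: 'a::comm_ring_1 \<Rightarrow> 'a \<Rightarrow> 'a"
  by (rule module_times)

(* As a simp rule it would reassociate all products of ring elements to the left. *)
declare idl.scale_scale [simp del]

section \<open>The grading\<close>

lemma lookup_scalar_mult [simp]: "lookup (scalar_mult c f) m = c * lookup f m"
proof -
  have "scalar_mult c f = Poly_Mapping.map ((*) c) f"
    by (simp add: scalar_mult_def mult_map_scale_conv_mult)
  thus ?thesis by (simp add: Poly_Mapping.map.rep_eq when_def)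
qed

lemma poly_mapping_sum_single: "f = (\<Sum>m\<in>keys f. single m (lookup f m))"
  by (rule poly_mapping_eqI)
    (auto simp: lookup_sum lookup_single when_def in_keys_iff sum.delta)

lemma mon_deg_superset:
  assumes "finite A" "keys m \<subseteq> A"
  shows "mon_deg m = (\<Sum>x\<in>A. lookup m x)"
  unfolding mon_deg_def using assms
  by (intro sum.mono_neutral_left) (auto simp: in_keys_iff)

lemma mon_deg_add: "mon_deg (m + m') = mon_deg m + mon_deg m'"
proof -
  let ?A = "keys m \<union> keys m'"
  have "keys (m + m') \<subseteq> ?A" by (auto simp: in_keys_iff lookup_add)
  hence "mon_deg (m + m') = (\<Sum>x\<in>?A. lookup (m + m') x)" by (intro mon_deg_superset) auto
  also have "\<dots> = (\<Sum>x\<in>?A. lookup m x) + (\<Sum>x\<in>?A. lookup m' x)"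
    by (simp add: lookup_add sum.distrib)
  also have "\<dots> = mon_deg m + mon_deg m'"
    by (metis finite_Un finite_keys mon_deg_superset sup_ge1 sup_ge2)
  finally show ?thesis .
qed

lemma mon_deg_0 [simp]: "mon_deg 0 = 0"
  by (simp add: mon_deg_def)

lemma mon_deg_eq_0_iff: "mon_deg m = 0 \<longleftrightarrow> m = 0"
proof
  assume "mon_deg m = 0"
  hence "\<forall>x\<in>keys m. lookup m x = 0" by (simp add: mon_deg_def)
  thus "m = 0" by (intro poly_mapping_eqI) (auto simp: in_keys_iff)
qed simp

lemma mon_deg_single [simp]: "mon_deg (single x k) = k"
  by (simp add: mon_deg_def)

lemma mon_deg_Suc:
  assumes "mon_deg m = Suc k"
  shows "\<exists>x w. m = single x 1 + w \<and> mon_deg w = k"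
proof -
  have "m \<noteq> 0" using assms by auto
  then obtain x where x: "lookup m x \<noteq> 0" by (auto simp: poly_mapping_eq_iff fun_eq_iff)
  define w where "w = m - single x 1"
  have m: "m = single x 1 + w"
    by (rule poly_mapping_eqI)
      (use x in \<open>auto simp: w_def lookup_add lookup_minus lookup_single when_def\<close>)
  hence "mon_deg w = k" using assms mon_deg_add[of "single x 1" w] by simp
  thus ?thesis using m by blast
qed

lemma mon_deg_1: "mon_deg m = Suc 0 \<Longrightarrow> \<exists>x. m = single x 1"
  using mon_deg_Suc[of m 0] by (auto simp: mon_deg_eq_0_iff)

lemma mon_split:
  assumes "mon_deg m = j + k"
  shows "\<exists>u v. m = u + v \<and> mon_deg u = j \<and> mon_deg v = k"
  using assms
proof (induction j arbitrary: m)
  case 0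
  thus ?case by (intro exI[of _ 0] exI[of _ m]) auto
next
  case (Suc j)
  then obtain x w where w: "m = single x 1 + w" "mon_deg w = j + k"
    using mon_deg_Suc[of m "j + k"] by auto
  then obtain u v where uv: "w = u + v" "mon_deg u = j" "mon_deg v = k" using Suc.IH by blast
  have "m = (single x 1 + u) + v" using w uv by (simp add: add.assoc)
  moreover have "mon_deg (single x 1 + u) = Suc j" using uv by (simp add: mon_deg_add)
  ultimately show ?case using uv(3) by blast
qed

lemma forms_iff: "f \<in> forms t \<longleftrightarrow> (\<forall>m. mon_deg m \<noteq> t \<longrightarrow> lookup f m = 0)"
  by (auto simp: forms_def in_keys_iff)

lemma zero_in_forms [simp]: "0 \<in> forms t"
  by (simp add: forms_iff)

lemma forms_add: "f \<in> forms t \<Longrightarrow> g \<in> forms t \<Longrightarrow> f + g \<in> forms t"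
  by (simp add: forms_iff lookup_add)

lemma forms_diff: "f \<in> forms t \<Longrightarrow> g \<in> forms t \<Longrightarrow> f - g \<in> forms t"
  by (simp add: forms_iff lookup_minus)

lemma forms_sum: "(\<And>i. i \<in> A \<Longrightarrow> f i \<in> forms t) \<Longrightarrow> sum f A \<in> forms t"
  by (induction A rule: infinite_finite_induct) (auto intro: forms_add)

lemma forms_scalar_mult: "f \<in> forms t \<Longrightarrow> scalar_mult c f \<in> forms t"
  by (simp add: forms_iff)

lemma single_in_forms: "mon_deg m = t \<Longrightarrow> single m c \<in> forms t"
  by (auto simp: forms_iff lookup_single when_def)

lemma forms_mult:
  assumes "f \<in> forms a" "g \<in> forms b"
  shows "f * g \<in> forms (a + b)"
  unfolding forms_def
proof safe
  fix m assume "m \<in> keys (f * g)"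
  then obtain u v where "u \<in> keys f" "v \<in> keys g" "m = u + v"
    using keys_mult[of f g] by blast
  thus "mon_deg m = a + b" using assms by (auto simp: forms_def mon_deg_add)
qed

lemma one_in_forms: "(1 :: ('x, 'k::comm_ring_1) mpoly) \<in> forms 0"
  using single_in_forms[of 0 0 "1::'k"] by simp

lemma subspace_forms: "vs.subspace (forms t)"
  by (intro vs.subspaceI) (auto intro: forms_add forms_scalar_mult)

lemma ideal_scalar_mult: "idl.subspace I \<Longrightarrow> f \<in> I \<Longrightarrow> scalar_mult c f \<in> I"
  unfolding scalar_mult_def by (rule idl.subspace_scale)

lemma ideal_vs_subspace: "idl.subspace I \<Longrightarrow> vs.subspace I"
  by (intro vs.subspaceI)
    (auto intro: idl.subspace_0 idl.subspace_add ideal_scalar_mult)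

section \<open>Homogeneous components of a polynomial\<close>

definition hcomp :: "nat \<Rightarrow> ('x, 'k::comm_ring_1) mpoly \<Rightarrow> ('x, 'k) mpoly" where
  "hcomp t f = Poly_Mapping.mapp (\<lambda>m c. c when mon_deg m = t) f"

lemma lookup_hcomp: "lookup (hcomp t f) m = (lookup f m when mon_deg m = t)"
  by (simp add: hcomp_def lookup_mapp when_def in_keys_iff)

lemma hcomp_in_forms [simp]: "hcomp t f \<in> forms t"
  by (simp add: forms_iff lookup_hcomp when_def)

lemma hcomp_add: "hcomp t (f + g) = hcomp t f + hcomp t g"
  by (rule poly_mapping_eqI) (simp add: lookup_hcomp lookup_add when_def)

lemma hcomp_diff: "hcomp t (f - g) = hcomp t f - hcomp t g"
  by (rule poly_mapping_eqI) (simp add: lookup_hcomp lookup_minus when_def)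

lemma hcomp_0 [simp]: "hcomp t 0 = 0"
  by (rule poly_mapping_eqI) (simp add: lookup_hcomp when_def)

lemma hcomp_sum: "hcomp t (sum f A) = (\<Sum>i\<in>A. hcomp t (f i))"
  by (induction A rule: infinite_finite_induct) (auto simp: hcomp_add)

lemma hcomp_forms: "f \<in> forms t \<Longrightarrow> hcomp u f = (if u = t then f else 0)"
  by (auto intro!: poly_mapping_eqI simp: lookup_hcomp forms_iff when_def)

lemma hcomp_same: "f \<in> forms t \<Longrightarrow> hcomp t f = f"
  by (simp add: hcomp_forms)

lemma hcomp_eq_0: "t \<notin> mon_deg ` keys f \<Longrightarrow> hcomp t f = 0"
  by (auto intro!: poly_mapping_eqI simp: lookup_hcomp when_def in_keys_iff image_iff)

lemma sum_hcomp:
  assumes "finite A" "mon_deg ` keys f \<subseteq> A"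
  shows "f = (\<Sum>t\<in>A. hcomp t f)"
proof (rule poly_mapping_eqI)
  fix m
  show "lookup f m = lookup (\<Sum>t\<in>A. hcomp t f) m"
    using assms
    by (cases "m \<in> keys f") (auto simp: lookup_sum lookup_hcomp when_def sum.delta in_keys_iff)
qed

lemma sum_hcomp_lessThan: "\<exists>N. \<forall>n\<ge>N. f = (\<Sum>t<n. hcomp t f)"
proof -
  obtain N where N: "mon_deg ` keys f \<subseteq> {..<N}"
    using finite_nat_iff_bounded by (meson finite_imageI finite_keys)
  have "f = (\<Sum>t<n. hcomp t f)" if "n \<ge> N" for n
    by (rule sum_hcomp) (use N that in force)+
  thus ?thesis by blast
qed

lemma hcomp_form_mult:
  assumes "g \<in> forms e"
  shows "hcomp t (g * f) = (if e \<le> t then g * hcomp (t - e) f else 0)"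
proof -
  obtain N where N: "\<forall>n\<ge>N. f = (\<Sum>i<n. hcomp i f)" using sum_hcomp_lessThan by blast
  let ?n = "N + t + 1"
  have "g * f = g * (\<Sum>i<?n. hcomp i f)" using N by (metis le_add1 add.assoc)
  also have "\<dots> = (\<Sum>i<?n. g * hcomp i f)" by (rule sum_distrib_left)
  finally have "hcomp t (g * f) = hcomp t (\<Sum>i<?n. g * hcomp i f)" by (rule arg_cong)
  also have "\<dots> = (\<Sum>i<?n. hcomp t (g * hcomp i f))" by (rule hcomp_sum)
  also have "\<dots> = (\<Sum>i<?n. if i + e = t then g * hcomp i f else 0)"
    by (intro sum.cong refl)
      (use hcomp_forms[OF forms_mult[OF assms hcomp_in_forms]] in \<open>auto simp: add.commute\<close>)
  also have "\<dots> = (\<Sum>i<?n. if i = t - e then (if e \<le> t then g * hcomp i f else 0) else 0)"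
    by (intro sum.cong refl) auto
  also have "\<dots> = (if e \<le> t then g * hcomp (t - e) f else 0)"
    by (subst sum.delta) auto
  finally show ?thesis .
qed

lemma hcomp_mult: "hcomp t (r * f) = (\<Sum>i\<le>t. hcomp i r * hcomp (t - i) f)"
proof -
  obtain N where N: "\<forall>n\<ge>N. r = (\<Sum>i<n. hcomp i r)" using sum_hcomp_lessThan by blast
  let ?n = "N + t + 1"
  have "r * f = (\<Sum>i<?n. hcomp i r) * f" using N by (metis le_add1 add.assoc)
  also have "\<dots> = (\<Sum>i<?n. hcomp i r * f)" by (rule sum_distrib_right)
  finally have "hcomp t (r * f) = hcomp t (\<Sum>i<?n. hcomp i r * f)" by (rule arg_cong)
  also have "\<dots> = (\<Sum>i<?n. hcomp t (hcomp i r * f))" by (rule hcomp_sum)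
  also have "\<dots> = (\<Sum>i<?n. if i \<le> t then hcomp i r * hcomp (t - i) f else 0)"
    by (intro sum.cong refl) (simp add: hcomp_form_mult)
  also have "\<dots> = (\<Sum>i\<le>t. hcomp i r * hcomp (t - i) f)"
    by (intro sum.mono_neutral_cong_right) auto
  finally show ?thesis .
qed

text \<open>Components of a multiple of a form are multiples of that form, and conversely the
  components of the elements serve as homogeneous generators. Closure under components is the shape
  in which homogeneity is used from here on.\<close>

lemma homogeneous_ideal_iff:
  "homogeneous_ideal I \<longleftrightarrow> idl.subspace I \<and> (\<forall>f\<in>I. \<forall>t. hcomp t f \<in> I)"
proof
  assume "homogeneous_ideal I"
  then obtain S where S: "S \<subseteq> (\<Union>t. forms t)" "I = idl.span S"
    unfolding homogeneous_ideal_def by auto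
  have "idl.subspace I" using S by simp
  moreover have "\<forall>t. hcomp t f \<in> I" if "f \<in> I" for f
    using that unfolding S(2)
  proof (induction rule: idl.span_induct_alt)
    case base
    show ?case by (simp add: idl.span_zero)
  next
    case (step r s f)
    show ?case
    proof
      fix t
      obtain e where e: "s \<in> forms e" using step(1) S by blast
      have "hcomp t (r * s + f) = (if e \<le> t then hcomp (t - e) r * s else 0) + hcomp t f"
        using hcomp_form_mult[OF e, of t r] by (simp add: hcomp_add mult.commute)
      also have "\<dots> \<in> idl.span S"
        using step by (intro idl.span_add) (simp_all add: idl.span_scale idl.span_base idl.span_zero)
      finally show "hcomp t (r * s + f) \<in> idl.span S" .
    qed
  qed
  ultimately show "idl.subspace I \<and> (\<forall>f\<in>I. \<forall>t. hcomp t f \<in> I)" by blast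
next
  assume I: "idl.subspace I \<and> (\<forall>f\<in>I. \<forall>t. hcomp t f \<in> I)"
  let ?S = "I \<inter> (\<Union>t. forms t)"
  have "idl.span ?S \<subseteq> I" using I by (intro idl.span_minimal) auto
  moreover have "I \<subseteq> idl.span ?S"
  proof
    fix f assume f: "f \<in> I"
    obtain N where N: "\<forall>n\<ge>N. f = (\<Sum>i<n. hcomp i f)" using sum_hcomp_lessThan by blast
    have "(\<Sum>i<N. hcomp i f) \<in> idl.span ?S"
      by (intro idl.span_sum idl.span_base) (use f I hcomp_in_forms in blast)
    thus "f \<in> idl.span ?S" using N by (metis order_refl)
  qed
  ultimately have "I = idl.span ?S" by blast
  thus "homogeneous_ideal I" unfolding homogeneous_ideal_def by blast
qed

lemma homogeneous_idealD:
  assumes "homogeneous_ideal I"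
  shows "idl.subspace I" "f \<in> I \<Longrightarrow> hcomp t f \<in> I"
  using assms by (auto simp: homogeneous_ideal_iff)

lemma homogeneous_ideal_subsetI:
  assumes "homogeneous_ideal I" "idl.subspace J" "\<And>t f. f \<in> forms t \<Longrightarrow> f \<in> I \<Longrightarrow> f \<in> J"
  shows "I \<subseteq> J"
proof
  fix f assume f: "f \<in> I"
  obtain N where "\<forall>n\<ge>N. f = (\<Sum>i<n. hcomp i f)" using sum_hcomp_lessThan by blast
  hence "f = (\<Sum>i<N. hcomp i f)" by blast
  moreover have "(\<Sum>i<N. hcomp i f) \<in> J"
    by (intro idl.subspace_sum assms(2) assms(3)[OF hcomp_in_forms] homogeneous_idealD(2)[OF assms(1) f])
  ultimately show "f \<in> J" by simp
qed

lemma in_ideal_if_hcomp: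
  assumes "idl.subspace I" "\<And>t. hcomp t f \<in> I"
  shows "f \<in> I"
proof -
  obtain N where "\<forall>n\<ge>N. f = (\<Sum>i<n. hcomp i f)" using sum_hcomp_lessThan by blast
  hence "f = (\<Sum>i<N. hcomp i f)" by blast
  moreover have "(\<Sum>i<N. hcomp i f) \<in> I"
    using assms by (intro idl.subspace_sum) auto
  ultimately show ?thesis by simp
qed

lemma homogeneous_ideal_span:
  "S \<subseteq> (\<Union>t. forms t) \<Longrightarrow> homogeneous_ideal (idl.span S)"
  unfolding homogeneous_ideal_def by blast

lemma ideal_eq_UNIV: "idl.subspace I \<Longrightarrow> 1 \<in> I \<Longrightarrow> I = UNIV"
  using idl.subspace_scale[of I 1] by auto

text \<open>The ideals I : g and I + (g) are the outer terms of the exact sequence 0 -> R/(I :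
  g)(-e) -> R/I -> R/(I + (g)) -> 0 for a form g of degree e. Both the counting of dimensions and
  the induction over ideals rest on this pair.\<close>

definition colon :: "'a::comm_ring_1 set \<Rightarrow> 'a \<Rightarrow> 'a set" where
  "colon I g = {f. g * f \<in> I}"

definition ideal_insert :: "'a::comm_ring_1 set \<Rightarrow> 'a \<Rightarrow> 'a set" where
  "ideal_insert I g = idl.span (insert g I)"

lemma in_colon_iff: "f \<in> colon I g \<longleftrightarrow> g * f \<in> I"
  by (simp add: colon_def)

lemma subset_colon: "idl.subspace I \<Longrightarrow> I \<subseteq> colon I g"
  by (auto simp: colon_def intro: idl.subspace_scale)

lemma in_ideal_insert_iff:
  assumes "idl.subspace I"
  shows "f \<in> ideal_insert I g \<longleftrightarrow> (\<exists>r. f - r * g \<in> I)"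
proof -
  have "idl.span I = I" using assms by (simp only: idl.span_eq_iff)
  thus ?thesis unfolding ideal_insert_def using idl.span_breakdown_eq[of f g I] by (simp only:)
qed

lemma ideal_insert_subspace: "idl.subspace (ideal_insert I g)"
  by (simp add: ideal_insert_def)

lemma subset_ideal_insert: "I \<subseteq> ideal_insert I g"
  by (auto simp: ideal_insert_def intro: idl.span_base)

lemma in_ideal_insert: "g \<in> ideal_insert I g"
  by (auto simp: ideal_insert_def intro: idl.span_base)

lemma ideal_insert_minimal: "idl.subspace J \<Longrightarrow> I \<subseteq> J \<Longrightarrow> g \<in> J \<Longrightarrow> ideal_insert I g \<subseteq> J"
  unfolding ideal_insert_def by (rule idl.span_minimal) auto

lemma homogeneous_ideal_insert:
  assumes I: "homogeneous_ideal I" and g: "g \<in> forms e"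
  shows "homogeneous_ideal (ideal_insert I g)"
  unfolding homogeneous_ideal_iff
proof (intro conjI ballI allI)
  note s = homogeneous_idealD(1)[OF I]
  fix f t assume "f \<in> ideal_insert I g"
  then obtain r where "f - r * g \<in> I" using in_ideal_insert_iff[OF s] by blast
  hence "hcomp t (f - g * r) \<in> I" using homogeneous_idealD(2)[OF I] by (simp add: mult.commute)
  hence "hcomp t f - (if e \<le> t then hcomp (t - e) r else 0) * g \<in> I"
    by (simp add: hcomp_diff hcomp_form_mult[OF g] mult.commute split: if_splits)
  thus "hcomp t f \<in> ideal_insert I g" using in_ideal_insert_iff[OF s] by blast
qed (rule ideal_insert_subspace)

lemma homogeneous_colon:
  assumes I: "homogeneous_ideal I" and g: "g \<in> forms e"
  shows "homogeneous_ideal (colon I g)"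
  unfolding homogeneous_ideal_iff
proof (intro conjI ballI allI)
  note s = homogeneous_idealD(1)[OF I]
  show "idl.subspace (colon I g)"
  proof (rule idl.subspaceI)
    fix c x assume "x \<in> colon I g"
    thus "c * x \<in> colon I g"
      using idl.subspace_scale[OF s, of "g * x" c] by (simp add: colon_def mult.left_commute)
  qed (simp_all add: colon_def distrib_left idl.subspace_0[OF s] idl.subspace_add[OF s])
  fix f t assume "f \<in> colon I g"
  hence "hcomp (t + e) (g * f) \<in> I" using homogeneous_idealD(2)[OF I] by (simp add: colon_def)
  thus "hcomp t f \<in> colon I g" by (simp add: colon_def hcomp_form_mult[OF g])
qed

section \<open>Hilbert functions\<close>

lemma finite_mon_deg: "finite {m :: 'x::finite \<Rightarrow>\<^sub>0 nat. mon_deg m = t}"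
proof -
  have "lookup m x \<le> t" if "mon_deg m = t" for m :: "'x \<Rightarrow>\<^sub>0 nat" and x
    using that member_le_sum[of x UNIV "lookup m"] mon_deg_superset[of UNIV m] by simp
  hence "lookup ` {m :: 'x \<Rightarrow>\<^sub>0 nat. mon_deg m = t} \<subseteq> (UNIV \<rightarrow>\<^sub>E {..t})" by auto
  moreover have "finite ((UNIV :: 'x set) \<rightarrow>\<^sub>E {..t})" by (rule finite_PiE) auto
  ultimately have "finite (lookup ` {m :: 'x \<Rightarrow>\<^sub>0 nat. mon_deg m = t})"
    by (rule finite_subset)
  moreover have "inj_on lookup {m :: 'x \<Rightarrow>\<^sub>0 nat. mon_deg m = t}"
    by (rule inj_onI) (rule poly_mapping_eqI, rule fun_cong)
  ultimately show ?thesis by (rule finite_imageD)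
qed

lemma forms_subset_span:
  "forms t \<subseteq> vs.span ((\<lambda>m. single m 1 :: ('x::finite, 'k::field) mpoly) ` {m. mon_deg m = t})"
proof
  fix f :: "('x, 'k) mpoly" assume f: "f \<in> forms t"
  have "f = (\<Sum>m\<in>keys f. scalar_mult (lookup f m) (single m 1))"
    using poly_mapping_sum_single[of f] by (simp add: scalar_mult_def mult_single)
  also have "\<dots> \<in> vs.span ((\<lambda>m. single m 1) ` {m. mon_deg m = t})"
    using f by (intro vs.span_sum vs.span_scale vs.span_base) (auto simp: forms_def)
  finally show "f \<in> vs.span ((\<lambda>m. single m 1) ` {m. mon_deg m = t})" .
qed

text \<open>An infinite basis has cardinality 0 by convention, so \<open>vs.dim\<close> is monotone
  only below a finitely spanned set. The polynomial ring itself is infinite-dimensional, hence the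
  explicit predicate for its graded pieces.\<close>

definition fin_dim :: "('x, 'k::field) mpoly set \<Rightarrow> bool" where
  "fin_dim V \<longleftrightarrow> (\<exists>T. finite T \<and> V \<subseteq> vs.span T)"

lemma fin_dim_forms: "fin_dim (forms t :: ('x::finite, 'k::field) mpoly set)"
  unfolding fin_dim_def using forms_subset_span finite_mon_deg by blast

lemma fin_dim_subset: "fin_dim V \<Longrightarrow> W \<subseteq> V \<Longrightarrow> fin_dim W"
  unfolding fin_dim_def by blast

lemma fin_dim_independent: "fin_dim V \<Longrightarrow> B \<subseteq> V \<Longrightarrow> vs.independent B \<Longrightarrow> finite B"
  unfolding fin_dim_def using vs.independent_span_bound by blast

lemma dim_mono_fin:
  assumes "fin_dim V" "W \<subseteq> V"
  shows "vs.dim W \<le> vs.dim V"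
proof -
  obtain B where B: "B \<subseteq> V" "vs.independent B" "V \<subseteq> vs.span B" "card B = vs.dim V"
    using vs.basis_exists by blast
  have "finite B" using fin_dim_independent assms(1) B by blast
  moreover have "W \<subseteq> vs.span B" using assms B by blast
  ultimately show ?thesis using vs.dim_le_card B(4) by metis
qed

lemma subspace_dim_eq:
  assumes "fin_dim V" "W \<subseteq> V" "vs.subspace W" "vs.dim W = vs.dim V"
  shows "W = V"
proof -
  obtain C where C: "C \<subseteq> W" "vs.independent C" "W \<subseteq> vs.span C" "card C = vs.dim W"
    using vs.basis_exists by blast
  obtain D where D: "C \<subseteq> D" "D \<subseteq> V" "vs.independent D" "V \<subseteq> vs.span D"
    using vs.maximal_independent_subset_extend[of C V] C assms(2) by blast
  have "finite D" using fin_dim_independent assms(1) D by blast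
  moreover have "card D = vs.dim V" using D vs.basis_card_eq_dim by blast
  ultimately have "C = D" using C D assms(4) by (metis card_subset_eq)
  moreover have "vs.span C \<subseteq> W" using C assms(3) vs.span_minimal by blast
  ultimately show ?thesis using D assms(2) by blast
qed

section \<open>Dimensions of quotients\<close>

lemma independent_Un:
  fixes B C :: "('x, 'k::field) mpoly set"
  assumes B: "vs.independent B" and C: "vs.independent C"
    and BC: "vs.span B \<inter> vs.span C = {0}"
  shows "vs.independent (B \<union> C)" "B \<inter> C = {}"
proof -
  have "0 \<notin> B" using B vs.dependent_zero by blast
  moreover have "x = 0" if "x \<in> B" "x \<in> C" for x
    using vs.span_base[OF that(1)] vs.span_base[OF that(2)] BC by auto
  ultimately show disj: "B \<inter> C = {}" by auto
  have key: "a \<notin> vs.span (X \<union> Y - {a})"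
    if "a \<in> X" "vs.independent X" "X \<inter> Y = {}" "vs.span X \<inter> vs.span Y = {0}"
    for a and X Y :: "('x, 'k) mpoly set"
  proof
    assume "a \<in> vs.span (X \<union> Y - {a})"
    moreover have "X \<union> Y - {a} = (X - {a}) \<union> Y" using that by blast
    ultimately obtain x y where xy: "a = x + y" "x \<in> vs.span (X - {a})" "y \<in> vs.span Y"
      by (auto simp: vs.span_Un)
    have "x \<in> vs.span X" using xy(2) vs.span_mono[of "X - {a}" X] by blast
    hence "a - x \<in> vs.span X" using that(1) by (simp add: vs.span_base vs.span_diff)
    hence "y = 0" using xy that(4) by auto
    hence "a \<in> vs.span (X - {a})" using xy by simp
    thus False using that(1,2) vs.dependent_def by blast
  qed
  show "vs.independent (B \<union> C)"
    unfolding vs.dependent_def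
    using key[of _ B C] key[of _ C B] B C BC disj by (auto simp: Un_commute Int_commute)
qed

text \<open>A common element has a single representation over \<open>D\<close>, whose support lies
  in both \<open>A\<close> and \<open>B\<close>.\<close>

lemma independent_disjoint_span:
  assumes D: "vs.independent D" and "A \<subseteq> D" "B \<subseteq> D" "A \<inter> B = {}"
  shows "vs.span A \<inter> vs.span B = {0}"
proof -
  have "x = 0" if "x \<in> vs.span A" "x \<in> vs.span B" for x
  proof -
    have "vs.representation D x = vs.representation A x" "vs.representation D x = vs.representation B x"
      by (rule vs.representation_extend[OF D that(1) assms(2)],
          rule vs.representation_extend[OF D that(2) assms(3)])
    hence "vs.representation A x b = 0" for b
      using vs.representation_ne_zero[of A x b] vs.representation_ne_zero[of B x b] assms(4) by auto
    moreover have "(\<Sum>b | vs.representation A x b \<noteq> 0. scalar_mult (vs.representation A x b) b) = x"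
      using vs.sum_nonzero_representation_eq vs.independent_mono[OF D assms(2)] that(1) by blast
    ultimately show ?thesis by simp
  qed
  thus ?thesis using vs.span_zero by blast
qed

text \<open>Together with a basis of the intersection with \<open>W\<close>, a quotient basis
  becomes a basis of \<open>V\<close>. So all quotient bases have the same size, and the choice made
  in \<open>quotient_dim\<close> does not matter.\<close>

lemma quotient_basis_card:
  assumes V: "vs.subspace V" "fin_dim V" and W: "vs.subspace W" and B: "quotient_basis V W B"
  shows "finite B" "card B + vs.dim (V \<inter> W) = vs.dim V"
proof -
  obtain C where C: "C \<subseteq> V \<inter> W" "vs.independent C" "V \<inter> W \<subseteq> vs.span C" "card C = vs.dim (V \<inter> W)"
    using vs.basis_exists by blast
  have BV: "B \<subseteq> V" and Bi: "vs.independent B" and BW: "vs.span B \<inter> W = {0}"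
    and Bs: "\<forall>v\<in>V. \<exists>b\<in>vs.span B. v - b \<in> W"
    using B by (auto simp: quotient_basis_def)
  show fB: "finite B" using fin_dim_independent V BV Bi by blast
  have fC: "finite C" using fin_dim_independent V C by blast
  have "vs.span C \<subseteq> W" using C W vs.span_minimal by blast
  hence "vs.span B \<inter> vs.span C = {0}" using BW vs.span_zero by blast
  note ind = independent_Un[OF Bi C(2) this]
  have BsV: "vs.span B \<subseteq> V" using BV V vs.span_minimal by blast
  have "V \<subseteq> vs.span (B \<union> C)"
  proof
    fix v assume v: "v \<in> V"
    then obtain b where b: "b \<in> vs.span B" "v - b \<in> W" using Bs by blast
    hence "v - b \<in> V" using BsV v V(1) vs.subspace_diff by blast
    hence "v - b \<in> vs.span C" using b C by blast
    moreover have "vs.span B \<subseteq> vs.span (B \<union> C)" "vs.span C \<subseteq> vs.span (B \<union> C)"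
      by (intro vs.span_mono; simp)+
    ultimately have "b + (v - b) \<in> vs.span (B \<union> C)" using b(1) by (intro vs.span_add) auto
    thus "v \<in> vs.span (B \<union> C)" by simp
  qed
  hence "card (B \<union> C) = vs.dim V" using ind BV C by (intro vs.basis_card_eq_dim) auto
  thus "card B + vs.dim (V \<inter> W) = vs.dim V"
    using card_Un_disjoint[OF fB fC ind(2)] C(4) by simp
qed

lemma quotient_basis_exists:
  assumes V: "vs.subspace V" and W: "vs.subspace W"
  shows "\<exists>B. quotient_basis V W B"
proof -
  obtain C where C: "C \<subseteq> V \<inter> W" "vs.independent C" "V \<inter> W \<subseteq> vs.span C"
    by (rule vs.maximal_independent_subset[of "V \<inter> W"])
  have "C \<subseteq> V" using C by blast
  then obtain D where D: "C \<subseteq> D" "D \<subseteq> V" "vs.independent D" "V \<subseteq> vs.span D"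
    using C(2) by (rule vs.maximal_independent_subset_extend)
  let ?B = "D - C"
  have BsV: "vs.span ?B \<subseteq> V" using D(2) V by (intro vs.span_minimal) auto
  have CW: "vs.span C \<subseteq> W" using C(1) W by (intro vs.span_minimal) auto
  have "vs.span ?B \<inter> vs.span C = {0}"
    using D by (intro independent_disjoint_span[of D]) auto
  hence "vs.span ?B \<inter> W = {0}" using BsV C(3) vs.span_zero[of ?B] vs.subspace_0[OF W] by blast
  moreover have "\<exists>b\<in>vs.span ?B. v - b \<in> W" if "v \<in> V" for v
  proof -
    have "D = ?B \<union> C" using D by blast
    hence "v \<in> vs.span (?B \<union> C)" using D that by auto
    then obtain x y where "v = x + y" "x \<in> vs.span ?B" "y \<in> vs.span C"
      unfolding vs.span_Un by blast
    thus ?thesis using CW by (intro bexI[of _ x]) auto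
  qed
  ultimately have "quotient_basis V W ?B"
    unfolding quotient_basis_def using D vs.independent_mono[of D ?B] by auto
  thus ?thesis by blast
qed

lemma quotient_dim:
  assumes "vs.subspace V" "fin_dim V" "vs.subspace W"
  shows "quotient_dim V W + vs.dim (V \<inter> W) = vs.dim V"
proof -
  have "quotient_basis V W (SOME B. quotient_basis V W B)"
    using quotient_basis_exists assms someI_ex by metis
  thus ?thesis unfolding quotient_dim_def using assms by (intro quotient_basis_card(2))
qed

text \<open>Stated additively, so that no subtraction of natural numbers enters the later
  counts.\<close>

lemma hilbert_fun_dim:
  assumes "idl.subspace (I :: ('x::finite, 'k::field) mpoly set)"
  shows "hilbert_fun I t + vs.dim (forms t \<inter> I) = vs.dim (forms t :: ('x, 'k) mpoly set)"
  unfolding hilbert_fun_def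
  by (intro quotient_dim subspace_forms fin_dim_forms ideal_vs_subspace assms)

lemma fin_dim_forms_Int: "fin_dim (forms t \<inter> (I :: ('x::finite, 'k::field) mpoly set))"
  using fin_dim_subset[OF fin_dim_forms] by blast

lemma hilbert_fun_mono:
  assumes I: "idl.subspace (I :: ('x::finite, 'k::field) mpoly set)" and J: "idl.subspace J"
    and sub: "forms t \<inter> I \<subseteq> J"
  shows "hilbert_fun J t \<le> hilbert_fun I t"
proof -
  have "vs.dim (forms t \<inter> I) \<le> vs.dim (forms t \<inter> J)"
    using sub by (intro dim_mono_fin fin_dim_forms_Int) auto
  thus ?thesis using hilbert_fun_dim[OF I, of t] hilbert_fun_dim[OF J, of t] by linarith
qed

lemma hilbert_fun_cong:
  assumes "idl.subspace (I :: ('x::finite, 'k::field) mpoly set)" "idl.subspace J"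
    and "forms t \<inter> I = forms t \<inter> J"
  shows "hilbert_fun I t = hilbert_fun J t"
  using assms hilbert_fun_mono[of I J t] hilbert_fun_mono[of J I t] by force

text \<open>Turns a numerical coincidence into an equality of graded pieces; this is how equal
  values of the Hilbert function will yield injectivity of a multiplication map.\<close>

lemma hilbert_fun_eq_imp:
  assumes I: "idl.subspace (I :: ('x::finite, 'k::field) mpoly set)" and J: "idl.subspace J"
    and sub: "forms t \<inter> I \<subseteq> J" and eq: "hilbert_fun I t = hilbert_fun J t"
  shows "forms t \<inter> I = forms t \<inter> J"
proof (rule subspace_dim_eq)
  show "vs.subspace (forms t \<inter> I)"
    by (intro vs.subspace_inter subspace_forms ideal_vs_subspace I)
  show "vs.dim (forms t \<inter> I) = vs.dim (forms t \<inter> J)"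
    using hilbert_fun_dim[OF I, of t] hilbert_fun_dim[OF J, of t] eq by linarith
qed (use sub fin_dim_forms_Int in auto)

lemma hilbert_fun_eq_0_iff:
  assumes I: "idl.subspace (I :: ('x::finite, 'k::field) mpoly set)"
  shows "hilbert_fun I t = 0 \<longleftrightarrow> forms t \<subseteq> I"
proof
  assume "forms t \<subseteq> I"
  hence "forms t \<inter> I = forms t" by blast
  thus "hilbert_fun I t = 0" using hilbert_fun_dim[OF I, of t] by simp
next
  assume "hilbert_fun I t = 0"
  moreover have "hilbert_fun (UNIV :: ('x, 'k) mpoly set) t = 0"
    using hilbert_fun_dim[of UNIV t] by simp
  ultimately have "forms t \<inter> I = forms t \<inter> UNIV"
    using I by (intro hilbert_fun_eq_imp) auto
  thus "forms t \<subseteq> I" by blast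
qed

text \<open>Multiplication by \<open>g\<close> maps a basis of the forms of degree \<open>t\<close>
  modulo I : g to a basis of the degree \<open>t + e\<close> piece of I + (g) modulo
  \<open>I\<close>; counting dimensions gives the exact sequence in numerical form.\<close>

lemma hilbert_fun_exact:
  assumes I: "homogeneous_ideal (I :: ('x::finite, 'k::field) mpoly set)" and g: "g \<in> forms e"
  shows "hilbert_fun I (t + e) = hilbert_fun (ideal_insert I g) (t + e) + hilbert_fun (colon I g) t"
proof -
  note sI = homogeneous_idealD(1)[OF I]
  note hc = homogeneous_colon[OF I g]
  note sc = homogeneous_idealD(1)[OF hc]
  let ?J = "ideal_insert I g" and ?V = "forms (t + e)"
  let ?U = "?V \<inter> ?J"
  obtain B where B: "quotient_basis (forms t) (colon I g) B"
    using quotient_basis_exists[OF subspace_forms ideal_vs_subspace[OF sc]] by blast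
  have cB: "card B + vs.dim (forms t \<inter> colon I g) = vs.dim (forms t :: ('x, 'k) mpoly set)"
    using quotient_basis_card(2)[OF subspace_forms fin_dim_forms ideal_vs_subspace[OF sc] B] .
  have Bf: "B \<subseteq> forms t" and Bi: "vs.independent B" and BW: "vs.span B \<inter> colon I g = {0}"
    and Bs: "\<forall>v\<in>forms t. \<exists>b\<in>vs.span B. v - b \<in> colon I g"
    using B by (auto simp: quotient_basis_def)
  interpret m: module_hom scalar_mult scalar_mult "(*) g"
    by unfold_locales (simp_all add: scalar_mult_def algebra_simps single_add mult_single)
  have inj: "inj_on ((*) g) (vs.span B)"
  proof (rule inj_onI)
    fix x y assume xy: "x \<in> vs.span B" "y \<in> vs.span B" "g * x = g * y"
    hence "x - y \<in> colon I g" using idl.subspace_0[OF sI] by (simp add: in_colon_iff right_diff_distrib)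
    moreover have "x - y \<in> vs.span B" using xy by (intro vs.span_diff)
    ultimately have "x - y = 0" using BW by blast
    thus "x = y" by simp
  qed
  have "quotient_basis ?U I ((*) g ` B)"
    unfolding quotient_basis_def
  proof (intro conjI ballI)
    show "(*) g ` B \<subseteq> ?U"
    proof
      fix y assume "y \<in> (*) g ` B"
      then obtain b where b: "b \<in> B" "y = g * b" by blast
      have "g * b \<in> ?V" using forms_mult[OF g, of b t] Bf b by (auto simp: add.commute)
      moreover have "g * b \<in> ?J"
        using idl.subspace_scale[OF ideal_insert_subspace in_ideal_insert[of g I], of b]
        by (simp add: mult.commute)
      ultimately show "y \<in> ?U" using b by blast
    qed
    show "vs.independent ((*) g ` B)" by (rule m.independent_injective_image[OF Bi inj])
    have "x = 0" if "x \<in> (*) g ` vs.span B" "x \<in> I" for x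
    proof -
      obtain b where b: "b \<in> vs.span B" "x = g * b" using \<open>x \<in> (*) g ` vs.span B\<close> by blast
      hence "b \<in> colon I g" using \<open>x \<in> I\<close> by (simp add: in_colon_iff)
      hence "b = 0" using BW b(1) by blast
      thus ?thesis using b(2) by simp
    qed
    thus "vs.span ((*) g ` B) \<inter> I = {0}"
      using m.span_image[of B] idl.subspace_0[OF sI] vs.span_zero[of "(*) g ` B"] by auto
    fix v assume v: "v \<in> ?U"
    then obtain r where "v - r * g \<in> I" using in_ideal_insert_iff[OF sI] by blast
    hence "hcomp (t + e) (v - g * r) \<in> I" using homogeneous_idealD(2)[OF I] by (simp add: mult.commute)
    hence *: "v - g * hcomp t r \<in> I" using v
      by (simp add: hcomp_diff hcomp_form_mult[OF g] hcomp_same)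
    obtain b where b: "b \<in> vs.span B" "hcomp t r - b \<in> colon I g" using Bs hcomp_in_forms by blast
    have "(v - g * hcomp t r) + g * (hcomp t r - b) \<in> I"
      using * b(2) by (intro idl.subspace_add[OF sI]) (simp_all add: in_colon_iff)
    hence "v - g * b \<in> I" by (simp add: right_diff_distrib)
    thus "\<exists>b\<in>vs.span ((*) g ` B). v - b \<in> I" using b(1) m.span_image[of B] by auto
  qed
  moreover have "vs.subspace ?U"
    by (intro vs.subspace_inter subspace_forms ideal_vs_subspace ideal_insert_subspace)
  ultimately have "card ((*) g ` B) + vs.dim (?U \<inter> I) = vs.dim ?U"
    using fin_dim_forms_Int ideal_vs_subspace[OF sI] by (intro quotient_basis_card(2)) auto
  moreover have "card ((*) g ` B) = card B"
    using inj vs.span_superset by (intro card_image) (rule inj_on_subset)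
  moreover have "?U \<inter> I = ?V \<inter> I" using subset_ideal_insert[of I g] by blast
  ultimately have "card B + vs.dim (?V \<inter> I) = vs.dim ?U" by simp
  moreover note hilbert_fun_dim[OF sI, of "t + e"] hilbert_fun_dim[OF ideal_insert_subspace[of I g], of "t + e"]
    hilbert_fun_dim[OF sc, of t] cB
  ultimately show ?thesis by linarith
qed

lemma hilbert_fun_UNIV: "hilbert_fun (UNIV :: ('x::finite, 'k::field) mpoly set) t = 0"
  by (simp add: hilbert_fun_eq_0_iff)

section \<open>Noetherian induction for homogeneous ideals\<close>

text \<open>
  Integer polynomials are linearly ordered by the sign of the leading coefficient, so weights give
  an additive (lexicographic) total order on the monomials.
\<close>

definition weight :: "('x \<Rightarrow> nat) \<Rightarrow> ('x \<Rightarrow>\<^sub>0 nat) \<Rightarrow> int poly" where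
  "weight e m = (\<Sum>x\<in>keys m. monom (int (lookup m x)) (e x))"

lemma weight_superset:
  assumes "finite A" "keys m \<subseteq> A"
  shows "weight e m = (\<Sum>x\<in>A. monom (int (lookup m x)) (e x))"
  unfolding weight_def using assms
  by (intro sum.mono_neutral_left) (auto simp: in_keys_iff)

lemma weight_add: "weight e (m + m') = weight e m + weight e m'"
proof -
  let ?A = "keys m \<union> keys m'"
  have "keys (m + m') \<subseteq> ?A" by (auto simp: in_keys_iff lookup_add)
  hence "weight e (m + m') = (\<Sum>x\<in>?A. monom (int (lookup (m + m') x)) (e x))"
    by (intro weight_superset) auto
  also have "\<dots> = (\<Sum>x\<in>?A. monom (int (lookup m x)) (e x)) + (\<Sum>x\<in>?A. monom (int (lookup m' x)) (e x))"
    by (simp add: lookup_add sum.distrib flip: add_monom)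
  also have "\<dots> = weight e m + weight e m'"
    using weight_superset[of ?A m e] weight_superset[of ?A m' e] by simp
  finally show ?thesis .
qed

lemma coeff_weight:
  assumes "inj_on e A" "finite A" "keys m \<subseteq> A" "x \<in> A"
  shows "coeff (weight e m) (e x) = int (lookup m x)"
proof -
  have "coeff (weight e m) (e x) = (\<Sum>y\<in>A. coeff (monom (int (lookup m y)) (e y)) (e x))"
    using weight_superset[OF assms(2,3)] by (simp add: coeff_sum)
  also have "\<dots> = (\<Sum>y\<in>A. if y = x then int (lookup m y) else 0)"
    using assms by (intro sum.cong refl) (auto simp: inj_on_def)
  also have "\<dots> = int (lookup m x)" using assms by (simp add: sum.delta)
  finally show ?thesis .
qed

lemma weight_inj:
  assumes e: "inj_on e (keys m \<union> keys m')" and eq: "weight e m = weight e m'"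
  shows "m = m'"
proof (rule poly_mapping_eqI)
  fix x
  show "lookup m x = lookup m' x"
  proof (cases "x \<in> keys m \<union> keys m'")
    case True
    thus ?thesis using coeff_weight[OF e _ _ True, of m] coeff_weight[OF e _ _ True, of m'] eq by simp
  qed (auto simp: in_keys_iff)
qed

definition var_index :: "'x::finite \<Rightarrow> nat" where
  "var_index = (SOME f. inj f)"

lemma inj_var_index: "inj (var_index :: 'x::finite \<Rightarrow> nat)"
proof -
  have "\<exists>f. inj (f :: 'x \<Rightarrow> nat)"
    using finite_imp_inj_to_nat_seg[of "UNIV :: 'x set"] by auto
  thus ?thesis unfolding var_index_def by (rule someI_ex)
qed

abbreviation mon_weight :: "('x::finite \<Rightarrow>\<^sub>0 nat) \<Rightarrow> int poly" where
  "mon_weight \<equiv> weight var_index"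

lemma mon_weight_inj: "mon_weight m = mon_weight m' \<Longrightarrow> m = m'"
  by (rule weight_inj[of var_index]) (auto intro: inj_on_subset[OF inj_var_index])

section \<open>Leading monomials\<close>

definition is_lead_mon :: "('x::finite, 'k::zero) mpoly \<Rightarrow> ('x \<Rightarrow>\<^sub>0 nat) \<Rightarrow> bool" where
  "is_lead_mon f m \<longleftrightarrow> m \<in> keys f \<and> (\<forall>m'\<in>keys f. mon_weight m' \<le> mon_weight m)"

lemma lead_mon_exists:
  assumes "f \<noteq> 0"
  shows "\<exists>m. is_lead_mon f m"
proof -
  have ne: "keys f \<noteq> {}" using assms by simp
  have "Max (mon_weight ` keys f) \<in> mon_weight ` keys f" using ne by (intro Max_in) auto
  then obtain m where m: "m \<in> keys f" "mon_weight m = Max (mon_weight ` keys f)" by auto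
  have "mon_weight m' \<le> mon_weight m" if "m' \<in> keys f" for m'
    using that m(2) by simp
  thus ?thesis unfolding is_lead_mon_def using m(1) by auto
qed

lemma lookup_single_mult: "lookup (single u c * f) (u + m) = c * lookup f m"
  for f :: "('x, 'k::comm_ring_1) mpoly"
proof -
  have "single u c * f = single u c * (\<Sum>v\<in>keys f. single v (lookup f v))"
    using poly_mapping_sum_single[of f] by simp
  also have "\<dots> = (\<Sum>v\<in>keys f. single (u + v) (c * lookup f v))"
    by (simp add: sum_distrib_left mult_single)
  finally have "lookup (single u c * f) (u + m) = (\<Sum>v\<in>keys f. lookup (single (u + v) (c * lookup f v)) (u + m))"
    by (simp add: lookup_sum)
  also have "\<dots> = (\<Sum>v\<in>keys f. if v = m then c * lookup f v else 0)"
    by (intro sum.cong refl) (auto simp: lookup_single when_def)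
  also have "\<dots> = c * lookup f m" by (auto simp: sum.delta in_keys_iff)
  finally show ?thesis .
qed

lemma lead_mon_single_mult:
  fixes f :: "('x::finite, 'k::comm_ring_1) mpoly"
  assumes "is_lead_mon f m"
  shows "is_lead_mon (single u 1 * f) (u + m)"
  unfolding is_lead_mon_def
proof (intro conjI ballI)
  show "u + m \<in> keys (single u 1 * f)"
    using assms by (simp add: is_lead_mon_def in_keys_iff lookup_single_mult)
  fix m' assume "m' \<in> keys (single u 1 * f)"
  then obtain v where "v \<in> keys f" "m' = u + v" using keys_mult[of "single u 1" f] by auto
  thus "mon_weight m' \<le> mon_weight (u + m)" using assms by (simp add: is_lead_mon_def weight_add)
qed

text \<open>Among the forms of one degree in \<open>J\<close> outside \<open>I\<close>, take one
  with the smallest leading monomial. If a form of \<open>I\<close> of that degree had the same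
  leading monomial, cancelling it would leave a form in \<open>J\<close> outside \<open>I\<close>
  with a smaller one.\<close>

lemma new_lead_mon:
  fixes I J :: "('x::finite, 'k::field) mpoly set"
  assumes I: "homogeneous_ideal I" and J: "homogeneous_ideal J" and IJ: "I \<subset> J"
  shows "\<exists>f m t. f \<in> J \<and> f \<in> forms t \<and> is_lead_mon f m \<and> (\<forall>g\<in>I. g \<in> forms t \<longrightarrow> \<not> is_lead_mon g m)"
proof -
  note sI = homogeneous_idealD(1)[OF I] and sJ = homogeneous_idealD(1)[OF J]
  have "\<not> J \<subseteq> I" using IJ by blast
  then obtain t f0 where f0: "f0 \<in> forms t" "f0 \<in> J" "f0 \<notin> I"
    using homogeneous_ideal_subsetI[OF J sI] by blast
  let ?M = "{m. \<exists>f. f \<in> J \<and> f \<in> forms t \<and> f \<notin> I \<and> is_lead_mon f m}"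
  have "?M \<subseteq> {m. mon_deg m = t}" by (auto simp: is_lead_mon_def forms_def)
  hence fin: "finite ?M" using finite_mon_deg finite_subset by blast
  have "f0 \<noteq> 0" using f0 idl.subspace_0[OF sI] by auto
  hence ne: "?M \<noteq> {}" using lead_mon_exists[of f0] f0 by auto
  have "Min (mon_weight ` ?M) \<in> mon_weight ` ?M" using fin ne by (intro Min_in) auto
  then obtain m where mw: "Min (mon_weight ` ?M) = mon_weight m" and m: "m \<in> ?M" by (rule imageE)
  have min: "mon_weight m \<le> mon_weight m'" if "m' \<in> ?M" for m'
    unfolding mw[symmetric] using fin that by (intro Min_le finite_imageI imageI)
  obtain f where f: "f \<in> J" "f \<in> forms t" "f \<notin> I" "is_lead_mon f m" using m by auto
  have "\<not> is_lead_mon g m" if g: "g \<in> I" "g \<in> forms t" for g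
  proof
    assume lg: "is_lead_mon g m"
    define h where "h = f - scalar_mult (lookup f m / lookup g m) g"
    have gI: "scalar_mult c g \<in> I" for c using ideal_scalar_mult[OF sI g(1)] .
    have "h \<in> J" unfolding h_def using gI IJ f by (intro idl.subspace_diff[OF sJ]) auto
    moreover have "h \<in> forms t" unfolding h_def using f g by (intro forms_diff forms_scalar_mult)
    moreover have "h \<notin> I"
    proof
      assume "h \<in> I"
      hence "h + scalar_mult (lookup f m / lookup g m) g \<in> I" using gI by (rule idl.subspace_add[OF sI])
      thus False using f by (simp add: h_def)
    qed
    moreover have "h \<noteq> 0" using \<open>h \<notin> I\<close> idl.subspace_0[OF sI] by auto
    ultimately obtain m' where m': "m' \<in> ?M" "is_lead_mon h m'" using lead_mon_exists by blast
    have "lookup g m \<noteq> 0" using lg by (simp add: is_lead_mon_def in_keys_iff)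
    hence "lookup h m = 0" by (simp add: h_def lookup_minus)
    hence "m' \<noteq> m" using m'(2) by (auto simp: is_lead_mon_def in_keys_iff)
    have "m' \<in> keys f \<or> m' \<in> keys g"
      using m'(2) by (auto simp: is_lead_mon_def in_keys_iff h_def lookup_minus)
    hence "mon_weight m' \<le> mon_weight m" using f(4) lg by (auto simp: is_lead_mon_def)
    with min[OF m'(1)] have "mon_weight m' = mon_weight m" by simp
    with \<open>m' \<noteq> m\<close> show False using mon_weight_inj by blast
  qed
  with f show ?thesis by blast
qed

section \<open>Dickson's lemma and the ascending chain condition\<close>

lemma incseq_subseq:
  fixes s :: "nat \<Rightarrow> nat"
  shows "\<exists>g. strict_mono g \<and> incseq (\<lambda>i. s (g i))"
proof -
  obtain g where g: "strict_mono (g :: nat \<Rightarrow> nat)" "monoseq (\<lambda>n. s (g n))"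
    using seq_monosub[of s] by blast
  consider "incseq (\<lambda>n. s (g n))" | "decseq (\<lambda>n. s (g n))"
    using g(2) by (auto simp: monoseq_iff)
  thus ?thesis
  proof cases
    case 1
    thus ?thesis using g by blast
  next
    case 2
    obtain N where N: "\<And>n. s (g N) \<le> s (g n)"
      using ex_has_least_nat[of "\<lambda>_. True" 0 "\<lambda>n. s (g n)"] by auto
    have "s (g (i + N)) = s (g N)" for i
      using N[of "i + N"] decseqD[OF 2, of N "i + N"] by simp
    hence "incseq (\<lambda>i. s (g (i + N)))" by (simp add: incseq_def)
    moreover have "strict_mono (\<lambda>i. g (i + N))" using g(1) by (simp add: strict_mono_def)
    ultimately show ?thesis by blast
  qed
qed

lemma dickson_subseq:
  fixes m :: "nat \<Rightarrow> 'x \<Rightarrow> nat"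
  assumes "finite A"
  shows "\<exists>r. strict_mono r \<and> (\<forall>x\<in>A. incseq (\<lambda>i. m (r i) x))"
  using assms
proof (induction A)
  case empty
  show ?case using strict_mono_id by blast
next
  case (insert a A)
  then obtain r where r: "strict_mono r" "\<forall>x\<in>A. incseq (\<lambda>i. m (r i) x)" by blast
  obtain g where g: "strict_mono g" "incseq (\<lambda>i. m (r (g i)) a)"
    using incseq_subseq[of "\<lambda>i. m (r i) a"] by blast
  have "strict_mono (\<lambda>i. r (g i))" using r g by (simp add: strict_mono_def)
  moreover have "incseq (\<lambda>i. m (r (g i)) x)" if "x \<in> A" for x
    using r(2) that strict_mono_mono[OF g(1)] by (auto simp: incseq_def mono_def)
  ultimately show ?case using g(2) by auto
qed

text \<open>Every step contributes a leading monomial that is new in its degree. By Dickson's lemma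
  one of them divides a later one; the corresponding monomial multiple of the earlier form already
  lies in the later ideal and has that allegedly new leading monomial.\<close>

lemma no_ascending_chain:
  fixes I :: "nat \<Rightarrow> ('x::finite, 'k::field) mpoly set"
  assumes hI: "\<And>i. homogeneous_ideal (I i)" and asc: "\<And>i. I i \<subset> I (Suc i)"
  shows False
proof -
  have "\<forall>i. \<exists>f m t. f \<in> I (Suc i) \<and> f \<in> forms t \<and> is_lead_mon f m \<and>
      (\<forall>g\<in>I i. g \<in> forms t \<longrightarrow> \<not> is_lead_mon g m)"
    using new_lead_mon[OF hI hI asc] by blast
  then obtain f m t where f: "\<And>i. f i \<in> I (Suc i)" "\<And>i. f i \<in> forms (t i)" "\<And>i. is_lead_mon (f i) (m i)"
    and new: "\<And>i g. g \<in> I i \<Longrightarrow> g \<in> forms (t i) \<Longrightarrow> \<not> is_lead_mon g (m i)"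
    by metis
  obtain r where r: "strict_mono r" "\<And>x. incseq (\<lambda>i. lookup (m (r i)) x)"
    using dickson_subseq[of "UNIV :: 'x set" "\<lambda>i. lookup (m i)"] by auto
  define i j where "i = r 0" and "j = r 1"
  have ij: "i < j" using r(1) by (simp add: i_def j_def strict_mono_def)
  have le: "lookup (m i) x \<le> lookup (m j) x" for x
    using r(2)[of x] by (simp add: i_def j_def incseq_def)
  define u where "u = m j - m i"
  have um: "u + m i = m j"
    by (rule poly_mapping_eqI) (use le in \<open>simp add: u_def lookup_add lookup_minus\<close>)
  have mono: "I a \<subseteq> I b" if "a \<le> b" for a b
    using asc lift_Suc_mono_le[of I a b] that by blast
  have "single u 1 * f i \<in> I j"
    using f(1)[of i] mono[of "Suc i" j] ij
    by (intro idl.subspace_scale homogeneous_idealD(1)[OF hI]) auto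
  moreover have "mon_deg (m i) = t i" for i using f(2,3)[of i] by (auto simp: is_lead_mon_def forms_def)
  hence "t j = mon_deg u + t i" using um mon_deg_add[of u "m i"] by simp
  hence "single u 1 * f i \<in> forms (t j)" using forms_mult[OF single_in_forms[OF refl] f(2)] by metis
  ultimately show False using new lead_mon_single_mult[OF f(3)[of i], of u] um by simp
qed

lemma homogeneous_ideal_wf_induct:
  fixes I :: "('x::finite, 'k::field) mpoly set"
  assumes I: "homogeneous_ideal I"
    and step: "\<And>I. homogeneous_ideal I \<Longrightarrow> (\<And>J. homogeneous_ideal J \<Longrightarrow> I \<subset> J \<Longrightarrow> P J) \<Longrightarrow> P I"
  shows "P I"
proof -
  let ?R = "{(J, I). homogeneous_ideal I \<and> homogeneous_ideal J \<and> (I :: ('x, 'k) mpoly set) \<subset> J}"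
  have "wf ?R" unfolding wf_iff_no_infinite_down_chain using no_ascending_chain by blast
  hence "homogeneous_ideal I \<longrightarrow> P I"
    by (induction I rule: wf_induct_rule) (use step in blast)
  thus ?thesis using I by blast
qed

text \<open>In contrast to the members of \<open>proj_points\<close>, such a prime may contain the
  irrelevant ideal. The induction over ideals ends in primes of both kinds.\<close>

definition homogeneous_prime :: "('x, 'k::comm_ring_1) mpoly set \<Rightarrow> bool" where
  "homogeneous_prime P \<longleftrightarrow> homogeneous_ideal P \<and> P \<noteq> UNIV \<and> (\<forall>f g. f * g \<in> P \<longrightarrow> f \<in> P \<or> g \<in> P)"

lemma max_hcomp_notin:
  assumes I: "idl.subspace I" and f: "f \<notin> I"
  shows "\<exists>a. hcomp a f \<notin> I \<and> (\<forall>i>a. hcomp i f \<in> I)"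
proof -
  let ?A = "{a. hcomp a f \<notin> I}"
  have "?A \<subseteq> mon_deg ` keys f" using hcomp_eq_0[of _ f] idl.subspace_0[OF I] by (auto simp: image_iff) metis
  hence fin: "finite ?A" by (rule finite_subset) simp
  moreover have ne: "?A \<noteq> {}" using in_ideal_if_hcomp[OF I] f by blast
  ultimately have "Max ?A \<in> ?A" by (rule Max_in)
  moreover have "hcomp i f \<in> I" if "i > Max ?A" for i
    using that Max_ge[OF fin, of i] by force
  ultimately show ?thesis by blast
qed

text \<open>For \<open>f\<close> and \<open>g\<close> outside \<open>I\<close> let \<open>a\<close>
  and \<open>b\<close> be the top degrees of components outside \<open>I\<close>. In degree
  \<open>a + b\<close> of the product, every other summand has a factor in \<open>I\<close>, so the
  product of these two components lies in \<open>I\<close> as well.\<close>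

lemma homogeneous_primeI:
  assumes I: "homogeneous_ideal I" "I \<noteq> UNIV"
    and prime: "\<And>a b f g. f \<in> forms a \<Longrightarrow> g \<in> forms b \<Longrightarrow> f * g \<in> I \<Longrightarrow> f \<in> I \<or> g \<in> I"
  shows "homogeneous_prime I"
proof -
  note sI = homogeneous_idealD(1)[OF I(1)]
  have False if fg: "f * g \<in> I" and f: "f \<notin> I" and g: "g \<notin> I" for f g
  proof -
    obtain a where a: "hcomp a f \<notin> I" "\<And>i. i > a \<Longrightarrow> hcomp i f \<in> I" using max_hcomp_notin[OF sI f] by blast
    obtain b where b: "hcomp b g \<notin> I" "\<And>i. i > b \<Longrightarrow> hcomp i g \<in> I" using max_hcomp_notin[OF sI g] by blast
    let ?s = "\<lambda>i. hcomp i f * hcomp (a + b - i) g"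
    have s: "?s i \<in> I" if "i \<noteq> a" "i \<le> a + b" for i
    proof (cases "i > a")
      case True
      from idl.subspace_scale[OF sI a(2)[OF this], of "hcomp (a + b - i) g"]
      show ?thesis by (simp add: mult.commute)
    next
      case False
      hence "a + b - i > b" using that by simp
      thus ?thesis using idl.subspace_scale[OF sI b(2)] by blast
    qed
    have "hcomp (a + b) (f * g) = ?s a + (\<Sum>i\<in>{..a + b} - {a}. ?s i)"
      unfolding hcomp_mult by (intro sum.remove) auto
    moreover have "(\<Sum>i\<in>{..a + b} - {a}. ?s i) \<in> I" using s by (intro idl.subspace_sum[OF sI]) auto
    moreover have "hcomp (a + b) (f * g) \<in> I" by (rule homogeneous_idealD(2)[OF I(1) fg])
    ultimately have "?s a + (\<Sum>i\<in>{..a + b} - {a}. ?s i) - (\<Sum>i\<in>{..a + b} - {a}. ?s i) \<in> I"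
      by (intro idl.subspace_diff[OF sI]) simp_all
    hence "?s a \<in> I" by simp
    thus False using prime[OF hcomp_in_forms hcomp_in_forms, of a f b g] a b by simp
  qed
  thus ?thesis unfolding homogeneous_prime_def using I by blast
qed

text \<open>A proper ideal that is not prime has a form \<open>f\<close> for which both I + (f) and
  I : f are strictly larger, so Noetherian induction applies to both. This takes the place of prime
  filtrations and primary decomposition.\<close>

lemma homogeneous_ideal_prime_induct [consumes 1, case_names UNIV prime step]:
  fixes I :: "('x::finite, 'k::field) mpoly set"
  assumes I: "homogeneous_ideal I" and UNIV: "P UNIV"
    and prime: "\<And>I. homogeneous_prime I \<Longrightarrow> P I"
    and step: "\<And>I f e. homogeneous_ideal I \<Longrightarrow> f \<in> forms e \<Longrightarrow> P (ideal_insert I f) \<Longrightarrow> P (colon I f) \<Longrightarrow> P I"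
  shows "P I"
  using I
proof (rule homogeneous_ideal_wf_induct)
  fix I :: "('x, 'k) mpoly set"
  assume I: "homogeneous_ideal I" and IH: "\<And>J. homogeneous_ideal J \<Longrightarrow> I \<subset> J \<Longrightarrow> P J"
  note sI = homogeneous_idealD(1)[OF I]
  show "P I"
  proof (cases "I = UNIV \<or> homogeneous_prime I")
    case True
    thus ?thesis using UNIV prime by auto
  next
    case False
    then obtain a b f g where fg: "f \<in> forms a" "g \<in> forms b" "f * g \<in> I" "f \<notin> I" "g \<notin> I"
      using homogeneous_primeI[OF I] by blast
    have "I \<subset> ideal_insert I f" using subset_ideal_insert[of I f] in_ideal_insert[of f I] fg by blast
    moreover have "I \<subset> colon I f" using subset_colon[OF sI, of f] fg by (auto simp: in_colon_iff)
    ultimately show ?thesis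
      using step[OF I fg(1)] IH homogeneous_ideal_insert[OF I fg(1)] homogeneous_colon[OF I fg(1)] by blast
  qed
qed

section \<open>Evaluation and general linear forms\<close>

definition mono_val :: "('v \<Rightarrow> 'r::comm_ring_1) \<Rightarrow> ('v \<Rightarrow>\<^sub>0 nat) \<Rightarrow> 'r" where
  "mono_val \<sigma> m = (\<Prod>v\<in>keys m. \<sigma> v ^ lookup m v)"

lemma mono_val_superset:
  assumes "finite A" "keys m \<subseteq> A"
  shows "mono_val \<sigma> m = (\<Prod>v\<in>A. \<sigma> v ^ lookup m v)"
  unfolding mono_val_def using assms
  by (intro prod.mono_neutral_left) (auto simp: in_keys_iff)

lemma mono_val_add: "mono_val \<sigma> (m + m') = mono_val \<sigma> m * mono_val \<sigma> m'"
proof -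
  let ?A = "keys m \<union> keys m'"
  have "keys (m + m') \<subseteq> ?A" by (auto simp: in_keys_iff lookup_add)
  hence "mono_val \<sigma> (m + m') = (\<Prod>v\<in>?A. \<sigma> v ^ lookup (m + m') v)" by (intro mono_val_superset) auto
  also have "\<dots> = (\<Prod>v\<in>?A. \<sigma> v ^ lookup m v) * (\<Prod>v\<in>?A. \<sigma> v ^ lookup m' v)"
    by (simp add: lookup_add power_add prod.distrib)
  also have "\<dots> = mono_val \<sigma> m * mono_val \<sigma> m'"
    using mono_val_superset[of ?A m \<sigma>] mono_val_superset[of ?A m' \<sigma>] by simp
  finally show ?thesis .
qed

lemma mono_val_0 [simp]: "mono_val \<sigma> 0 = 1"
  by (simp add: mono_val_def)

lemma mono_val_single [simp]: "mono_val \<sigma> (single v 1) = \<sigma> v"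
  by (simp add: mono_val_def)

text \<open>Evaluation is needed with two targets: the field, for polynomials in the coefficients of
  general forms, and the polynomial ring, for linear substitutions of the variables.\<close>

locale coeff_hom =
  fixes h :: "'k::comm_ring_1 \<Rightarrow> 'r::comm_ring_1"
  assumes h_add: "h (a + b) = h a + h b" and h_mult: "h (a * b) = h a * h b" and h_1: "h 1 = 1"
begin

lemma h_0: "h 0 = 0"
  using h_add[of 0 0] by simp

definition insertion :: "('v \<Rightarrow> 'r) \<Rightarrow> ('v, 'k) mpoly \<Rightarrow> 'r" where
  "insertion \<sigma> F = (\<Sum>m\<in>keys F. h (lookup F m) * mono_val \<sigma> m)"

lemma insertion_superset:
  assumes "finite A" "keys F \<subseteq> A"
  shows "insertion \<sigma> F = (\<Sum>m\<in>A. h (lookup F m) * mono_val \<sigma> m)"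
  unfolding insertion_def using assms
  by (intro sum.mono_neutral_left) (auto simp: in_keys_iff h_0)

lemma insertion_add: "insertion \<sigma> (F + G) = insertion \<sigma> F + insertion \<sigma> G"
proof -
  let ?A = "keys F \<union> keys G"
  have "keys (F + G) \<subseteq> ?A" by (rule keys_add)
  thus ?thesis
    using insertion_superset[of ?A "F + G" \<sigma>] insertion_superset[of ?A F \<sigma>] insertion_superset[of ?A G \<sigma>]
    by (simp add: lookup_add h_add distrib_right sum.distrib)
qed

lemma insertion_0 [simp]: "insertion \<sigma> 0 = 0"
  by (simp add: insertion_def)

lemma insertion_sum: "insertion \<sigma> (sum f A) = (\<Sum>i\<in>A. insertion \<sigma> (f i))"
  by (induction A rule: infinite_finite_induct) (auto simp: insertion_add)

lemma insertion_single: "insertion \<sigma> (single m c) = h c * mono_val \<sigma> m"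
  by (simp add: insertion_def h_0)

lemma insertion_1 [simp]: "insertion \<sigma> 1 = 1"
  using insertion_single[of \<sigma> 0 1] by (simp add: h_1)

lemma insertion_mult: "insertion \<sigma> (F * G) = insertion \<sigma> F * insertion \<sigma> G"
proof -
  have "F * G = (\<Sum>m\<in>keys F. single m (lookup F m)) * (\<Sum>m\<in>keys G. single m (lookup G m))"
    using poly_mapping_sum_single[of F] poly_mapping_sum_single[of G] by simp
  also have "\<dots> = (\<Sum>m\<in>keys F. \<Sum>m'\<in>keys G. single (m + m') (lookup F m * lookup G m'))"
    by (simp add: sum_product mult_single)
  finally have "insertion \<sigma> (F * G) = insertion \<sigma> (\<Sum>m\<in>keys F. \<Sum>m'\<in>keys G. single (m + m') (lookup F m * lookup G m'))"
    by (rule arg_cong)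
  also have "\<dots> = (\<Sum>m\<in>keys F. \<Sum>m'\<in>keys G. h (lookup F m) * mono_val \<sigma> m * (h (lookup G m') * mono_val \<sigma> m'))"
    by (simp add: insertion_sum insertion_single h_mult mono_val_add ac_simps)
  also have "\<dots> = insertion \<sigma> F * insertion \<sigma> G"
    by (simp add: insertion_def sum_product)
  finally show ?thesis .
qed

end

interpretation eval: coeff_hom "\<lambda>x :: 'k::comm_ring_1. x"
  by unfold_locales auto

lemma mpoly_eval_eq: "mpoly_eval F c = eval.insertion c F"
  by (simp add: mpoly_eval_def eval.insertion_def mono_val_def)

text \<open>Distinct monomials have distinct weight polynomials. The finitely many nonzero
  differences have finitely many roots, and any natural number that is not a root separates all the
  monomials.\<close>

lemma weights_separated_at_nat:
  fixes M :: "('v \<Rightarrow>\<^sub>0 nat) set"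
  assumes "finite M"
  shows "\<exists>(e :: 'v \<Rightarrow> nat) B. inj_on (\<lambda>m. poly (weight e m) (int B)) M"
proof -
  let ?V = "\<Union>m\<in>M. keys m"
  have "finite ?V" using assms by auto
  then obtain e :: "'v \<Rightarrow> nat" where e: "inj_on e ?V"
    using finite_imp_inj_to_nat_seg[of ?V] by auto
  define X where "X = {x \<in> M \<times> M. fst x \<noteq> snd x}"
  define q where "q x = weight e (fst x) - weight e (snd x)" for x
  have finX: "finite X" using assms by (simp add: X_def)
  have nz: "q x \<noteq> 0" if x: "x \<in> X" for x
  proof
    assume "q x = 0"
    hence eq: "weight e (fst x) = weight e (snd x)" by (simp add: q_def)
    have "inj_on e (keys (fst x) \<union> keys (snd x))"
      by (rule inj_on_subset[OF e]) (use x in \<open>auto simp: X_def\<close>)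
    from weight_inj[OF this eq] show False using x by (simp add: X_def)
  qed
  have "finite (\<Union>x\<in>X. {n. poly (q x) (int n) = 0})"
  proof (rule finite_UN_I[OF finX])
    fix x assume "x \<in> X"
    hence "finite {z. poly (q x) z = 0}" by (intro poly_roots_finite nz)
    hence "finite (int -` {z. poly (q x) z = 0})" by (rule finite_vimageI) simp
    thus "finite {n. poly (q x) (int n) = 0}" by (simp add: vimage_def)
  qed
  then obtain B :: nat where "B \<notin> (\<Union>x\<in>X. {n. poly (q x) (int n) = 0})"
    using ex_new_if_finite infinite_UNIV_nat by blast
  hence B: "poly (q x) (int B) \<noteq> 0" if "x \<in> X" for x using that by simp
  have "inj_on (\<lambda>m. poly (weight e m) (int B)) M"
  proof (rule inj_onI, rule ccontr)
    fix m m' assume m: "m \<in> M" "m' \<in> M" "poly (weight e m) (int B) = poly (weight e m') (int B)" "m \<noteq> m'"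
    hence "poly (q (m, m')) (int B) = 0" by (simp add: q_def)
    thus False using B[of "(m, m')"] m by (simp add: X_def)
  qed
  thus ?thesis by blast
qed

text \<open>Kronecker substitution turns two multivariate polynomials into univariate ones.\<close>

lemma common_nonzero_value:
  fixes F G :: "('v, 'k::field_char_0) mpoly"
  assumes "F \<noteq> 0" "G \<noteq> 0"
  shows "\<exists>c. mpoly_eval F c \<noteq> 0 \<and> mpoly_eval G c \<noteq> 0"
proof -
  obtain e :: "'v \<Rightarrow> nat" and B where inj: "inj_on (\<lambda>m. poly (weight e m) (int B)) (keys F \<union> keys G)"
    using weights_separated_at_nat[of "keys F \<union> keys G"] by auto
  \<comment> \<open>\<open>N m\<close> is the exponent acquired by the monomial \<open>m\<close>
    when each variable \<open>v\<close> is replaced by \<open>a ^ (B ^ e v)\<close>; by the choice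
    of \<open>B\<close> no two monomials of \<open>F\<close> and \<open>G\<close> collide.\<close>
  define N where "N m = (\<Sum>v\<in>keys m. lookup m v * B ^ e v)" for m
  have N: "int (N m) = poly (weight e m) (int B)" for m
    by (simp add: N_def weight_def poly_sum poly_monom)
  have injN: "m = m'" if "m \<in> keys F \<union> keys G" "m' \<in> keys F \<union> keys G" "N m = N m'" for m m'
    using inj that N[of m] N[of m'] by (auto dest!: inj_onD)
  define p where "p H = (\<Sum>m\<in>keys H. monom (lookup H m) (N m))" for H :: "('v, 'k) mpoly"
  have p_nz: "p H \<noteq> 0" if H: "H \<noteq> 0" "keys H \<subseteq> keys F \<union> keys G" for H
  proof -
    have "keys H \<noteq> {}" using H(1) by simp
    then obtain m0 where m0: "m0 \<in> keys H" by blast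
    have "coeff (p H) (N m0) = (\<Sum>m\<in>keys H. if m = m0 then lookup H m else 0)"
      unfolding p_def coeff_sum using injN m0 H by (intro sum.cong refl) auto
    also have "\<dots> = lookup H m0" using m0 by (simp add: sum.delta)
    finally have "coeff (p H) (N m0) \<noteq> 0" using m0 by (simp add: in_keys_iff)
    thus ?thesis by auto
  qed
  have eval_p: "poly (p H) a = mpoly_eval H (\<lambda>v. a ^ (B ^ e v))" for H a
    unfolding p_def mpoly_eval_def poly_sum poly_monom N_def
    by (simp add: power_sum mult.commute flip: power_mult)
  have "p F * p G \<noteq> 0" using p_nz assms by simp
  hence "finite {a. poly (p F * p G) a = 0}" by (rule poly_roots_finite)
  then obtain a where "a \<notin> {a. poly (p F * p G) a = 0}"
    using ex_new_if_finite infinite_UNIV_char_0 by blast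
  thus ?thesis using eval_p by auto
qed

lemma mpoly_mult_eq_0:
  fixes f g :: "('v, 'k::field_char_0) mpoly"
  assumes "f * g = 0"
  shows "f = 0 \<or> g = 0"
proof (rule ccontr)
  assume "\<not> (f = 0 \<or> g = 0)"
  then obtain c where "mpoly_eval f c \<noteq> 0" "mpoly_eval g c \<noteq> 0" using common_nonzero_value by blast
  hence "mpoly_eval (f * g) c \<noteq> 0" by (simp add: mpoly_eval_eq eval.insertion_mult)
  thus False using assms by (simp add: mpoly_eval_eq)
qed

text \<open>Genericity is proved by exhibiting a polynomial function of the coefficients. Working
  with functions keeps sums and products pointwise, and the polynomial required by
  \<open>for_general_forms\<close> is recovered only once.\<close>

definition polyfun :: "nat \<Rightarrow> ((nat \<times> 'x \<Rightarrow> 'k::comm_ring_1) \<Rightarrow> 'k) \<Rightarrow> bool" where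
  "polyfun s \<phi> \<longleftrightarrow> (\<exists>F :: (nat \<times> 'x, 'k) mpoly.
     (\<forall>m\<in>keys F. keys m \<subseteq> {..<s} \<times> UNIV) \<and> (\<forall>c. mpoly_eval F c = \<phi> c))"

lemma polyfun_const [simp]: "polyfun s (\<lambda>c. k)"
  unfolding polyfun_def by (intro exI[of _ "single 0 k"]) (auto simp: mpoly_eval_eq eval.insertion_single)

lemma polyfun_coord: "i < s \<Longrightarrow> polyfun s (\<lambda>c. c (i, x))"
  unfolding polyfun_def
  by (intro exI[of _ "single (single (i, x) 1) 1"])
    (auto simp: mpoly_eval_eq eval.insertion_single simp del: One_nat_def)

lemma polyfun_add:
  assumes "polyfun s \<phi>" "polyfun s \<psi>"
  shows "polyfun s (\<lambda>c. \<phi> c + \<psi> c)"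
proof -
  from assms obtain F G where F: "\<forall>m\<in>keys F. keys m \<subseteq> {..<s} \<times> UNIV" "\<forall>c. mpoly_eval F c = \<phi> c"
    and G: "\<forall>m\<in>keys G. keys m \<subseteq> {..<s} \<times> UNIV" "\<forall>c. mpoly_eval G c = \<psi> c"
    unfolding polyfun_def by blast
  have "\<forall>m\<in>keys (F + G). keys m \<subseteq> {..<s} \<times> UNIV" using F(1) G(1) keys_add[of F G] by blast
  moreover have "\<forall>c. mpoly_eval (F + G) c = \<phi> c + \<psi> c"
    using F(2) G(2) by (simp add: mpoly_eval_eq eval.insertion_add)
  ultimately show ?thesis unfolding polyfun_def by blast
qed

lemma polyfun_mult:
  assumes "polyfun s \<phi>" "polyfun s \<psi>"
  shows "polyfun s (\<lambda>c. \<phi> c * \<psi> c)"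
proof -
  from assms obtain F G where F: "\<forall>m\<in>keys F. keys m \<subseteq> {..<s} \<times> UNIV" "\<forall>c. mpoly_eval F c = \<phi> c"
    and G: "\<forall>m\<in>keys G. keys m \<subseteq> {..<s} \<times> UNIV" "\<forall>c. mpoly_eval G c = \<psi> c"
    unfolding polyfun_def by blast
  have "keys m \<subseteq> {..<s} \<times> UNIV" if m: "m \<in> keys (F * G)" for m
  proof -
    obtain u v where "u \<in> keys F" "v \<in> keys G" "m = u + v" using m keys_mult[of F G] by blast
    thus ?thesis using F(1) G(1) keys_add[of u v] by blast
  qed
  moreover have "\<forall>c. mpoly_eval (F * G) c = \<phi> c * \<psi> c"
    using F(2) G(2) by (simp add: mpoly_eval_eq eval.insertion_mult)
  ultimately show ?thesis unfolding polyfun_def by blast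
qed

lemma polyfun_diff: "polyfun s \<phi> \<Longrightarrow> polyfun s \<psi> \<Longrightarrow> polyfun s (\<lambda>c. \<phi> c - \<psi> c)"
  using polyfun_add[of s \<phi> "\<lambda>c. (- 1) * \<psi> c"] polyfun_mult[OF polyfun_const, of s \<psi> "- 1"] by simp

lemma polyfun_sum: "(\<And>i. i \<in> A \<Longrightarrow> polyfun s (\<phi> i)) \<Longrightarrow> polyfun s (\<lambda>c. \<Sum>i\<in>A. \<phi> i c)"
  by (induction A rule: infinite_finite_induct) (auto intro: polyfun_add)

section \<open>Rules for general linear forms\<close>

abbreviation forms_of :: "(nat \<times> 'x::finite \<Rightarrow> 'k::comm_ring_1) \<Rightarrow> nat \<Rightarrow> ('x, 'k) mpoly" where
  "forms_of c \<equiv> (\<lambda>i. linear_form (\<lambda>x. c (i, x)))"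

lemma for_general_formsI:
  fixes Q :: "(nat \<Rightarrow> ('x::finite, 'k::field) mpoly) \<Rightarrow> bool"
  assumes "polyfun s \<phi>" "\<phi> c0 \<noteq> 0" "\<And>c. \<phi> c \<noteq> 0 \<Longrightarrow> Q (forms_of c)"
  shows "for_general_forms s Q"
proof -
  obtain F where F: "\<forall>m\<in>keys F. keys m \<subseteq> {..<s} \<times> UNIV" "\<forall>c. mpoly_eval F c = \<phi> c"
    using assms(1) unfolding polyfun_def by blast
  have "F \<noteq> 0" using F(2) assms(2) by (auto simp: mpoly_eval_eq)
  thus ?thesis unfolding for_general_forms_def using F assms(3) by auto
qed

lemma for_general_forms_UNIV:
  "(\<And>c. Q (forms_of c)) \<Longrightarrow> for_general_forms s (Q :: (nat \<Rightarrow> ('x::finite, 'k::field) mpoly) \<Rightarrow> bool)"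
  by (rule for_general_formsI[of s "\<lambda>_. 1"]) auto

text \<open>Two nonempty open subsets of an affine space over an infinite field meet: the product of
  the two polynomials is nonzero at some point.\<close>

lemma for_general_forms_conj:
  fixes P Q :: "(nat \<Rightarrow> ('x::finite, 'k::field_char_0) mpoly) \<Rightarrow> bool"
  assumes "for_general_forms s P" "for_general_forms s Q"
  shows "for_general_forms s (\<lambda>L. P L \<and> Q L)"
proof -
  obtain F where F: "F \<noteq> 0" "\<forall>m\<in>keys F. keys m \<subseteq> {..<s} \<times> UNIV"
      "\<And>c. mpoly_eval F c \<noteq> 0 \<Longrightarrow> P (forms_of c)"
    using assms(1) unfolding for_general_forms_def by blast
  obtain G where G: "G \<noteq> 0" "\<forall>m\<in>keys G. keys m \<subseteq> {..<s} \<times> UNIV"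
      "\<And>c. mpoly_eval G c \<noteq> 0 \<Longrightarrow> Q (forms_of c)"
    using assms(2) unfolding for_general_forms_def by blast
  have "polyfun s (mpoly_eval F)" "polyfun s (mpoly_eval G)" using F(2) G(2) unfolding polyfun_def by blast+
  hence p: "polyfun s (\<lambda>c. mpoly_eval F c * mpoly_eval G c)" by (rule polyfun_mult)
  obtain c where "mpoly_eval F c * mpoly_eval G c \<noteq> 0" using common_nonzero_value[OF F(1) G(1)] by auto
  with p show ?thesis by (rule for_general_formsI) (use F(3) G(3) in auto)
qed

lemma for_general_forms_ex:
  fixes Q :: "(nat \<Rightarrow> ('x::finite, 'k::field_char_0) mpoly) \<Rightarrow> bool"
  assumes "for_general_forms s Q"
  shows "\<exists>c. Q (forms_of c)"
  using assms common_nonzero_value unfolding for_general_forms_def by metis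

text \<open>Besides weakening the property, this enlarges the number of forms, so that conditions on
  one, two and three general forms can be imposed on a single triple.\<close>

lemma for_general_forms_mono:
  assumes "for_general_forms s Q" "s \<le> s'" "\<And>c. Q (forms_of c) \<Longrightarrow> Q' (forms_of c)"
  shows "for_general_forms s' Q'"
proof -
  obtain F where F: "F \<noteq> 0" "\<forall>m\<in>keys F. keys m \<subseteq> {..<s} \<times> UNIV"
      "\<And>c. mpoly_eval F c \<noteq> 0 \<Longrightarrow> Q (forms_of c)"
    using assms(1) unfolding for_general_forms_def by blast
  have "{..<s} \<times> UNIV \<subseteq> {..<s'} \<times> UNIV" using assms(2) by auto
  hence "\<forall>m\<in>keys F. keys m \<subseteq> {..<s'} \<times> UNIV" using F(2) by blast
  thus ?thesis unfolding for_general_forms_def using F(1,3) assms(3) by blast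
qed

section \<open>Generic vanishing and the reduction numbers\<close>

lemma forms_subset_upward:
  fixes I :: "('x::finite, 'k::comm_ring_1) mpoly set"
  assumes I: "idl.subspace I" and r: "forms r \<subseteq> I" and "r \<le> k"
  shows "forms k \<subseteq> I"
proof
  fix f :: "('x, 'k) mpoly" assume f: "f \<in> forms k"
  have "single m c \<in> I" if "mon_deg m = k" for m c
  proof -
    have "mon_deg m = (k - r) + r" using that \<open>r \<le> k\<close> by simp
    then obtain u v where uv: "m = u + v" "mon_deg v = r" using mon_split by blast
    have "single v c \<in> I" using r single_in_forms[OF uv(2)] by blast
    hence "single u 1 * single v c \<in> I" by (rule idl.subspace_scale[OF I])
    thus ?thesis by (simp add: uv(1) mult_single)
  qed
  hence "(\<Sum>m\<in>keys f. single m (lookup f m)) \<in> I"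
    using f by (intro idl.subspace_sum[OF I]) (auto simp: forms_def)
  thus "f \<in> I" using poly_mapping_sum_single[of f] by simp
qed

lemma linear_form_in_forms [simp]: "linear_form a \<in> forms (Suc 0)"
  unfolding linear_form_def by (intro forms_sum single_in_forms) simp

lemma add_forms_0: "idl.subspace I \<Longrightarrow> add_forms I 0 L = I"
  by (simp add: add_forms_def)

lemma add_forms_subspace: "idl.subspace (add_forms I s L)"
  by (simp add: add_forms_def)

lemma add_forms_Suc: "add_forms I (Suc s) L = ideal_insert (add_forms I s L) (L s)"
proof (rule antisym)
  have "I \<union> L ` {..<Suc s} \<subseteq> ideal_insert (add_forms I s L) (L s)"
    using subset_ideal_insert[of "add_forms I s L" "L s"] in_ideal_insert[of "L s" "add_forms I s L"]
      idl.span_superset[of "I \<union> L ` {..<s}"]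
    unfolding add_forms_def lessThan_Suc image_insert by blast
  thus "add_forms I (Suc s) L \<subseteq> ideal_insert (add_forms I s L) (L s)"
    unfolding add_forms_def[of I "Suc s"] by (intro idl.span_minimal ideal_insert_subspace)
  have "add_forms I s L \<subseteq> add_forms I (Suc s) L"
    unfolding add_forms_def by (intro idl.span_mono) auto
  moreover have "L s \<in> add_forms I (Suc s) L"
    unfolding add_forms_def by (intro idl.span_base) auto
  ultimately show "ideal_insert (add_forms I s L) (L s) \<subseteq> add_forms I (Suc s) L"
    by (intro ideal_insert_minimal add_forms_subspace)
qed

lemma subset_add_forms: "I \<subseteq> add_forms I s L"
  unfolding add_forms_def using idl.span_superset by blast

lemma add_forms_mono_index: "s \<le> s' \<Longrightarrow> add_forms I s L \<subseteq> add_forms I s' L"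
  unfolding add_forms_def by (intro idl.span_mono) auto

lemma add_forms_mono: "I \<subseteq> J \<Longrightarrow> add_forms I s L \<subseteq> add_forms J s L"
  unfolding add_forms_def by (intro idl.span_mono) auto

lemma in_add_forms_iff:
  assumes I: "idl.subspace I"
  shows "f \<in> add_forms I s L \<longleftrightarrow> (\<exists>r. f - (\<Sum>i<s. r i * L i) \<in> I)"
proof (induction s arbitrary: f)
  case 0
  show ?case using add_forms_0[OF I, of L] by simp
next
  case (Suc s)
  have "f \<in> add_forms I (Suc s) L \<longleftrightarrow> (\<exists>q r. (f - q * L s) - (\<Sum>i<s. r i * L i) \<in> I)"
    unfolding add_forms_Suc in_ideal_insert_iff[OF add_forms_subspace] Suc ..
  also have "\<dots> \<longleftrightarrow> (\<exists>r. f - (\<Sum>i<Suc s. r i * L i) \<in> I)"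
  proof safe
    fix q r assume *: "f - q * L s - (\<Sum>i<s. r i * L i) \<in> I"
    have "(\<Sum>i<Suc s. (r(s := q)) i * L i) = (\<Sum>i<s. r i * L i) + q * L s" by simp
    hence "f - (\<Sum>i<Suc s. (r(s := q)) i * L i) \<in> I" using * by (simp add: algebra_simps)
    thus "\<exists>r. f - (\<Sum>i<Suc s. r i * L i) \<in> I" by blast
  next
    fix r assume "f - (\<Sum>i<Suc s. r i * L i) \<in> I"
    hence "(f - r s * L s) - (\<Sum>i<s. r i * L i) \<in> I" by (simp add: algebra_simps)
    thus "\<exists>q r. f - q * L s - (\<Sum>i<s. r i * L i) \<in> I" by blast
  qed
  finally show ?case .
qed

lemma homogeneous_add_forms:
  assumes "homogeneous_ideal I" "\<And>i. i < s \<Longrightarrow> L i \<in> forms 1"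
  shows "homogeneous_ideal (add_forms I s L)"
  using assms(2)
proof (induction s)
  case 0
  thus ?case using add_forms_0[OF homogeneous_idealD(1)[OF assms(1)]] assms(1) by simp
next
  case (Suc s)
  thus ?case unfolding add_forms_Suc by (intro homogeneous_ideal_insert) auto
qed

lemma add_forms_homogeneous_repr:
  assumes I: "homogeneous_ideal I" and L: "\<And>i. i < s \<Longrightarrow> L i \<in> forms 1"
    and f: "f \<in> add_forms I s L" "f \<in> forms (Suc k)"
  shows "\<exists>g r. g \<in> I \<inter> forms (Suc k) \<and> (\<forall>i. r i \<in> forms k) \<and> f = g + (\<Sum>i<s. r i * L i)"
proof -
  obtain r where r: "f - (\<Sum>i<s. r i * L i) \<in> I"
    using f(1) in_add_forms_iff[OF homogeneous_idealD(1)[OF I]] by blast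
  let ?g = "hcomp (Suc k) (f - (\<Sum>i<s. L i * r i))"
  have "?g \<in> I" using homogeneous_idealD(2)[OF I r] by (simp add: mult.commute)
  moreover have "?g = f - (\<Sum>i<s. L i * hcomp k (r i))"
    using L by (simp add: hcomp_diff hcomp_sum hcomp_form_mult[of _ 1] hcomp_same[OF f(2)])
  hence "f = ?g + (\<Sum>i<s. hcomp k (r i) * L i)" by (simp add: mult.commute)
  ultimately show ?thesis by (intro exI[of _ ?g] exI[of _ "\<lambda>i. hcomp k (r i)"]) auto
qed

text \<open>Indexed families are needed here: for special coefficients, vectors with different
  indices may coincide, and passing to the set of vectors would hide that dependence.\<close>

definition indep_family :: "'i set \<Rightarrow> ('i \<Rightarrow> ('x, 'k::field) mpoly) \<Rightarrow> bool" where
  "indep_family J v \<longleftrightarrow> (\<forall>u. (\<Sum>j\<in>J. scalar_mult (u j) (v j)) = 0 \<longrightarrow> (\<forall>j\<in>J. u j = 0))"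

lemma indep_familyD:
  "indep_family J v \<Longrightarrow> (\<Sum>j\<in>J. scalar_mult (u j) (v j)) = 0 \<Longrightarrow> j \<in> J \<Longrightarrow> u j = 0"
  unfolding indep_family_def by blast

text \<open>Gaussian elimination takes the place of a nonvanishing minor.\<close>

lemma indep_family_open:
  fixes v :: "'i \<Rightarrow> (nat \<times> 'x::finite \<Rightarrow> 'k::field) \<Rightarrow> ('x, 'k) mpoly"
  assumes "finite J" "\<And>j m. j \<in> J \<Longrightarrow> polyfun s (\<lambda>c. lookup (v j c) m)"
    and "indep_family J (\<lambda>j. v j c0)"
  shows "\<exists>\<phi>. polyfun s \<phi> \<and> \<phi> c0 \<noteq> 0 \<and> (\<forall>c. \<phi> c \<noteq> 0 \<longrightarrow> indep_family J (\<lambda>j. v j c))"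
  using assms
proof (induction J arbitrary: v)
  case empty
  show ?case by (intro exI[of _ "\<lambda>_. 1"]) (simp add: indep_family_def)
next
  case (insert a J)
  have "v a c0 \<noteq> 0"
  proof
    assume "v a c0 = 0"
    hence "(\<Sum>j\<in>insert a J. scalar_mult (if j = a then 1 else 0) (v j c0)) = 0"
      by (intro sum.neutral) auto
    from indep_familyD[OF insert.prems(2) this, of a] show False by simp
  qed
  then obtain e where e: "lookup (v a c0) e \<noteq> 0" by (auto simp: poly_mapping_eq_iff fun_eq_iff)
  \<comment> \<open>The coefficient at \<open>e\<close> is the pivot. \<open>w\<close> clears it
    from the other vectors by cross-multiplication; a division would lead out of the polynomial
    functions of \<open>c\<close>.\<close>
  define p where "p c = lookup (v a c) e" for c
  define q where "q j c = lookup (v j c) e" for j c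
  define w where "w j c = scalar_mult (p c) (v j c) - scalar_mult (q j c) (v a c)" for j c
  have w_sum: "(\<Sum>j\<in>J. scalar_mult (u j) (w j c)) =
      scalar_mult (p c) (\<Sum>j\<in>J. scalar_mult (u j) (v j c)) - scalar_mult (\<Sum>j\<in>J. u j * q j c) (v a c)"
    for u c
    by (simp add: w_def vs.scale_right_diff_distrib sum_subtractf vs.scale_sum_right vs.scale_sum_left
        mult.commute mult.left_commute)
  have "indep_family J (\<lambda>j. w j c0)"
    unfolding indep_family_def
  proof (intro allI impI)
    fix u assume u: "(\<Sum>j\<in>J. scalar_mult (u j) (w j c0)) = 0"
    let ?u = "\<lambda>j. if j = a then - (\<Sum>j\<in>J. u j * q j c0) else p c0 * u j"
    have "(\<Sum>j\<in>J. scalar_mult (?u j) (v j c0)) = (\<Sum>j\<in>J. scalar_mult (p c0 * u j) (v j c0))"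
      using insert.hyps(2) by (intro sum.cong refl) auto
    hence "(\<Sum>j\<in>insert a J. scalar_mult (?u j) (v j c0)) = (\<Sum>j\<in>J. scalar_mult (u j) (w j c0))"
      using insert.hyps w_sum[of u c0]
      by (simp add: vs.scale_sum_right vs.scale_minus_left)
    hence *: "(\<Sum>j\<in>insert a J. scalar_mult (?u j) (v j c0)) = 0" using u by simp
    show "\<forall>j\<in>J. u j = 0"
    proof
      fix j assume "j \<in> J"
      with indep_familyD[OF insert.prems(2) *, of j] show "u j = 0"
        using e insert.hyps(2) by (auto simp: p_def split: if_splits)
    qed
  qed
  moreover have "polyfun s (\<lambda>c. lookup (w j c) m)" if "j \<in> J" for j m
    unfolding w_def p_def q_def lookup_minus lookup_scalar_mult
    using that insert.prems(1) by (intro polyfun_diff polyfun_mult) auto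
  ultimately obtain \<phi> where \<phi>: "polyfun s \<phi>" "\<phi> c0 \<noteq> 0" "\<And>c. \<phi> c \<noteq> 0 \<Longrightarrow> indep_family J (\<lambda>j. w j c)"
    using insert.IH[of w] by blast
  have "polyfun s p" unfolding p_def using insert.prems(1) by simp
  hence "polyfun s (\<lambda>c. \<phi> c * p c)" using \<phi>(1) by (intro polyfun_mult)
  moreover have "\<phi> c0 * p c0 \<noteq> 0" using \<phi>(2) e by (simp add: p_def)
  moreover have "indep_family (insert a J) (\<lambda>j. v j c)" if c: "\<phi> c * p c \<noteq> 0" for c
    unfolding indep_family_def
  proof (intro allI impI)
    fix u assume "(\<Sum>j\<in>insert a J. scalar_mult (u j) (v j c)) = 0"
    hence u: "(\<Sum>j\<in>J. scalar_mult (u j) (v j c)) = - scalar_mult (u a) (v a c)"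
      using insert.hyps by (simp add: eq_neg_iff_add_eq_0 add.commute)
    have "lookup (\<Sum>j\<in>J. scalar_mult (u j) (v j c)) e = lookup (- scalar_mult (u a) (v a c)) e"
      unfolding u ..
    hence "(\<Sum>j\<in>J. u j * q j c) = - (u a * p c)" by (simp add: lookup_sum q_def p_def)
    hence "(\<Sum>j\<in>J. scalar_mult (u j) (w j c)) = 0"
      unfolding w_sum u by (simp add: mult.commute vs.scale_minus_right vs.scale_minus_left)
    hence uJ: "\<forall>j\<in>J. u j = 0" using \<phi>(3)[of c] c unfolding indep_family_def by simp
    hence "(\<Sum>j\<in>J. u j * q j c) = 0" by simp
    hence "u a = 0" using \<open>(\<Sum>j\<in>J. u j * q j c) = - (u a * p c)\<close> c by simp
    thus "\<forall>j\<in>insert a J. u j = 0" using uJ by simp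
  qed
  ultimately show ?case by blast
qed

lemma indep_family_independent:
  assumes J: "finite J" and v: "indep_family J v"
  shows "inj_on v J" "vs.independent (v ` J)"
proof -
  show inj: "inj_on v J"
  proof (rule inj_onI, rule ccontr)
    fix i j assume ij: "i \<in> J" "j \<in> J" "v i = v j" "i \<noteq> j"
    let ?u = "\<lambda>l. if l = i then 1 else if l = j then - 1 else 0"
    have "(\<Sum>l\<in>J. scalar_mult (?u l) (v l)) = (\<Sum>l\<in>{i, j}. scalar_mult (?u l) (v l))"
      using ij J by (intro sum.mono_neutral_right) auto
    also have "\<dots> = 0" using ij by (simp add: vs.scale_minus_left)
    finally have "(\<Sum>l\<in>J. scalar_mult (?u l) (v l)) = 0" .
    from indep_familyD[OF v this ij(1)] show False by simp
  qed
  show "vs.independent (v ` J)"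
  proof (rule vs.independent_if_scalars_zero)
    fix f b assume f: "(\<Sum>b\<in>v ` J. scalar_mult (f b) b) = 0" and b: "b \<in> v ` J"
    have "(\<Sum>j\<in>J. scalar_mult (f (v j)) (v j)) = 0" using f by (simp add: sum.reindex[OF inj])
    with b show "f b = 0" using indep_familyD[OF v, of "\<lambda>j. f (v j)"] by blast
  qed (use J in simp)
qed

lemma independent_indep_family:
  assumes J: "finite J" and inj: "inj_on v J" and v: "vs.independent (v ` J)"
  shows "indep_family J v"
  unfolding indep_family_def
proof (intro allI impI ballI)
  fix u j assume u: "(\<Sum>j\<in>J. scalar_mult (u j) (v j)) = 0" and j: "j \<in> J"
  let ?u = "\<lambda>b. u (the_inv_into J v b)"
  have "(\<Sum>b\<in>v ` J. scalar_mult (?u b) b) = (\<Sum>j\<in>J. scalar_mult (u j) (v j))"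
    by (simp add: sum.reindex[OF inj] the_inv_into_f_f[OF inj])
  hence "?u (v j) = 0"
    using vs.independentD[OF v, of "v ` J" ?u "v j"] u J j by simp
  thus "u j = 0" by (simp add: the_inv_into_f_f[OF inj j])
qed

lemma polyfun_lookup_form_mult:
  assumes "i < s"
  shows "polyfun s (\<lambda>c :: nat \<times> 'x::finite \<Rightarrow> 'k::field. lookup (single n 1 * forms_of c i) m)"
proof -
  have "lookup (single n 1 * forms_of c i) m = (\<Sum>x\<in>UNIV. c (i, x) * lookup (single (n + single x 1) 1) m)"
    for c :: "nat \<times> 'x \<Rightarrow> 'k"
    unfolding linear_form_def sum_distrib_left mult_single lookup_sum
    by (intro sum.cong refl) (auto simp: lookup_single when_def)
  thus ?thesis using assms by (auto intro!: polyfun_sum polyfun_mult polyfun_coord)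
qed

text \<open>The degree \<open>k + 1\<close> piece of the enlarged ideal is spanned by the elements
  of \<open>I\<close> and the products of monomials of degree \<open>k\<close> with the forms.
  Select a basis of all forms among these vectors at \<open>c0\<close>. The same indices stay
  independent on a nonempty open set of coefficients, and there they span because their number is
  the full dimension.\<close>

lemma generic_vanishing:
  fixes I :: "('x::finite, 'k::field) mpoly set"
  assumes I: "homogeneous_ideal I" and c0: "forms (Suc k) \<subseteq> add_forms I s (forms_of c0)"
  shows "for_general_forms s (\<lambda>L. forms (Suc k) \<subseteq> add_forms I s L)"
proof -
  note sI = homogeneous_idealD(1)[OF I]
  let ?X = "Inl ` (I \<inter> forms (Suc k)) \<union> Inr ` ({..<s} \<times> {n. mon_deg n = k})
    :: (('x, 'k) mpoly + nat \<times> ('x \<Rightarrow>\<^sub>0 nat)) set"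
  define v where "v j c = (case j of Inl g \<Rightarrow> g | Inr (i, n) \<Rightarrow> single n 1 * forms_of c i)"
    for j :: "('x, 'k) mpoly + nat \<times> ('x \<Rightarrow>\<^sub>0 nat)" and c
  have v_forms: "v j c \<in> forms (Suc k)" if "j \<in> ?X" for j c
  proof (cases j)
    case (Inr p)
    with that obtain i n where "j = Inr (i, n)" "mon_deg n = k" by auto
    thus ?thesis using forms_mult[OF single_in_forms linear_form_in_forms, of n k]
      by (simp add: v_def)
  qed (use that in \<open>auto simp: v_def\<close>)
  have v_in: "v j c \<in> add_forms I s (forms_of c)" if "j \<in> ?X" for j c
  proof -
    have "forms_of c i \<in> add_forms I s (forms_of c)" if "i < s" for i
      unfolding add_forms_def by (intro idl.span_base) (use that in auto)
    thus ?thesis using \<open>j \<in> ?X\<close> subset_add_forms[of I s "forms_of c"]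
        idl.subspace_scale[OF add_forms_subspace, of _ I s "forms_of c"]
      by (auto simp: v_def)
  qed
  have span: "forms (Suc k) \<subseteq> vs.span ((\<lambda>j. v j c0) ` ?X)"
  proof
    fix f :: "('x, 'k) mpoly" assume f: "f \<in> forms (Suc k)"
    then obtain g r where g: "g \<in> I \<inter> forms (Suc k)" and r: "\<forall>i. r i \<in> forms k"
      and fgr: "f = g + (\<Sum>i<s. r i * forms_of c0 i)"
      using add_forms_homogeneous_repr[OF I, of s "forms_of c0" f k] c0 by auto
    have "g \<in> vs.span ((\<lambda>j. v j c0) ` ?X)"
      using g by (intro vs.span_base image_eqI[of _ _ "Inl g"]) (auto simp: v_def)
    moreover have "r i * forms_of c0 i \<in> vs.span ((\<lambda>j. v j c0) ` ?X)" if i: "i < s" for i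
    proof -
      have "r i * forms_of c0 i = (\<Sum>n\<in>keys (r i). single n (lookup (r i) n)) * forms_of c0 i"
        by (rule arg_cong[of _ _ "\<lambda>f. f * _"]) (rule poly_mapping_sum_single)
      also have "\<dots> = (\<Sum>n\<in>keys (r i). scalar_mult (lookup (r i) n) (v (Inr (i, n)) c0))"
        by (simp add: sum_distrib_right v_def scalar_mult_def mult_single flip: mult.assoc)
      also have "\<dots> \<in> vs.span ((\<lambda>j. v j c0) ` ?X)"
        using r i by (intro vs.span_sum vs.span_scale vs.span_base imageI) (auto simp: forms_def)
      finally show ?thesis .
    qed
    ultimately show "f \<in> vs.span ((\<lambda>j. v j c0) ` ?X)"
      unfolding fgr by (intro vs.span_add vs.span_sum) simp_all
  qed
  obtain D where D: "D \<subseteq> (\<lambda>j. v j c0) ` ?X" "vs.independent D" "(\<lambda>j. v j c0) ` ?X \<subseteq> vs.span D"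
    by (rule vs.maximal_independent_subset[of "(\<lambda>j. v j c0) ` ?X"])
  have Df: "D \<subseteq> forms (Suc k)" using D(1) v_forms by blast
  have "finite D" using fin_dim_independent[OF fin_dim_forms Df D(2)] .
  have "vs.span ((\<lambda>j. v j c0) ` ?X) \<subseteq> vs.span D" using D(3) by (intro vs.span_minimal) auto
  hence "forms (Suc k) \<subseteq> vs.span D" using span by blast
  hence cD: "card D = vs.dim (forms (Suc k) :: ('x, 'k) mpoly set)"
    using vs.basis_card_eq_dim[OF Df _ D(2)] by simp
  obtain J where J: "J \<subseteq> ?X" "inj_on (\<lambda>j. v j c0) J" "(\<lambda>j. v j c0) ` J = D"
    using D(1) by (auto simp: subset_image_inj)
  have fJ: "finite J" using finite_imageD[OF _ J(2)] J(3) \<open>finite D\<close> by simp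
  have cJ: "card J = card D" using J card_image by metis
  have "indep_family J (\<lambda>j. v j c0)" using independent_indep_family[OF fJ J(2)] J(3) D(2) by simp
  moreover have "polyfun s (\<lambda>c. lookup (v j c) m)" if "j \<in> J" for j m
  proof (cases j)
    case (Inr p)
    have "j \<in> ?X" using that J(1) by blast
    with Inr obtain i n where "j = Inr (i, n)" "i < s" by auto
    thus ?thesis using polyfun_lookup_form_mult[of i s n m] by (simp add: v_def)
  qed (simp add: v_def)
  ultimately have "\<exists>\<phi>. polyfun s \<phi> \<and> \<phi> c0 \<noteq> 0 \<and> (\<forall>c. \<phi> c \<noteq> 0 \<longrightarrow> indep_family J (\<lambda>j. v j c))"
    by (intro indep_family_open[OF fJ])
  then obtain \<phi> where \<phi>: "polyfun s \<phi>" "\<phi> c0 \<noteq> 0" "\<And>c. \<phi> c \<noteq> 0 \<Longrightarrow> indep_family J (\<lambda>j. v j c)"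
    by blast
  show ?thesis
  proof (rule for_general_formsI[OF \<phi>(1,2)])
    fix c assume "\<phi> c \<noteq> 0"
    note ind = indep_family_independent[OF fJ \<phi>(3)[OF this]]
    have sub: "(\<lambda>j. v j c) ` J \<subseteq> forms (Suc k)"
      by (rule image_subsetI, rule v_forms, rule subsetD[OF J(1)])
    have "vs.span ((\<lambda>j. v j c) ` J) = forms (Suc k)"
    proof (rule subspace_dim_eq[OF fin_dim_forms])
      show "vs.span ((\<lambda>j. v j c) ` J) \<subseteq> forms (Suc k)"
        by (intro vs.span_minimal sub subspace_forms)
      show "vs.dim (vs.span ((\<lambda>j. v j c) ` J)) = vs.dim (forms (Suc k) :: ('x, 'k) mpoly set)"
        using vs.dim_span_eq_card_independent[OF ind(2)] card_image[OF ind(1)] cJ cD by simp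
    qed simp
    moreover have "vs.span ((\<lambda>j. v j c) ` J) \<subseteq> add_forms I s (forms_of c)"
    proof (rule vs.span_minimal)
      show "(\<lambda>j. v j c) ` J \<subseteq> add_forms I s (forms_of c)"
        by (rule image_subsetI, rule v_in, rule subsetD[OF J(1)])
    qed (intro ideal_vs_subspace add_forms_subspace)
    ultimately show "forms (Suc k) \<subseteq> add_forms I s (forms_of c)" by simp
  qed
qed

lemma forms_0_not_subset:
  fixes I :: "('x::finite, 'k::field) mpoly set"
  assumes I: "homogeneous_ideal I" "I \<noteq> UNIV" and L: "\<And>i. i < s \<Longrightarrow> L i \<in> forms 1"
  shows "\<not> forms 0 \<subseteq> add_forms I s L"
proof
  assume "forms 0 \<subseteq> add_forms I s L"
  hence "1 \<in> add_forms I s L" using one_in_forms by blast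
  then obtain r where "1 - (\<Sum>i<s. L i * r i) \<in> I"
    using in_add_forms_iff[OF homogeneous_idealD(1)[OF I(1)], of 1 s L] by (auto simp: mult.commute)
  hence "hcomp 0 (1 - (\<Sum>i<s. L i * r i)) \<in> I" by (rule homogeneous_idealD(2)[OF I(1)])
  moreover have "(\<Sum>i<s. hcomp 0 (L i * r i)) = 0"
    by (intro sum.neutral ballI) (simp add: hcomp_form_mult[OF L])
  ultimately have "1 \<in> I"
    by (simp add: hcomp_diff hcomp_sum hcomp_same[OF one_in_forms])
  thus False using I ideal_eq_UNIV homogeneous_idealD(1) by blast
qed

text \<open>Shows that the definite description in \<open>red_max\<close> denotes. Let
  \<open>n\<close> be the least degree in which the quotient vanishes for some choice of forms. It
  is positive, vanishing in degree \<open>n\<close> is generic, and by minimality no choice at all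
  vanishes in degree \<open>n - 1\<close>. Two generic values agree because they can be compared at
  a common choice of forms.\<close>

lemma red_max_generic:
  fixes I :: "('x::finite, 'k::field_char_0) mpoly set"
  assumes I: "homogeneous_ideal I" "I \<noteq> UNIV" and N: "forms N \<subseteq> add_forms I s (forms_of c0)"
  shows "for_general_forms s (\<lambda>L. hilbert_fun (add_forms I s L) (red_max s I) \<noteq> 0 \<and>
     (\<forall>k. hilbert_fun (add_forms I s L) k \<noteq> 0 \<longrightarrow> k \<le> red_max s I))"
proof -
  let ?Q = "\<lambda>r L. hilbert_fun (add_forms I s L) r \<noteq> 0 \<and>
     (\<forall>k. hilbert_fun (add_forms I s L) k \<noteq> 0 \<longrightarrow> k \<le> r)"
  let ?P = "\<lambda>n. \<exists>c. forms n \<subseteq> add_forms I s (forms_of c)"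
  define n where "n = (LEAST n. ?P n)"
  have Pn: "?P n" unfolding n_def by (rule LeastI[of ?P N]) (use N in blast)
  have "\<not> forms 0 \<subseteq> add_forms I s (forms_of c)" for c
    by (rule forms_0_not_subset[OF I]) simp
  hence "\<not> ?P 0" by blast
  then obtain r where r: "n = Suc r" using Pn by (cases n) auto
  have nr: "\<not> ?P r" using not_less_Least[of r ?P] r unfolding n_def by simp
  obtain c where "forms (Suc r) \<subseteq> add_forms I s (forms_of c)" using Pn r by blast
  hence "for_general_forms s (\<lambda>L. forms (Suc r) \<subseteq> add_forms I s L)" by (rule generic_vanishing[OF I(1)])
  hence gen: "for_general_forms s (?Q r)"
  proof (rule for_general_forms_mono)
    fix c assume c: "forms (Suc r) \<subseteq> add_forms I s (forms_of c)"
    have "k \<le> r" if "hilbert_fun (add_forms I s (forms_of c)) k \<noteq> 0" for k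
      using that forms_subset_upward[OF add_forms_subspace c, of k]
        hilbert_fun_eq_0_iff[OF add_forms_subspace, of I s "forms_of c" k] by (meson not_less_eq_eq)
    thus "?Q r (forms_of c)" using nr hilbert_fun_eq_0_iff[OF add_forms_subspace] by blast
  qed simp
  have "red_max s I = r"
    unfolding red_max_def
  proof (rule the_equality)
    show "for_general_forms s (?Q r)" by (rule gen)
    fix r' assume "for_general_forms s (?Q r')"
    from for_general_forms_ex[OF for_general_forms_conj[OF gen this]] show "r' = r"
      by (meson le_antisym)
  qed
  thus ?thesis using gen by simp
qed

section \<open>General linear forms are nonzerodivisors up to saturation\<close>

abbreviation var :: "'x \<Rightarrow> ('x, 'k::comm_ring_1) mpoly" where
  "var x \<equiv> single (single x 1) 1"

lemma var_in_forms: "var x \<in> forms (Suc 0)"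
  by (rule single_in_forms) simp

lemma irrelevant_ideal_subset:
  fixes I :: "('x, 'k::comm_ring_1) mpoly set"
  assumes I: "idl.subspace I" and X: "\<And>x. var x \<in> I"
  shows "irrelevant_ideal \<subseteq> I"
proof
  fix f :: "('x, 'k) mpoly" assume f: "f \<in> irrelevant_ideal"
  have "single m (lookup f m) \<in> I" if m: "m \<in> keys f" for m
  proof -
    have "m \<noteq> 0" using m f by (auto simp: irrelevant_ideal_def in_keys_iff)
    hence "mon_deg m = Suc 0 + (mon_deg m - 1)" using mon_deg_eq_0_iff[of m] by linarith
    then obtain u v where uv: "m = u + v" "mon_deg u = Suc 0" using mon_split by blast
    obtain x where "u = single x 1" using mon_deg_1[OF uv(2)] by blast
    hence "single m (lookup f m) = single v (lookup f m) * var x"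
      using uv by (simp add: mult_single add.commute)
    thus ?thesis using idl.subspace_scale[OF I X] by simp
  qed
  hence "(\<Sum>m\<in>keys f. single m (lookup f m)) \<in> I" by (intro idl.subspace_sum[OF I])
  thus "f \<in> I" using poly_mapping_sum_single[of f] by simp
qed

lemma forms_subset_irrelevant: "0 < t \<Longrightarrow> forms t \<subseteq> irrelevant_ideal"
  by (auto simp: irrelevant_ideal_def forms_iff)

lemma homogeneous_prime_not_UNIV: "homogeneous_prime P \<Longrightarrow> 1 \<notin> P"
  using ideal_eq_UNIV homogeneous_idealD(1) unfolding homogeneous_prime_def by blast

lemma homogeneous_primeD:
  assumes "homogeneous_prime P"
  shows "homogeneous_ideal P" "f * g \<in> P \<Longrightarrow> f \<in> P \<or> g \<in> P"
  using assms unfolding homogeneous_prime_def by blast+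

lemma colon_prime:
  assumes "homogeneous_prime P" "f \<notin> P"
  shows "colon P f = P"
proof
  show "P \<subseteq> colon P f"
    by (intro subset_colon homogeneous_idealD(1) homogeneous_primeD(1) assms(1))
  show "colon P f \<subseteq> P"
    using homogeneous_primeD(2)[OF assms(1)] assms(2) by (auto simp: colon_def)
qed

definition saturation :: "('x, 'k::comm_ring_1) mpoly set \<Rightarrow> ('x, 'k) mpoly set" where
  "saturation I = {f. \<exists>k. \<forall>m. mon_deg m = k \<longrightarrow> single m 1 * f \<in> I}"

lemma saturated_imp: "saturated I \<Longrightarrow> f \<in> saturation I \<Longrightarrow> f \<in> I"
  unfolding saturated_def saturation_def by blast

lemma saturation_upward:
  fixes f :: "('x, 'k::comm_ring_1) mpoly"
  assumes I: "idl.subspace I" and k: "\<forall>m. mon_deg m = k \<longrightarrow> single m 1 * f \<in> I"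
    and "k \<le> k'" and m: "mon_deg m = k'"
  shows "single m 1 * f \<in> I"
proof -
  have "mon_deg m = (k' - k) + k" using m \<open>k \<le> k'\<close> by simp
  then obtain u v where uv: "m = u + v" "mon_deg v = k" using mon_split by blast
  have "single u 1 * (single v 1 * f) \<in> I" 
    by (rule idl.subspace_scale[OF I]) (use k uv(2) in blast)
  moreover have "single u 1 * (single v 1 * f) = single m 1 * f"
    unfolding uv(1) by (simp add: mult_single flip: mult.assoc)
  ultimately show ?thesis by simp
qed

lemma subset_saturation: "f \<in> I \<Longrightarrow> f \<in> saturation I"
  unfolding saturation_def by (auto intro!: exI[of _ 0] simp: mon_deg_eq_0_iff)

text \<open>A linear functional that is zero on \<open>P\<close> and 1 on \<open>var x0\<close>
  restricts to a nonzero linear function of the coefficients of a linear form. Where that function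
  is nonzero, the form is outside \<open>P\<close>.\<close>

lemma general_form_notin:
  fixes P :: "('x::finite, 'k::field) mpoly set"
  assumes P: "idl.subspace P" and x0: "var x0 \<notin> P"
  shows "for_general_forms 1 (\<lambda>L. L 0 \<notin> P)"
proof -
  interpret vp: vector_space_pair "scalar_mult :: 'k \<Rightarrow> ('x, 'k) mpoly \<Rightarrow> _" "(*) :: 'k \<Rightarrow> 'k \<Rightarrow> 'k"
    by unfold_locales (simp_all add: algebra_simps)
  obtain B where B: "B \<subseteq> P" "vs.independent B" "P \<subseteq> vs.span B"
    by (rule vs.maximal_independent_subset[of P])
  have "vs.span B \<subseteq> P" using B(1) by (rule vs.span_minimal) (rule ideal_vs_subspace[OF P])
  hence spB: "vs.span B = P" using B(3) by blast
  have "vs.independent (insert (var x0) B)"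
    using x0 spB B(2) by (intro vs.independent_insertI) auto
  from vp.linear_independent_extend[OF this, of "\<lambda>b. if b = var x0 then 1 else 0"]
  obtain g where g: "Vector_Spaces.linear scalar_mult (*) g"
    "\<forall>b\<in>insert (var x0) B. g b = (if b = var x0 then 1 else (0::'k))" by blast
  interpret g: Vector_Spaces.linear scalar_mult "(*) :: 'k \<Rightarrow> 'k \<Rightarrow> 'k" g by (rule g(1))
  have gB: "g b = 0" if "b \<in> B" for b using g(2) that B(1) x0 by auto
  have gP: "g p = 0" if "p \<in> P" for p
    using g.eq_0_on_span[OF gB, of B p] that spB by simp
  have gx0: "g (var x0) = 1" using g(2) by simp
  have lin: "linear_form a = (\<Sum>x\<in>UNIV. scalar_mult (a x) (var x))" for a :: "'x \<Rightarrow> 'k"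
    unfolding linear_form_def by (simp add: scalar_mult_def mult_single)
  have g_lin: "g (linear_form a) = (\<Sum>x\<in>UNIV. a x * g (var x))" for a :: "'x \<Rightarrow> 'k"
    unfolding lin g.sum by (simp only: g.scale)
  show ?thesis
  proof (rule for_general_formsI)
    show "polyfun 1 (\<lambda>c. \<Sum>x\<in>UNIV. c (0, x) * g (var x))"
      by (intro polyfun_sum polyfun_mult polyfun_coord polyfun_const) simp
    show "(\<Sum>x\<in>UNIV. (\<lambda>(i, x). if x = x0 then 1 else 0) (0, x) * g (var x)) \<noteq> 0"
      using gx0 by (simp add: if_distrib[of "\<lambda>a. a * _"] sum.delta cong: if_cong)
    fix c :: "nat \<times> 'x \<Rightarrow> 'k"
    assume "(\<Sum>x\<in>UNIV. c (0, x) * g (var x)) \<noteq> 0"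
    hence "g (forms_of c 0) \<noteq> 0" using g_lin[of "\<lambda>x. c (0, x)"] by simp
    thus "forms_of c 0 \<notin> P" using gP by blast
  qed
qed

text \<open>Prime induction in place of avoiding associated primes. A general form lies outside a
  prime that misses some variable; for a prime containing all variables the saturation is the whole
  ring. In the inductive step, monomials of degree \<open>k\<close> carry \<open>f\<close> into I +
  (g), monomials of degree \<open>N\<close> carry the finitely many resulting coefficients of
  \<open>g\<close> into I : g, and so degree \<open>N + k\<close> carries \<open>f\<close> into
  \<open>I\<close>.\<close>

lemma general_nonzerodivisor:
  fixes I :: "('x::finite, 'k::field_char_0) mpoly set"
  assumes "homogeneous_ideal I"
  shows "for_general_forms 1 (\<lambda>L. \<forall>f. L 0 * f \<in> I \<longrightarrow> f \<in> saturation I)"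
  using assms
proof (induction I rule: homogeneous_ideal_prime_induct)
  case UNIV
  show ?case by (intro for_general_forms_UNIV) (simp add: subset_saturation)
next
  case (prime P)
  note sP = homogeneous_idealD(1)[OF homogeneous_primeD(1)[OF prime]]
  show ?case
  proof (cases "\<forall>x. var x \<in> P")
    case True
    have "f \<in> saturation P" for f
      unfolding saturation_def
    proof (intro CollectI exI[of _ "Suc 0"] allI impI)
      fix m :: "'x \<Rightarrow>\<^sub>0 nat" assume "mon_deg m = Suc 0"
      then obtain x where "m = single x 1" using mon_deg_1 by blast
      thus "single m 1 * f \<in> P" using True idl.subspace_scale[OF sP, of "var x" f] by (simp add: mult.commute)
    qed
    thus ?thesis by (intro for_general_forms_UNIV) simp
  next
    case False
    then obtain x0 where "var x0 \<notin> P" by blast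
    from general_form_notin[OF sP this] show ?thesis
      by (rule for_general_forms_mono) (use homogeneous_primeD(2)[OF prime] subset_saturation in blast)+
  qed
next
  case (step I g e)
  note sI = homogeneous_idealD(1)[OF step(1)]
  show ?case
  proof (rule for_general_forms_mono[OF for_general_forms_conj[OF step(3,4)]])
    fix c :: "nat \<times> 'x \<Rightarrow> 'k"
    define L where "L = forms_of c 0"
    assume "(\<forall>f. forms_of c 0 * f \<in> ideal_insert I g \<longrightarrow> f \<in> saturation (ideal_insert I g)) \<and>
      (\<forall>f. forms_of c 0 * f \<in> colon I g \<longrightarrow> f \<in> saturation (colon I g))"
    hence 1: "\<And>f. L * f \<in> ideal_insert I g \<Longrightarrow> f \<in> saturation (ideal_insert I g)"
      and 2: "\<And>f. L * f \<in> colon I g \<Longrightarrow> f \<in> saturation (colon I g)"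
      unfolding L_def by blast+
    have "f \<in> saturation I" if f: "L * f \<in> I" for f
    proof -
      have "f \<in> saturation (ideal_insert I g)" using 1 f subset_ideal_insert by blast
      then obtain k where k: "\<And>u. mon_deg u = k \<Longrightarrow> single u 1 * f \<in> ideal_insert I g"
        unfolding saturation_def by blast
      let ?M = "{u :: 'x \<Rightarrow>\<^sub>0 nat. mon_deg u = k}"
      have "\<exists>a j. single u 1 * f - a * g \<in> I \<and> (\<forall>v. mon_deg v = j \<longrightarrow> single v 1 * a \<in> colon I g)"
        if u: "u \<in> ?M" for u
      proof -
        obtain a where a: "single u 1 * f - a * g \<in> I"
          using k[of u] u in_ideal_insert_iff[OF sI] by blast
        \<comment> \<open>The difference equals \<open>L * a * g\<close>, so \<open>L * a\<close>
          lies in \<open>colon I g\<close> and the second induction hypothesis applies to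
          \<open>a\<close>.\<close>
        have "single u 1 * (L * f) - L * (single u 1 * f - a * g) \<in> I"
          by (rule idl.subspace_diff[OF sI idl.subspace_scale[OF sI f] idl.subspace_scale[OF sI a]])
        hence "L * a \<in> colon I g" by (simp add: in_colon_iff algebra_simps)
        from 2[OF this] show ?thesis using a unfolding saturation_def by blast
      qed
      then obtain a j where a: "\<And>u. u \<in> ?M \<Longrightarrow> single u 1 * f - a u * g \<in> I"
        and j: "\<And>u. u \<in> ?M \<Longrightarrow> \<forall>v. mon_deg v = j u \<longrightarrow> single v 1 * a u \<in> colon I g"
        by metis
      have "finite ?M" by (rule finite_mon_deg)
      then obtain N where N: "\<And>u. u \<in> ?M \<Longrightarrow> j u \<le> N"
        using finite_nat_set_iff_bounded_le[of "j ` ?M"] by auto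
      have sc: "idl.subspace (colon I g)"
        by (rule homogeneous_idealD(1)[OF homogeneous_colon[OF step(1,2)]])
      have "single m 1 * f \<in> I" if m: "mon_deg m = N + k" for m
      proof -
        obtain v u where vu: "m = v + u" "mon_deg v = N" "mon_deg u = k" using mon_split[OF m] by blast
        have u: "u \<in> ?M" using vu(3) by simp
        have "single v 1 * a u \<in> colon I g"
          by (rule saturation_upward[OF sc j[OF u] N[OF u] vu(2)])
        hence "g * (single v 1 * a u) \<in> I" by (simp add: in_colon_iff)
        moreover have "single v 1 * (single u 1 * f - a u * g) \<in> I"
          by (rule idl.subspace_scale[OF sI a[OF u]])
        ultimately have "single v 1 * (single u 1 * f - a u * g) + g * (single v 1 * a u) \<in> I"
          by (intro idl.subspace_add[OF sI])
        moreover have "single v 1 * (single u 1 * f - a u * g) + g * (single v 1 * a u)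
            = (single v 1 * single u 1) * f"
          by (simp add: algebra_simps)
        moreover have "single v 1 * single u 1 = single m (1::'k)"
          unfolding vu(1) by (simp add: mult_single)
        ultimately show ?thesis by simp
      qed
      thus ?thesis unfolding saturation_def by blast
    qed
    thus "\<forall>f. forms_of c 0 * f \<in> I \<longrightarrow> f \<in> saturation I" unfolding L_def by blast
  qed simp
qed

section \<open>Growth of Hilbert functions and chains of points\<close>

text \<open>
  For \<open>k > 0\<close> this says that the Hilbert function is \<open>O(t\<^sup>k\<^sup>-\<^sup>1)\<close>, for \<open>k = 0\<close> that it vanishes eventually.
\<close>

definition growth_le :: "nat \<Rightarrow> ('x, 'k::field) mpoly set \<Rightarrow> bool" where
  "growth_le k I \<longleftrightarrow> (\<exists>C. \<forall>t. Suc t * hilbert_fun I t \<le> C * Suc t ^ k)"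

lemma hilbert_fun_insert_low:
  fixes I :: "('x::finite, 'k::field) mpoly set"
  assumes I: "homogeneous_ideal I" and g: "g \<in> forms e" and "t < e"
  shows "hilbert_fun (ideal_insert I g) t = hilbert_fun I t"
proof (rule hilbert_fun_cong)
  note sI = homogeneous_idealD(1)[OF I]
  show "forms t \<inter> ideal_insert I g = forms t \<inter> I"
  proof
    show "forms t \<inter> ideal_insert I g \<subseteq> forms t \<inter> I"
    proof
      fix v assume v: "v \<in> forms t \<inter> ideal_insert I g"
      then obtain r where "v - r * g \<in> I" using in_ideal_insert_iff[OF sI] by blast
      hence "hcomp t (v - g * r) \<in> I" using homogeneous_idealD(2)[OF I] by (simp add: mult.commute)
      thus "v \<in> forms t \<inter> I"
        using v \<open>t < e\<close> by (simp add: hcomp_diff hcomp_form_mult[OF g] hcomp_same)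
    qed
  qed (use subset_ideal_insert in blast)
qed (intro ideal_insert_subspace homogeneous_idealD(1)[OF I])+

text \<open>The two outer Hilbert functions add up, one of them shifted by \<open>e\<close>. The
  shift costs the factor \<open>Suc e\<close> in the constant; below degree \<open>e\<close>
  adjoining \<open>g\<close> changes nothing.\<close>

lemma growth_le_exact:
  fixes I :: "('x::finite, 'k::field) mpoly set"
  assumes I: "homogeneous_ideal I" and g: "g \<in> forms e"
    and 1: "growth_le k (ideal_insert I g)" and 2: "growth_le k (colon I g)"
  shows "growth_le k I"
proof -
  obtain C where C: "\<And>t. Suc t * hilbert_fun (ideal_insert I g) t \<le> C * Suc t ^ k"
    using 1 unfolding growth_le_def by blast
  obtain D where D: "\<And>t. Suc t * hilbert_fun (colon I g) t \<le> D * Suc t ^ k"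
    using 2 unfolding growth_le_def by blast
  have "Suc t * hilbert_fun I t \<le> (C + Suc e * D) * Suc t ^ k" for t
  proof (cases "t < e")
    case True
    thus ?thesis using C[of t] hilbert_fun_insert_low[OF I g True] by (simp add: add_mult_distrib)
  next
    case False
    define u where "u = t - e"
    have t: "t = u + e" using False by (simp add: u_def)
    have "Suc t \<le> Suc e * Suc u" by (simp add: t)
    hence "Suc t * hilbert_fun (colon I g) u \<le> Suc e * Suc u * hilbert_fun (colon I g) u"
      by (rule mult_le_mono1)
    also have "\<dots> = Suc e * (Suc u * hilbert_fun (colon I g) u)" by (rule mult.assoc)
    also have "\<dots> \<le> Suc e * (D * Suc u ^ k)" by (intro mult_le_mono2 D)
    also have "\<dots> \<le> Suc e * (D * Suc t ^ k)" by (intro mult_le_mono2 power_mono) (simp_all add: t)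
    also have "\<dots> = Suc e * D * Suc t ^ k" by (rule mult.assoc[symmetric])
    finally have "Suc t * hilbert_fun (colon I g) u \<le> Suc e * D * Suc t ^ k" .
    moreover have "hilbert_fun I t = hilbert_fun (ideal_insert I g) t + hilbert_fun (colon I g) u"
      unfolding t by (rule hilbert_fun_exact[OF I g])
    ultimately show ?thesis using C[of t] by (simp only: add_mult_distrib add_mult_distrib2 add_mono)
  qed
  thus ?thesis unfolding growth_le_def by blast
qed

text \<open>Both ideals in the inductive step contain \<open>I\<close>, so primes over them are
  primes over \<open>I\<close>, and the growth bound passes back through the exact sequence.\<close>

lemma growth_le_of_primes:
  fixes I :: "('x::finite, 'k::field) mpoly set"
  assumes I: "homogeneous_ideal I"
    and "\<And>P. homogeneous_prime P \<Longrightarrow> I \<subseteq> P \<Longrightarrow> growth_le k P"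
  shows "growth_le k I"
proof -
  have "(\<forall>P. homogeneous_prime P \<and> I \<subseteq> P \<longrightarrow> growth_le k P) \<longrightarrow> growth_le k I"
    using I
  proof (induction I rule: homogeneous_ideal_prime_induct)
    case UNIV
    show ?case by (simp add: growth_le_def hilbert_fun_UNIV)
  next
    case (step I g e)
    show ?case
    proof
      assume *: "\<forall>P. homogeneous_prime P \<and> I \<subseteq> P \<longrightarrow> growth_le k P"
      have "growth_le k (ideal_insert I g)" using step(3) * subset_ideal_insert[of I g] by blast
      moreover have "growth_le k (colon I g)"
        using step(4) * subset_colon[OF homogeneous_idealD(1)[OF step(1)], of g] by blast
      ultimately show "growth_le k I" by (rule growth_le_exact[OF step(1,2)])
    qed
  qed simp
  thus ?thesis using assms(2) by blast
qed

lemma growth_le_irrelevant: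
  fixes I :: "('x::finite, 'k::field) mpoly set"
  assumes I: "idl.subspace I" and "irrelevant_ideal \<subseteq> I"
  shows "growth_le k I"
  unfolding growth_le_def
proof (intro exI allI)
  fix t
  show "Suc t * hilbert_fun I t \<le> hilbert_fun I 0 * Suc t ^ k"
  proof (cases "t = 0")
    case False
    hence "forms t \<subseteq> I" using forms_subset_irrelevant[of t] assms(2) by blast
    hence "hilbert_fun I t = 0" using hilbert_fun_eq_0_iff[OF I] by blast
    thus ?thesis by simp
  qed simp
qed

lemma growth_le_mono:
  fixes I :: "('x::finite, 'k::field) mpoly set"
  assumes "idl.subspace I" "idl.subspace J" "I \<subseteq> J" "growth_le k I"
  shows "growth_le k J"
proof -
  obtain C where C: "\<And>t. Suc t * hilbert_fun I t \<le> C * Suc t ^ k"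
    using assms(4) unfolding growth_le_def by blast
  have "Suc t * hilbert_fun J t \<le> C * Suc t ^ k" for t
    using C[of t] hilbert_fun_mono[OF assms(1,2), of t] assms(3)
    by (meson inf.coboundedI2 le_trans mult_le_mono2)
  thus ?thesis unfolding growth_le_def by blast
qed

section \<open>Growth along chains of points\<close>

lemma point_var:
  assumes "P \<in> proj_points I"
  shows "homogeneous_prime P" "I \<subseteq> P" "\<exists>x. var x \<notin> P"
proof -
  show P: "homogeneous_prime P" and "I \<subseteq> P"
    using assms by (auto simp: proj_points_def homogeneous_prime_def)
  show "\<exists>x. var x \<notin> P"
    using assms irrelevant_ideal_subset[OF homogeneous_idealD(1)[OF homogeneous_primeD(1)[OF P]]]
    by (auto simp: proj_points_def)
qed

lemma hilbert_fun_prime_form: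
  fixes P :: "('x::finite, 'k::field) mpoly set"
  assumes P: "homogeneous_prime P" and f: "f \<in> forms e" "f \<notin> P"
  shows "hilbert_fun P (t + e) = hilbert_fun (ideal_insert P f) (t + e) + hilbert_fun P t"
  using hilbert_fun_exact[OF homogeneous_primeD(1)[OF P] f(1), of t] colon_prime[OF P f(2)] by simp

lemma hilbert_fun_point_mono:
  fixes P :: "('x::finite, 'k::field) mpoly set"
  assumes P: "P \<in> proj_points I" and "t \<le> u"
  shows "hilbert_fun P t \<le> hilbert_fun P u"
proof -
  obtain x where x: "var x \<notin> P" using point_var(3)[OF P] by blast
  have "hilbert_fun P t \<le> hilbert_fun P (Suc t)" for t
    using hilbert_fun_prime_form[OF point_var(1)[OF P] var_in_forms x, of t] by simp
  thus ?thesis using lift_Suc_mono_le[of "hilbert_fun P"] assms(2) by blast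
qed

text \<open>A form \<open>g\<close> of degree \<open>e + 1\<close> in \<open>Q\<close> outside
  \<open>P\<close> gives H_Q(t) + H_P(t) \<le> H_P(t + e + 1). Iterating \<open>t + 1\<close> times
  bounds (t + 1) H_Q(t) by a value of H_P at an argument linear in \<open>t\<close>, so the order of
  growth drops by one.\<close>

lemma growth_le_chain_step:
  fixes P Q :: "('x::finite, 'k::field) mpoly set"
  assumes P: "P \<in> proj_points I" and Q: "Q \<in> proj_points I" and PQ: "P \<subset> Q"
    and gP: "growth_le (Suc k) P"
  shows "growth_le k Q"
proof -
  note pP = point_var(1)[OF P] and pQ = point_var(1)[OF Q]
  note hP = homogeneous_primeD(1)[OF pP] and hQ = homogeneous_primeD(1)[OF pQ]
  obtain f e where f: "f \<in> forms e" "f \<in> Q" "f \<notin> P"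
    using homogeneous_ideal_subsetI[OF hQ homogeneous_idealD(1)[OF hP]] PQ by blast
  obtain x where x: "var x \<notin> P" using point_var(3)[OF P] by blast
  define g where "g = var x * f"
  have gf: "g \<in> forms (Suc e)" using forms_mult[OF var_in_forms f(1)] by (simp add: g_def)
  have gQ: "g \<in> Q" using idl.subspace_scale[OF homogeneous_idealD(1)[OF hQ] f(2)] by (simp add: g_def)
  have gnP: "g \<notin> P" using homogeneous_primeD(2)[OF pP, of "var x" f] x f(3) by (auto simp: g_def)
  have sub: "ideal_insert P g \<subseteq> Q"
    using PQ gQ by (intro ideal_insert_minimal homogeneous_idealD(1)[OF hQ]) auto
  have step: "hilbert_fun Q t + hilbert_fun P t \<le> hilbert_fun P (t + Suc e)" for t
  proof -
    have "hilbert_fun Q t \<le> hilbert_fun Q (t + Suc e)" by (rule hilbert_fun_point_mono[OF Q]) simp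
    also have "\<dots> \<le> hilbert_fun (ideal_insert P g) (t + Suc e)"
      using sub by (intro hilbert_fun_mono ideal_insert_subspace homogeneous_idealD(1)[OF hQ]) auto
    finally show ?thesis using hilbert_fun_prime_form[OF pP gf gnP, of t] by simp
  qed
  have many: "N * hilbert_fun Q t \<le> hilbert_fun P (t + N * Suc e)" for N t
  proof (induction N)
    case (Suc N)
    have "hilbert_fun Q t \<le> hilbert_fun Q (t + N * Suc e)" by (rule hilbert_fun_point_mono[OF Q]) simp
    hence "Suc N * hilbert_fun Q t \<le> hilbert_fun P (t + N * Suc e + Suc e)"
      using step[of "t + N * Suc e"] Suc.IH unfolding mult_Suc by linarith
    moreover have "t + N * Suc e + Suc e = t + Suc N * Suc e" by simp
    ultimately show ?case by (simp only:)
  qed simp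
  obtain C where C: "\<And>t. Suc t * hilbert_fun P t \<le> C * Suc t ^ Suc k"
    using gP unfolding growth_le_def by blast
  have C': "hilbert_fun P t \<le> C * Suc t ^ k" for t
  proof -
    have "Suc t * hilbert_fun P t \<le> Suc t * (C * Suc t ^ k)"
      using C[of t] by (simp only: power_Suc mult.left_commute)
    thus ?thesis by (simp only: Suc_mult_le_cancel1)
  qed
  have "Suc t * hilbert_fun Q t \<le> (C * (e + 2) ^ k) * Suc t ^ k" for t
  proof -
    have "Suc t * hilbert_fun Q t \<le> hilbert_fun P (t + Suc t * Suc e)" by (rule many)
    also have "\<dots> \<le> C * Suc (t + Suc t * Suc e) ^ k" by (rule C')
    also have "Suc (t + Suc t * Suc e) = (e + 2) * Suc t" by simp
    finally show ?thesis by (simp only: power_mult_distrib mult.assoc)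
  qed
  thus ?thesis unfolding growth_le_def by blast
qed

lemma growth_le_0_no_point:
  fixes P :: "('x::finite, 'k::field) mpoly set"
  assumes P: "P \<in> proj_points I"
  shows "\<not> growth_le 0 P"
proof
  assume "growth_le 0 P"
  then obtain C where C: "\<And>t. Suc t * hilbert_fun P t \<le> C"
    unfolding growth_le_def by auto
  have "\<not> forms 0 \<subseteq> P" using homogeneous_prime_not_UNIV[OF point_var(1)[OF P]] one_in_forms by blast
  hence "hilbert_fun P 0 \<noteq> 0"
    using hilbert_fun_eq_0_iff homogeneous_idealD(1) homogeneous_primeD(1) point_var(1)[OF P] by blast
  \<comment> \<open>Degree \<open>C\<close> is where the factor \<open>Suc C\<close> by itself
    exceeds the supposed bound.\<close>
  hence "1 \<le> hilbert_fun P C" using hilbert_fun_point_mono[OF P, of 0 C] by simp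
  hence "Suc C * 1 \<le> Suc C * hilbert_fun P C" by (rule mult_le_mono2)
  thus False using C[of C] by simp
qed

text \<open>The order of growth drops at every inclusion, and after \<open>k\<close> of them it
  would be 0, which no point of projective space admits.\<close>

lemma no_long_chain:
  fixes I :: "('x::finite, 'k::field) mpoly set"
  assumes I: "homogeneous_ideal I" and g: "growth_le k I"
  shows "\<not> point_chain I k P"
proof
  assume P: "point_chain I k P"
  hence pts: "\<And>i. i \<le> k \<Longrightarrow> P i \<in> proj_points I" and inc: "\<And>i. i < k \<Longrightarrow> P i \<subset> P (Suc i)"
    by (auto simp: point_chain_def)
  have "growth_le (k - i) (P i)" if "i \<le> k" for i
    using that
  proof (induction i)
    case 0
    have "homogeneous_ideal (P 0)" using point_var(1)[OF pts[of 0]] homogeneous_primeD(1) by blast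
    thus ?case
      using growth_le_mono[OF homogeneous_idealD(1)[OF I] homogeneous_idealD(1) point_var(2)[OF pts[of 0]] g]
      by simp
  next
    case (Suc i)
    hence "k - i = Suc (k - Suc i)" by simp
    hence "growth_le (Suc (k - Suc i)) (P i)" using Suc by simp
    thus ?case using growth_le_chain_step[OF pts pts inc, of i] Suc.prems by simp
  qed
  from this[of k] have "growth_le 0 (P k)" by simp
  thus False using growth_le_0_no_point[OF pts[of k]] by simp
qed

text \<open>A prime containing the irrelevant ideal satisfies every growth bound, so a prime that
  violates one is a point.\<close>

lemma prime_of_growth:
  fixes I :: "('x::finite, 'k::field) mpoly set"
  assumes I: "homogeneous_ideal I" and "\<not> growth_le k I"
  shows "\<exists>P\<in>proj_points I. \<not> growth_le k P"
proof -
  obtain P where P: "homogeneous_prime P" "I \<subseteq> P" "\<not> growth_le k P"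
    using growth_le_of_primes[OF I, of k] assms(2) by blast
  hence "\<not> irrelevant_ideal \<subseteq> P"
    using growth_le_irrelevant homogeneous_idealD(1) homogeneous_primeD(1) by blast
  hence "P \<in> proj_points I" using P(1,2) by (auto simp: proj_points_def homogeneous_prime_def)
  thus ?thesis using P(3) by blast
qed

text \<open>A variable outside \<open>P\<close> is a nonzerodivisor, so the Hilbert function of
  \<open>P\<close> is the summatory function of that of its hyperplane section, and summation raises
  the order by one. The case \<open>k = 0\<close> is separate: there the summands vanish from degree
  \<open>C\<close> on.\<close>

lemma growth_le_sum:
  fixes P :: "('x::finite, 'k::field) mpoly set"
  assumes P: "homogeneous_prime P" and x: "var x \<notin> P" and g: "growth_le k (ideal_insert P (var x))"
  shows "growth_le (Suc k) P"
proof -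
  let ?h = "hilbert_fun (ideal_insert P (var x))"
  note hP = homogeneous_primeD(1)[OF P]
  obtain C where C: "\<And>t. Suc t * ?h t \<le> C * Suc t ^ k" using g unfolding growth_le_def by blast
  have sum: "hilbert_fun P t = (\<Sum>u\<le>t. ?h u)" for t
  proof (induction t)
    case 0
    show ?case using hilbert_fun_insert_low[OF hP var_in_forms, of 0 x] by simp
  next
    case (Suc t)
    thus ?case using hilbert_fun_prime_form[OF P var_in_forms x, of t] by simp
  qed
  have "\<exists>D. \<forall>t. (\<Sum>u\<le>t. ?h u) \<le> D * Suc t ^ k"
  proof (cases k)
    case 0
    have C0: "Suc t * ?h t \<le> C" for t using C[of t] 0 by simp
    have h0: "?h t = 0" if "C \<le> t" for t
    proof (rule ccontr)
      assume "?h t \<noteq> 0"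
      hence "Suc t * 1 \<le> Suc t * ?h t" by (intro mult_le_mono2) simp
      thus False using C0[of t] that by simp
    qed
    have "(\<Sum>u\<le>t. ?h u) \<le> (\<Sum>u<C. ?h u)" for t
    proof -
      have "(\<Sum>u\<le>t. ?h u) = (\<Sum>u\<in>{..t} \<inter> {..<C}. ?h u)"
        using h0 by (intro sum.mono_neutral_right) (auto simp: not_less)
      also have "\<dots> \<le> (\<Sum>u<C. ?h u)" by (intro sum_mono2) auto
      finally show ?thesis .
    qed
    thus ?thesis using 0 by (intro exI[of _ "\<Sum>u<C. ?h u"]) simp
  next
    case (Suc j)
    have Cj: "?h u \<le> C * Suc u ^ j" for u
    proof -
      have "Suc u * ?h u \<le> Suc u * (C * Suc u ^ j)"
        using C[of u] by (simp only: Suc power_Suc mult.left_commute)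
      thus ?thesis by (simp only: Suc_mult_le_cancel1)
    qed
    have "(\<Sum>u\<le>t. ?h u) \<le> C * Suc t ^ k" for t
    proof -
      have "?h u \<le> C * Suc t ^ j" if "u \<le> t" for u
      proof -
        have "C * Suc u ^ j \<le> C * Suc t ^ j" using that by (intro mult_le_mono2 power_mono) auto
        with Cj[of u] show ?thesis by (rule le_trans)
      qed
      hence "(\<Sum>u\<le>t. ?h u) \<le> (\<Sum>u\<le>t. C * Suc t ^ j)" by (intro sum_mono) auto
      thus ?thesis using Suc by (simp add: mult.left_commute mult.commute)
    qed
    thus ?thesis by blast
  qed
  then obtain D where D: "\<And>t. hilbert_fun P t \<le> D * Suc t ^ k" unfolding sum by blast
  have "Suc t * hilbert_fun P t \<le> D * Suc t ^ Suc k" for t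
    using mult_le_mono2[OF D[of t], of "Suc t"] by (simp only: power_Suc mult.left_commute)
  thus ?thesis unfolding growth_le_def by blast
qed

text \<open>Cutting with a variable outside \<open>P\<close> lowers the order of growth by at most
  one. Some prime over the section therefore still grows fast enough to continue the chain, and it
  contains \<open>P\<close> strictly because it contains that variable.\<close>

lemma chain_of_growth_point:
  fixes I :: "('x::finite, 'k::field) mpoly set"
  assumes "P \<in> proj_points I" "\<not> growth_le k P"
  shows "\<exists>C. C 0 = P \<and> point_chain I k C"
  using assms
proof (induction k arbitrary: P)
  case 0
  thus ?case by (intro exI[of _ "\<lambda>_. P"]) (simp add: point_chain_def)
next
  case (Suc k)
  note P = Suc.prems(1)
  note pP = point_var(1)[OF P]
  obtain x where x: "var x \<notin> P" using point_var(3)[OF P] by blast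
  have "\<not> growth_le k (ideal_insert P (var x))" using growth_le_sum[OF pP x] Suc.prems(2) by blast
  then obtain Q where Q: "Q \<in> proj_points (ideal_insert P (var x))" "\<not> growth_le k Q"
    using prime_of_growth[OF homogeneous_ideal_insert[OF homogeneous_primeD(1)[OF pP] var_in_forms]] by blast
  have sub: "P \<subseteq> Q" "var x \<in> Q"
    using point_var(2)[OF Q(1)] subset_ideal_insert[of P "var x"] in_ideal_insert[of "var x" P] by blast+
  have "Q \<in> proj_points I" using Q(1) sub(1) P by (auto simp: proj_points_def)
  then obtain C where C: "C 0 = Q" "point_chain I k C" using Suc.IH Q(2) by blast
  have "point_chain I (Suc k) (case_nat P C)"
    unfolding point_chain_def
  proof (intro conjI allI impI)
    fix i assume "i \<le> Suc k"
    thus "case_nat P C i \<in> proj_points I" using C(2) P by (cases i) (auto simp: point_chain_def)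
  next
    fix i assume "i < Suc k"
    thus "case_nat P C i \<subset> case_nat P C (Suc i)"
      using C sub x by (cases i) (auto simp: point_chain_def)
  qed
  thus ?case by (intro exI[of _ "case_nat P C"]) simp
qed

lemma chain_of_growth:
  fixes I :: "('x::finite, 'k::field) mpoly set"
  assumes "homogeneous_ideal I" "\<not> growth_le k I"
  shows "\<exists>C. point_chain I k C"
  using prime_of_growth[OF assms] chain_of_growth_point by blast

text \<open>The bridge from Hilbert functions to the dimension: fast growth produces chains of
  points, slow growth limits their length.\<close>

lemma has_proj_dimI:
  fixes I :: "('x::finite, 'k::field) mpoly set"
  assumes "homogeneous_ideal I" "growth_le (Suc k) I" "\<not> growth_le k I"
  shows "has_proj_dim I k"
  unfolding has_proj_dim_def
  using chain_of_growth[OF assms(1,3)] no_long_chain[OF assms(1,2)] by blast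

lemma zero_dim_bounded:
  fixes I :: "('x::finite, 'k::field) mpoly set"
  assumes I: "homogeneous_ideal I" and dim: "has_proj_dim I 0"
  shows "\<exists>C. \<forall>t. hilbert_fun I t \<le> C" "I \<noteq> UNIV"
proof -
  have "growth_le 1 I"
    using chain_of_growth[OF I, of 1] dim unfolding has_proj_dim_def by auto
  then obtain C where C: "\<And>t. Suc t * hilbert_fun I t \<le> C * Suc t"
    unfolding growth_le_def by auto
  have "hilbert_fun I t \<le> C" for t
    using C[of t] mult.commute[of C "Suc t"] Suc_mult_le_cancel1[of t "hilbert_fun I t" C] by metis
  thus "\<exists>C. \<forall>t. hilbert_fun I t \<le> C" by blast
  obtain P where "P \<in> proj_points I" using dim unfolding has_proj_dim_def point_chain_def by auto
  thus "I \<noteq> UNIV" by (auto simp: proj_points_def)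
qed

text \<open>For saturated \<open>I\<close> a general form is a nonzerodivisor, so the increments of
  the Hilbert function of \<open>I\<close> are the values for the section. A bounded function cannot
  increase strictly forever, hence some value is 0.\<close>

lemma general_section_artinian:
  fixes I :: "('x::finite, 'k::field_char_0) mpoly set"
  assumes I: "homogeneous_ideal I" "saturated I" and dim: "has_proj_dim I 0"
  shows "for_general_forms 1 (\<lambda>L. (\<forall>f. L 0 * f \<in> I \<longrightarrow> f \<in> I) \<and> (\<exists>N. forms N \<subseteq> add_forms I 1 L))"
proof (rule for_general_forms_mono[OF general_nonzerodivisor[OF I(1)]])
  note sI = homogeneous_idealD(1)[OF I(1)]
  fix c :: "nat \<times> 'x \<Rightarrow> 'k"
  assume "\<forall>f. forms_of c 0 * f \<in> I \<longrightarrow> f \<in> saturation I"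
  hence nzd: "\<forall>f. forms_of c 0 * f \<in> I \<longrightarrow> f \<in> I" using saturated_imp[OF I(2)] by blast
  hence colon: "colon I (forms_of c 0) = I"
    using subset_colon[OF sI, of "forms_of c 0"] by (auto simp: in_colon_iff)
  let ?J = "add_forms I 1 (forms_of c)"
  have J: "?J = ideal_insert I (forms_of c 0)"
    using add_forms_Suc[of I 0 "forms_of c"] add_forms_0[OF sI] by simp
  have step: "hilbert_fun I (Suc t) = hilbert_fun ?J (Suc t) + hilbert_fun I t" for t
    using hilbert_fun_exact[OF I(1) linear_form_in_forms[of "\<lambda>x. c (0, x)"], of t] colon J by simp
  obtain C where C: "\<And>t. hilbert_fun I t \<le> C" using zero_dim_bounded(1)[OF I(1) dim] by blast
  have "\<exists>N. hilbert_fun ?J (Suc N) = 0"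
  proof (rule ccontr)
    assume "\<not> (\<exists>N. hilbert_fun ?J (Suc N) = 0)"
    hence "hilbert_fun I t < hilbert_fun I (Suc t)" for t using step[of t] by simp
    hence "strict_mono (hilbert_fun I)" by (simp add: strict_mono_Suc_iff)
    hence "Suc C \<le> hilbert_fun I (Suc C)" by (rule strict_mono_imp_increasing)
    thus False using C[of "Suc C"] by simp
  qed
  then obtain N where "forms N \<subseteq> ?J" using hilbert_fun_eq_0_iff[OF add_forms_subspace] by blast
  thus "(\<forall>f. forms_of c 0 * f \<in> I \<longrightarrow> f \<in> I) \<and> (\<exists>N. forms N \<subseteq> ?J)" using nzd by blast
qed simp

section \<open>Regular sequences of linear forms\<close>

interpretation subst: coeff_hom "single 0 :: 'k::comm_ring_1 \<Rightarrow> ('x, 'k) mpoly"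
  by unfold_locales (simp_all add: single_add mult_single)

lemma homogeneous_zero_ideal: "homogeneous_ideal {0}"
  by (simp add: homogeneous_ideal_iff)

lemma form_in_add_forms: "i < k \<Longrightarrow> L i \<in> add_forms I k L"
  unfolding add_forms_def by (intro idl.span_base) auto

lemma in_lin_ideal_iff: "f \<in> add_forms {0} k l \<longleftrightarrow> (\<exists>r. f = (\<Sum>i<k. r i * l i))"
  using in_add_forms_iff[of "{0}" f k l] by auto

lemma in_add_forms_split:
  assumes J: "idl.subspace J"
  shows "f \<in> add_forms J k l \<longleftrightarrow> (\<exists>s\<in>add_forms {0} k l. f - s \<in> J)"
  unfolding in_add_forms_iff[OF J] in_lin_ideal_iff Bex_def by blast

text \<open>A coordinate system reduced to what the later arguments use. It allows the chosen
  general forms to act as the first coordinates without transporting \<open>J\<close> along a linear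
  change of variables.\<close>

locale regular_forms =
  fixes l :: "nat \<Rightarrow> ('x::finite, 'k::field_char_0) mpoly" and n :: nat
  assumes linear: "\<And>i. i < n \<Longrightarrow> l i \<in> forms (Suc 0)"
    and regular: "\<And>k a. k < n \<Longrightarrow> l k * a \<in> add_forms {0} k l \<Longrightarrow> a \<in> add_forms {0} k l"
    and full: "irrelevant_ideal \<subseteq> add_forms {0} n l"

text \<open>
  The ideal generated by linearly independent linear forms is the kernel of the substitution
  induced by a linear projection along their span, hence prime.
\<close>

lemma independent_forms_regular:
  fixes B :: "('x::finite, 'k::field_char_0) mpoly set"
  assumes B: "vs.independent B" "B \<subseteq> forms (Suc 0)" "forms (Suc 0) \<subseteq> vs.span B"
    and l: "bij_betw l {..<n} B"
  shows "regular_forms l n"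
proof
  show l1: "l i \<in> forms (Suc 0)" if "i < n" for i using that B(2) l by (auto simp: bij_betw_def)
  show "irrelevant_ideal \<subseteq> add_forms {0} n l"
  proof (rule irrelevant_ideal_subset[OF add_forms_subspace])
    fix x
    have "B \<subseteq> add_forms {0} n l"
      unfolding bij_betw_imp_surj_on[OF l, symmetric]
      by (rule image_subsetI) (simp add: form_in_add_forms)
    hence "vs.span B \<subseteq> add_forms {0} n l"
      by (rule vs.span_minimal) (rule ideal_vs_subspace[OF add_forms_subspace])
    thus "var x \<in> add_forms {0} n l" by (rule subsetD[OF _ subsetD[OF B(3) var_in_forms]])
  qed
  fix k a assume k: "k < n" and la: "l k * a \<in> add_forms {0} k l"
  let ?a = "add_forms {0} k l"
  note sa = add_forms_subspace[of "{0}" k l]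
  define A where "A = l ` {..<k}"
  have AB: "A \<subseteq> B" using l k by (auto simp: A_def bij_betw_def)
  have lkA: "l k \<notin> A"
  proof
    assume "l k \<in> A"
    then obtain i where "i < k" "l k = l i" by (auto simp: A_def)
    thus False using l k by (auto simp: bij_betw_def dest: inj_onD)
  qed
  have lkB: "l k \<in> B" using l k by (auto simp: bij_betw_def)
  have Aa: "A \<subseteq> ?a"
    unfolding A_def by (rule image_subsetI) (simp add: form_in_add_forms)
  interpret vp: vector_space_pair "scalar_mult :: 'k \<Rightarrow> ('x, 'k) mpoly \<Rightarrow> _" "scalar_mult :: 'k \<Rightarrow> ('x, 'k) mpoly \<Rightarrow> _"
    by unfold_locales
  obtain p where p: "Vector_Spaces.linear scalar_mult scalar_mult p" "\<forall>b\<in>B. p b = (if b \<in> A then 0 else b)"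
    using vp.linear_independent_extend[OF B(1), of "\<lambda>b. if b \<in> A then 0 else b"] by blast
  interpret p: Vector_Spaces.linear "scalar_mult :: 'k \<Rightarrow> ('x, 'k) mpoly \<Rightarrow> _" scalar_mult p by (rule p(1))
  \<comment> \<open>On linear forms the substitution is the projection \<open>p\<close>. It is the
    identity modulo \<open>?a\<close> and kills \<open>?a\<close>, so its kernel is exactly
    \<open>?a\<close>; its values lie in a domain.\<close>
  define \<sigma> where "\<sigma> = subst.insertion (\<lambda>x. p (var x))"
  have proj: "v - p v \<in> ?a" if "v \<in> forms (Suc 0)" for v
  proof -
    have "v \<in> vs.span B" using that B(3) by blast
    thus ?thesis
    proof (induction rule: vs.span_induct_alt)
      case base
      show ?case using idl.subspace_0[OF sa] p.zero by simp
    next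
      case (step c b y)
      have "b - p b \<in> ?a" using step(1) p(2) Aa idl.subspace_0[OF sa] by auto
      hence "scalar_mult c (b - p b) + (y - p y) \<in> ?a"
        by (intro idl.subspace_add[OF sa] ideal_scalar_mult[OF sa] step(2))
      moreover have "scalar_mult c (b - p b) + (y - p y) = scalar_mult c b + y - p (scalar_mult c b + y)"
        by (simp add: p.add p.scale vs.scale_right_diff_distrib)
      ultimately show ?case by simp
    qed
  qed
  have \<sigma>_lin: "\<sigma> v = p v" if "v \<in> forms (Suc 0)" for v
  proof -
    have "v = (\<Sum>m\<in>keys v. scalar_mult (lookup v m) (single m 1))"
      using poly_mapping_sum_single[of v] by (simp add: scalar_mult_def mult_single)
    hence *: "p v = (\<Sum>m\<in>keys v. scalar_mult (lookup v m) (p (single m 1)))"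
      using p.sum[of "\<lambda>m. scalar_mult (lookup v m) (single m 1)" "keys v"] by (simp only: p.scale)
    have "\<sigma> v = (\<Sum>m\<in>keys v. scalar_mult (lookup v m) (p (single m 1)))"
      unfolding \<sigma>_def subst.insertion_def
    proof (rule sum.cong[OF refl])
      fix m assume "m \<in> keys v"
      hence "mon_deg m = Suc 0" using that by (auto simp: forms_def)
      then obtain x where "m = single x 1" using mon_deg_1 by blast
      thus "single 0 (lookup v m) * mono_val (\<lambda>x. p (var x)) m = scalar_mult (lookup v m) (p (single m 1))"
        unfolding scalar_mult_def by (simp only: mono_val_single)
    qed
    thus ?thesis using * by simp
  qed
  have mono: "single m c - \<sigma> (single m c) \<in> ?a" for m c
  proof (induction "mon_deg m" arbitrary: m)
    case 0
    hence "m = 0" by (simp add: mon_deg_eq_0_iff)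
    thus ?case using idl.subspace_0[OF sa] by (simp add: \<sigma>_def subst.insertion_single)
  next
    case (Suc t)
    hence "mon_deg m = Suc 0 + t" by simp
    then obtain u w where uw: "m = u + w" "mon_deg u = Suc 0" "mon_deg w = t" using mon_split by blast
    obtain x where x: "u = single x 1" using mon_deg_1[OF uw(2)] by blast
    let ?w = "single w c"
    have m: "single m c = var x * ?w" unfolding uw x by (simp add: mult_single)
    have "var x * (?w - \<sigma> ?w) + \<sigma> ?w * (var x - p (var x)) \<in> ?a"
      using Suc(1)[OF uw(3)[symmetric]] proj[OF var_in_forms]
      by (intro idl.subspace_add[OF sa] idl.subspace_scale[OF sa])
    moreover have "\<sigma> (single m c) = p (var x) * \<sigma> ?w"
      unfolding m using \<sigma>_lin[OF var_in_forms, of x] by (simp add: \<sigma>_def subst.insertion_mult)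
    ultimately show ?case unfolding m by (simp add: algebra_simps)
  qed
  have diff: "f - \<sigma> f \<in> ?a" for f
  proof -
    have "(\<Sum>m\<in>keys f. single m (lookup f m) - \<sigma> (single m (lookup f m))) \<in> ?a"
      by (intro idl.subspace_sum[OF sa] mono)
    moreover have "\<sigma> f = (\<Sum>m\<in>keys f. \<sigma> (single m (lookup f m)))"
      using arg_cong[OF poly_mapping_sum_single[of f], of \<sigma>] by (simp add: \<sigma>_def subst.insertion_sum)
    ultimately show ?thesis using poly_mapping_sum_single[of f] by (simp add: sum_subtractf)
  qed
  have kill: "\<sigma> f = 0" if "f \<in> ?a" for f
  proof -
    obtain r where r: "f = (\<Sum>i<k. r i * l i)" using \<open>f \<in> ?a\<close> in_lin_ideal_iff by blast
    have "\<sigma> (r i * l i) = 0" if "i < k" for i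
    proof -
      have "l i \<in> A" using that by (simp add: A_def)
      hence "p (l i) = 0" using p(2) AB by auto
      moreover have "l i \<in> forms (Suc 0)" using l1 that k by simp
      ultimately have "\<sigma> (l i) = 0" using \<sigma>_lin by simp
      thus ?thesis by (simp add: \<sigma>_def subst.insertion_mult)
    qed
    thus ?thesis unfolding r by (simp add: \<sigma>_def subst.insertion_sum)
  qed
  have "l k \<noteq> 0"
  proof
    assume "l k = 0"
    hence "0 \<in> B" using lkB by simp
    thus False using vs.dependent_zero[of B] B(1) by simp
  qed
  moreover have "\<sigma> (l k) = l k" using \<sigma>_lin[OF l1[OF k]] p(2) lkB lkA by simp
  moreover have "\<sigma> (l k) * \<sigma> a = 0" using kill[OF la] by (simp add: \<sigma>_def subst.insertion_mult)
  ultimately have "\<sigma> a = 0" using mpoly_mult_eq_0[of "\<sigma> (l k)" "\<sigma> a"] by simp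
  thus "a \<in> ?a" using diff[of a] by simp
qed

text \<open>The given forms keep their places at the front, because all later conditions speak about
  initial segments of the sequence.\<close>

lemma regular_forms_extend:
  fixes L :: "nat \<Rightarrow> ('x::finite, 'k::field_char_0) mpoly"
  assumes L: "inj_on L {..<r}" "vs.independent (L ` {..<r})" "L ` {..<r} \<subseteq> forms (Suc 0)"
  shows "\<exists>l n. r \<le> n \<and> (\<forall>i<r. l i = L i) \<and> regular_forms l n"
proof -
  obtain B where B: "L ` {..<r} \<subseteq> B" "B \<subseteq> forms (Suc 0)" "vs.independent B" "forms (Suc 0) \<subseteq> vs.span B"
    using L(3,2) by (rule vs.maximal_independent_subset_extend)
  have "finite B" using fin_dim_independent[OF fin_dim_forms B(2,3)] .
  hence "finite (B - L ` {..<r})" by simp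
  then obtain e where e: "bij_betw e {0..<card (B - L ` {..<r})} (B - L ` {..<r})"
    using ex_bij_betw_nat_finite by blast
  let ?m = "card (B - L ` {..<r})"
  define l where "l i = (if i < r then L i else e (i - r))" for i
  have 1: "bij_betw l {..<r} (L ` {..<r})"
  proof -
    have "bij_betw L {..<r} (L ` {..<r})" using L(1) by (simp add: bij_betw_def)
    thus ?thesis by (rule bij_betw_cong[THEN iffD1, rotated]) (simp add: l_def)
  qed
  have 2: "bij_betw l {r..<r + ?m} (B - L ` {..<r})"
  proof -
    have "bij_betw (\<lambda>i. i - r) {r..<r + ?m} {0..<?m}"
      by (rule bij_betwI[of _ _ _ "\<lambda>i. i + r"]) auto
    from bij_betw_trans[OF this e] have "bij_betw (e \<circ> (\<lambda>i. i - r)) {r..<r + ?m} (B - L ` {..<r})" .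
    thus ?thesis by (rule bij_betw_cong[THEN iffD1, rotated]) (simp add: l_def)
  qed
  have "bij_betw l ({..<r} \<union> {r..<r + ?m}) (L ` {..<r} \<union> (B - L ` {..<r}))"
    by (rule bij_betw_combine[OF 1 2]) auto
  moreover have "{..<r} \<union> {r..<r + ?m} = {..<r + ?m}" by auto
  moreover have "L ` {..<r} \<union> (B - L ` {..<r}) = B" using B(1) by blast
  ultimately have "bij_betw l {..<r + ?m} B" by simp
  hence "regular_forms l (r + ?m)" by (rule independent_forms_regular[OF B(3,2,4)])
  thus ?thesis by (intro exI[of _ l] exI[of _ "r + ?m"]) (simp add: l_def)
qed

context regular_forms
begin

abbreviation lin :: "nat \<Rightarrow> ('x, 'k) mpoly set" where
  "lin k \<equiv> add_forms {0} k l"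

lemma lin_subspace: "idl.subspace (lin k)"
  by (rule add_forms_subspace)

lemma homogeneous_lin: "k \<le> n \<Longrightarrow> homogeneous_ideal (lin k)"
  using linear by (intro homogeneous_add_forms homogeneous_zero_ideal) auto

lemma l_in_lin: "i < k \<Longrightarrow> l i \<in> lin k"
  by (rule form_in_add_forms)

lemma lin_mono: "j \<le> k \<Longrightarrow> lin j \<subseteq> lin k"
  by (rule add_forms_mono_index)

lemma linear_1: "i < n \<Longrightarrow> l i \<in> forms 1"
  using linear by simp

text \<open>
  If \<open>J\<close> is generated in degrees at most \<open>d\<close>, the following two conditions propagate each other from
  degree \<open>d\<close> to all larger degrees. This replaces the regularity criterion of Bayer and Stillman.
\<close>

definition colon_cond :: "('x, 'k) mpoly set \<Rightarrow> nat \<Rightarrow> bool" where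
  "colon_cond J q \<longleftrightarrow> (\<forall>k<n. \<forall>f\<in>forms q. l k * f \<in> add_forms J k l \<longrightarrow> f \<in> add_forms J k l)"

definition cap_cond :: "('x, 'k) mpoly set \<Rightarrow> nat \<Rightarrow> bool" where
  "cap_cond J q \<longleftrightarrow> (\<forall>k\<le>n. \<forall>f\<in>J \<inter> forms (Suc q) \<inter> lin k.
     \<exists>z. (\<forall>i. z i \<in> J \<inter> forms q) \<and> f = (\<Sum>i<k. z i * l i))"

text \<open>Induction on the number of forms. If \<open>f\<close> in \<open>J\<close> is
  \<open>l k * w\<close> modulo the earlier forms, then the colon condition moves \<open>w\<close>
  into \<open>J\<close> up to the earlier forms, giving \<open>z\<close> in \<open>J\<close>; now
  \<open>f - l k * z\<close> is in \<open>J\<close> and in the ideal of one form fewer.\<close>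

lemma colon_imp_cap:
  assumes J: "homogeneous_ideal J" and T: "colon_cond J q"
  shows "cap_cond J q"
proof -
  note sJ = homogeneous_idealD(1)[OF J]
  have "\<exists>z. (\<forall>i. z i \<in> J \<inter> forms q) \<and> f = (\<Sum>i<k. z i * l i)"
    if "k \<le> n" "f \<in> J" "f \<in> forms (Suc q)" "f \<in> lin k" for k f
    using that
  proof (induction k arbitrary: f)
    case 0
    hence "f = 0" using in_lin_ideal_iff[of f 0 l] by simp
    thus ?case using idl.subspace_0[OF sJ] by (intro exI[of _ "\<lambda>_. 0"]) simp
  next
    case (Suc k)
    hence k: "k < n" by simp
    obtain w where w: "f - w * l k \<in> lin k"
      using Suc.prems(4) in_ideal_insert_iff[OF lin_subspace] unfolding add_forms_Suc by blast
    define w' where "w' = hcomp q w"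
    have "hcomp (Suc q) (f - l k * w) \<in> lin k"
      by (rule homogeneous_idealD(2)[OF homogeneous_lin]) (use k w in \<open>simp_all add: mult.commute\<close>)
    hence w': "f - l k * w' \<in> lin k"
      using hcomp_form_mult[OF linear[OF k], of "Suc q" w] hcomp_same[OF Suc.prems(3)]
      by (simp add: hcomp_diff w'_def)
    have "l k * w' \<in> add_forms J k l"
      unfolding in_add_forms_split[OF sJ]
      by (rule bexI[OF _ idl.subspace_neg[OF lin_subspace w']]) (use Suc.prems(2) in simp)
    hence "w' \<in> add_forms J k l" using T k unfolding colon_cond_def w'_def by simp
    then obtain s where s: "s \<in> lin k" "w' - s \<in> J" using in_add_forms_split[OF sJ] by blast
    define z where "z = hcomp q (w' - s)"
    have zJ: "z \<in> J" unfolding z_def by (rule homogeneous_idealD(2)[OF J s(2)])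
    have "w' - z = hcomp q s" by (simp add: z_def hcomp_diff w'_def hcomp_same)
    hence wz: "w' - z \<in> lin k" using homogeneous_idealD(2)[OF homogeneous_lin s(1), of q] k by simp
    have zf: "z \<in> forms q" by (simp add: z_def)
    have "(f - l k * w') + l k * (w' - z) \<in> lin k"
      by (rule idl.subspace_add[OF lin_subspace w' idl.subspace_scale[OF lin_subspace wz]])
    hence 1: "f - l k * z \<in> lin k" by (simp add: algebra_simps)
    have 2: "f - l k * z \<in> J" by (rule idl.subspace_diff[OF sJ Suc.prems(2) idl.subspace_scale[OF sJ zJ]])
    have "l k * z \<in> forms (Suc q)" using forms_mult[OF linear[OF k] zf] by simp
    hence 3: "f - l k * z \<in> forms (Suc q)" by (intro forms_diff Suc.prems(3))
    from Suc.IH[OF _ 2 3 1] k obtain y where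
      y: "\<forall>i. y i \<in> J \<inter> forms q" "f - l k * z = (\<Sum>i<k. y i * l i)" by auto
    have "f = (\<Sum>i<Suc k. (y(k := z)) i * l i)" using y(2) by (simp add: algebra_simps)
    thus ?case using y(1) zJ zf by (intro exI[of _ "y(k := z)"]) simp
  qed
  thus ?thesis unfolding cap_cond_def by blast
qed

text \<open>Modulo \<open>lin k\<close> the product \<open>l k * f\<close> is a combination of all
  \<open>n\<close> forms with coefficients in \<open>J\<close>. While the last index
  \<open>j\<close> exceeds \<open>k\<close>, regularity puts the coefficient \<open>g j\<close> into
  \<open>lin j\<close>, the cap condition expands it with coefficients in \<open>J\<close>, and the
  expansion is absorbed into the earlier coefficients. When only indices up to \<open>k\<close>
  remain, \<open>l k\<close> can be cancelled from \<open>l k * (f - g k)\<close>.\<close>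

lemma cap_imp_colon:
  assumes J: "homogeneous_ideal J" and S: "cap_cond J q"
    and gen: "\<And>f. f \<in> J \<inter> forms (Suc (Suc q)) \<Longrightarrow>
      \<exists>g. (\<forall>i. g i \<in> J \<inter> forms (Suc q)) \<and> f = (\<Sum>i<n. g i * l i)"
  shows "colon_cond J (Suc q)"
  unfolding colon_cond_def
proof (intro allI ballI impI)
  fix k f assume k: "k < n" and f: "f \<in> forms (Suc q)" and lf: "l k * f \<in> add_forms J k l"
  note sJ = homogeneous_idealD(1)[OF J]
  obtain s where s: "s \<in> lin k" "l k * f - s \<in> J" using lf in_add_forms_split[OF sJ] by blast
  define s' where "s' = hcomp (Suc (Suc q)) s"
  have s': "s' \<in> lin k" unfolding s'_def using k by (intro homogeneous_idealD(2)[OF homogeneous_lin s(1)]) simp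
  have lff: "l k * f \<in> forms (Suc (Suc q))" using forms_mult[OF linear[OF k] f] by simp
  have "hcomp (Suc (Suc q)) (l k * f - s) \<in> J" by (rule homogeneous_idealD(2)[OF J s(2)])
  hence "l k * f - s' \<in> J \<inter> forms (Suc (Suc q))"
    using lff by (simp add: hcomp_diff hcomp_same s'_def forms_diff)
  from gen[OF this] obtain g where
    g: "\<forall>i. g i \<in> J \<inter> forms (Suc q)" "l k * f - s' = (\<Sum>i<n. g i * l i)" by blast
  have descend: "\<exists>g. (\<forall>i. g i \<in> J \<inter> forms (Suc q)) \<and> l k * f - (\<Sum>i<j. g i * l i) \<in> lin k"
    if "j \<le> n" "k < j" for j
    using that
  proof (induction j rule: inc_induct)
    case base
    have "l k * f - (\<Sum>i<n. g i * l i) = s'" unfolding g(2)[symmetric] by simp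
    thus ?case using g(1) s' by auto
  next
    case (step j)
    then obtain g where g: "\<forall>i. g i \<in> J \<inter> forms (Suc q)" "l k * f - (\<Sum>i<Suc j. g i * l i) \<in> lin k" by auto
    have kj: "lin k \<subseteq> lin j" using step.prems by (intro lin_mono) simp
    have "l k * f \<in> lin j"
      using idl.subspace_scale[OF lin_subspace l_in_lin[OF step.prems], of f] by (simp add: mult.commute)
    moreover have "(\<Sum>i<j. g i * l i) \<in> lin j" using in_lin_ideal_iff by blast
    ultimately have a: "l k * f - (\<Sum>i<j. g i * l i) \<in> lin j" by (rule idl.subspace_diff[OF lin_subspace])
    from idl.subspace_diff[OF lin_subspace a subsetD[OF kj g(2)]]
    have "l j * g j \<in> lin j" by (simp add: algebra_simps)
    hence "g j \<in> lin j" using regular step.hyps by simp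
    hence "\<exists>h. (\<forall>i. h i \<in> J \<inter> forms q) \<and> g j = (\<Sum>i<j. h i * l i)"
      using S step.hyps g(1) unfolding cap_cond_def by simp
    then obtain h where h: "\<forall>i. h i \<in> J \<inter> forms q" "g j = (\<Sum>i<j. h i * l i)" by blast
    define g' where "g' i = g i + l j * h i" for i
    have jn: "j < n" using step.hyps by simp
    have "g' i \<in> J" for i unfolding g'_def using g(1) h(1)
      by (intro idl.subspace_add[OF sJ] idl.subspace_scale[OF sJ]) auto
    moreover have "g' i \<in> forms (Suc q)" for i
      unfolding g'_def using g(1) h(1) forms_mult[OF linear[OF jn], of "h i" q] by (intro forms_add) auto
    moreover have "(\<Sum>i<j. g' i * l i) = (\<Sum>i<Suc j. g i * l i)"
    proof -
      have "(\<Sum>i<j. g' i * l i) = (\<Sum>i<j. g i * l i + (h i * l i) * l j)"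
        by (intro sum.cong refl) (simp add: g'_def algebra_simps)
      also have "\<dots> = (\<Sum>i<j. g i * l i) + g j * l j"
        unfolding sum.distrib sum_distrib_right[symmetric] h(2)[symmetric] ..
      finally show ?thesis by simp
    qed
    ultimately show ?case using g(2) by (intro exI[of _ g']) simp
  qed
  from descend[of "Suc k"] k obtain g where
    g: "\<forall>i. g i \<in> J \<inter> forms (Suc q)" "l k * f - (\<Sum>i<Suc k. g i * l i) \<in> lin k" by auto
  have "(\<Sum>i<k. g i * l i) \<in> lin k" using in_lin_ideal_iff by blast
  from idl.subspace_add[OF lin_subspace g(2) this] have "l k * (f - g k) \<in> lin k" by (simp add: algebra_simps)
  hence "f - g k \<in> lin k" by (rule regular[OF k])
  thus "f \<in> add_forms J k l"
    unfolding in_add_forms_split[OF sJ] by (rule bexI[rotated]) (use g(1) in simp)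
qed

lemma colon_cond_upward:
  assumes J: "homogeneous_ideal J" and d: "colon_cond J d"
    and gen: "\<And>q f. d \<le> q \<Longrightarrow> f \<in> J \<inter> forms (Suc q) \<Longrightarrow>
      \<exists>g. (\<forall>i. g i \<in> J \<inter> forms q) \<and> f = (\<Sum>i<n. g i * l i)"
    and "d \<le> q"
  shows "colon_cond J q"
  using \<open>d \<le> q\<close>
proof (induction q rule: dec_induct)
  case (step q)
  show ?case
    by (rule cap_imp_colon[OF J colon_imp_cap[OF J step.IH]]) (rule gen, use step in auto)
qed (rule d)

end

section \<open>Graded submodules of free modules and their syzygies\<close>

text \<open>
  The free module on \<open>b\<close> generators of degrees \<open>a 0, \<dots>, a (b - 1)\<close> consists of the functions on
  the natural numbers that vanish from \<open>b\<close> on.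
\<close>

definition smul :: "'a::comm_ring_1 \<Rightarrow> (nat \<Rightarrow> 'a) \<Rightarrow> nat \<Rightarrow> 'a" where
  "smul r v = (\<lambda>i. r * v i)"

interpretation fm: module "smul :: 'a::comm_ring_1 \<Rightarrow> (nat \<Rightarrow> 'a) \<Rightarrow> nat \<Rightarrow> 'a"
  by unfold_locales (auto simp: smul_def fun_eq_iff algebra_simps)

declare fm.scale_scale [simp del]

text \<open>The field acts through constant polynomials. This vector space structure serves to pick
  finite bases of the graded pieces.\<close>

definition fscale :: "'k::field \<Rightarrow> (nat \<Rightarrow> ('x, 'k) mpoly) \<Rightarrow> nat \<Rightarrow> ('x, 'k) mpoly" where
  "fscale c = smul (single 0 c)"

interpretation fvs: vector_space "fscale :: 'k::field \<Rightarrow> (nat \<Rightarrow> ('x, 'k) mpoly) \<Rightarrow> _"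
  by unfold_locales
    (auto simp: fscale_def smul_def fun_eq_iff algebra_simps single_add mult_single simp flip: mult.assoc)

lemma smul_apply: "smul r v i = r * v i"
  by (simp add: smul_def)

lemma sum_fun_apply: "(\<Sum>a\<in>A. f a) i = (\<Sum>a\<in>A. f a i)"
  by (induction A rule: infinite_finite_induct) auto

section \<open>Homogeneous vectors and their components\<close>

definition vec :: "nat \<Rightarrow> (nat \<Rightarrow> 'a::zero) \<Rightarrow> bool" where
  "vec b v \<longleftrightarrow> (\<forall>i\<ge>b. v i = 0)"

definition hvec :: "nat \<Rightarrow> (nat \<Rightarrow> nat) \<Rightarrow> nat \<Rightarrow> (nat \<Rightarrow> ('x, 'k::zero) mpoly) \<Rightarrow> bool" where
  "hvec b a q v \<longleftrightarrow> vec b v \<and> (\<forall>i<b. \<forall>m\<in>keys (v i). a i + mon_deg m = q)"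

text \<open>Coordinates with \<open>a i > q\<close> must be set to 0 explicitly, since the truncated
  difference \<open>q - a i\<close> would select their constant terms.\<close>

definition vcomp :: "nat \<Rightarrow> (nat \<Rightarrow> nat) \<Rightarrow> nat \<Rightarrow> (nat \<Rightarrow> ('x, 'k::comm_ring_1) mpoly) \<Rightarrow> nat \<Rightarrow> ('x, 'k) mpoly"
  where "vcomp b a q v = (\<lambda>i. if i < b \<and> a i \<le> q then hcomp (q - a i) (v i) else 0)"

lemma hvec_vcomp: "hvec b a q (vcomp b a q v)"
proof -
  have "a i + mon_deg m = q" if "i < b" "m \<in> keys (vcomp b a q v i)" for i m
    using that hcomp_in_forms[of "q - a i" "v i"]
    by (auto simp: vcomp_def forms_def split: if_splits)
  thus ?thesis by (auto simp: hvec_def vec_def vcomp_def)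
qed

lemma vcomp_hvec:
  assumes v: "hvec b a q v"
  shows "vcomp b a p v = (if p = q then v else 0)"
proof
  fix i
  show "vcomp b a p v i = (if p = q then v else 0) i"
  proof (cases "i < b")
    case True
    have *: "m \<in> keys (v i) \<Longrightarrow> a i + mon_deg m = q" for m using v True by (auto simp: hvec_def)
    show ?thesis
    proof (cases "a i \<le> q")
      case aq: True
      have f: "v i \<in> forms (q - a i)" using * by (force simp: forms_def)
      show ?thesis using True aq by (auto simp: vcomp_def hcomp_forms[OF f])
    next
      case False
      have "v i = 0" by (rule poly_mapping_eqI) (use * False in \<open>force simp: in_keys_iff\<close>)
      thus ?thesis by (simp add: vcomp_def)
    qed
  qed (use v in \<open>auto simp: vcomp_def hvec_def vec_def\<close>)
qed

lemma vcomp_add: "vcomp b a q (v + w) = vcomp b a q v + vcomp b a q w"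
  by (rule ext) (simp add: vcomp_def hcomp_add)

lemma vcomp_diff: "vcomp b a q (v - w) = vcomp b a q v - vcomp b a q w"
  by (rule ext) (simp add: vcomp_def hcomp_diff)

lemma vcomp_0: "vcomp b a q 0 = 0"
  by (rule ext) (simp add: vcomp_def)

lemma vcomp_sum: "vcomp b a q (\<Sum>i\<in>A. f i) = (\<Sum>i\<in>A. vcomp b a q (f i))"
  by (induction A rule: infinite_finite_induct)
    (simp_all only: sum.infinite sum.empty sum.insert not_False_eq_True vcomp_add vcomp_0)

lemma vcomp_smul_form:
  assumes f: "f \<in> forms e"
  shows "vcomp b a (q + e) (smul f v) = smul f (vcomp b a q v)"
proof
  fix i
  have *: "hcomp t (f * v i) = (if e \<le> t then f * hcomp (t - e) (v i) else 0)" for t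
    by (rule hcomp_form_mult[OF f])
  show "vcomp b a (q + e) (smul f v) i = smul f (vcomp b a q v) i"
    by (auto simp: vcomp_def smul_def *)
qed

lemma vcomp_smul_form_low:
  assumes f: "f \<in> forms e" and "q < e"
  shows "vcomp b a q (smul f v) = 0"
proof
  fix i
  have "\<not> e \<le> q - a i" using assms(2) by linarith
  thus "vcomp b a q (smul f v) i = 0 i" by (simp add: vcomp_def smul_def hcomp_form_mult[OF f])
qed

lemma vcomp_smul_hvec:
  assumes v: "hvec b a e v"
  shows "vcomp b a q (smul r v) = (if e \<le> q then smul (hcomp (q - e) r) v else 0)"
proof -
  obtain N where N: "\<forall>n\<ge>N. r = (\<Sum>i<n. hcomp i r)" using sum_hcomp_lessThan by blast
  let ?n = "N + q + 1"
  have "r = (\<Sum>i<?n. hcomp i r)" using N by (metis le_add1 add.assoc)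
  hence "smul r v = (\<Sum>i<?n. smul (hcomp i r) v)" using fm.scale_sum_left by metis
  hence "vcomp b a q (smul r v) = (\<Sum>i<?n. vcomp b a q (smul (hcomp i r) v))" by (simp only: vcomp_sum)
  also have "\<dots> = (\<Sum>i<?n. if i = q - e then (if e \<le> q then smul (hcomp i r) v else 0) else 0)"
  proof (intro sum.cong refl)
    fix i
    show "vcomp b a q (smul (hcomp i r) v) =
        (if i = q - e then (if e \<le> q then smul (hcomp i r) v else 0) else 0)"
    proof (cases "i \<le> q")
      case True
      have "vcomp b a q (smul (hcomp i r) v) = smul (hcomp i r) (vcomp b a (q - i) v)"
        using vcomp_smul_form[OF hcomp_in_forms, of b a "q - i" i r v] True by simp
      moreover have "q - i = e \<longleftrightarrow> i = q - e \<and> e \<le> q" using True by auto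
      ultimately show ?thesis unfolding vcomp_hvec[OF v] by auto
    next
      case False
      hence "vcomp b a q (smul (hcomp i r) v) = 0" by (intro vcomp_smul_form_low[OF hcomp_in_forms]) simp
      thus ?thesis using False by auto
    qed
  qed
  also have "\<dots> = (if e \<le> q then smul (hcomp (q - e) r) v else 0)" by (subst sum.delta) auto
  finally show ?thesis .
qed

lemma sum_vcomp:
  assumes v: "vec b v"
  shows "\<exists>N. v = (\<Sum>q<N. vcomp b a q v)"
proof -
  let ?D = "\<Union>i<b. (\<lambda>m. a i + mon_deg m) ` keys (v i)"
  obtain N where N: "?D \<subseteq> {..<N}" using finite_nat_iff_bounded[of ?D] by auto
  have "v i = (\<Sum>q<N. vcomp b a q v i)" for i
  proof (cases "i < b")
    case True
    show ?thesis
    proof (rule poly_mapping_eqI)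
      fix m
      have "(\<Sum>q<N. lookup (vcomp b a q v i) m) = (\<Sum>q<N. if q = a i + mon_deg m then lookup (v i) m else 0)"
        using True by (intro sum.cong refl) (auto simp: vcomp_def lookup_hcomp when_def)
      also have "\<dots> = lookup (v i) m"
      proof (cases "m \<in> keys (v i)")
        case mk: True
        hence "a i + mon_deg m < N" using N True by auto
        thus ?thesis by (simp add: sum.delta)
      qed (simp add: in_keys_iff sum.delta)
      finally show "lookup (v i) m = lookup (\<Sum>q<N. vcomp b a q v i) m" by (simp add: lookup_sum)
    qed
  qed (use v in \<open>simp add: vec_def vcomp_def\<close>)
  thus ?thesis by (intro exI[of _ N] ext) (simp add: sum_fun_apply)
qed

definition graded_submodule :: "nat \<Rightarrow> (nat \<Rightarrow> nat) \<Rightarrow> (nat \<Rightarrow> ('x, 'k::comm_ring_1) mpoly) set \<Rightarrow> bool" where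
  "graded_submodule b a N \<longleftrightarrow> fm.subspace N \<and> (\<forall>v\<in>N. vec b v) \<and> (\<forall>v\<in>N. \<forall>q. vcomp b a q v \<in> N)"

lemma fm_fvs_subspace: "fm.subspace N \<Longrightarrow> fvs.subspace N"
  by (intro fvs.subspaceI) (auto simp: fscale_def intro: fm.subspace_0 fm.subspace_add fm.subspace_scale)

lemma finite_dim_hvec:
  "\<exists>E. finite E \<and> {v. hvec b a q v} \<subseteq> fvs.span (E :: (nat \<Rightarrow> ('x::finite, 'k::field) mpoly) set)"
proof -
  let ?e = "\<lambda>i m j. if j = i then single m (1::'k) else 0"
  let ?S = "SIGMA i:{..<b}. \<Union>t\<le>q. {m :: 'x \<Rightarrow>\<^sub>0 nat. mon_deg m = t}"
  let ?E = "(\<lambda>(i, m). ?e i m) ` ?S"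
  have "finite ?E" using finite_mon_deg by (intro finite_imageI finite_SigmaI finite_UN_I) auto
  moreover have "v \<in> fvs.span ?E" if v: "hvec b a q v" for v
  proof -
    have "v = (\<Sum>i<b. \<Sum>m\<in>keys (v i). fscale (lookup (v i) m) (?e i m))"
    proof
      fix j
      have inner: "(\<Sum>m\<in>keys (v i). fscale (lookup (v i) m) (?e i m)) j = (if j = i then v i else 0)" for i
      proof (cases "j = i")
        case True
        have "v i = (\<Sum>m\<in>keys (v i). single m (lookup (v i) m))" by (rule poly_mapping_sum_single)
        thus ?thesis using True by (simp add: sum_fun_apply fscale_def smul_def mult_single)
      qed (simp add: sum_fun_apply fscale_def smul_def)
      have "(\<Sum>i<b. \<Sum>m\<in>keys (v i). fscale (lookup (v i) m) (?e i m)) j = (\<Sum>i<b. if j = i then v i else 0)"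
        unfolding sum_fun_apply[of _ "{..<b}"] inner ..
      also have "\<dots> = v j" using v by (auto simp: sum.delta' hvec_def vec_def)
      finally show "v j = (\<Sum>i<b. \<Sum>m\<in>keys (v i). fscale (lookup (v i) m) (?e i m)) j" ..
    qed
    moreover have "(\<Sum>i<b. \<Sum>m\<in>keys (v i). fscale (lookup (v i) m) (?e i m)) \<in> fvs.span ?E"
    proof (intro fvs.span_sum fvs.span_scale fvs.span_base)
      fix i m assume i: "i \<in> {..<b}" "m \<in> keys (v i)"
      hence "a i + mon_deg m = q" using v by (auto simp: hvec_def)
      hence "(i, m) \<in> ?S" using i by auto
      thus "?e i m \<in> ?E" by (intro image_eqI[of _ _ "(i, m)"]) auto
    qed
    ultimately show ?thesis by simp
  qed
  ultimately show ?thesis by blast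
qed

section \<open>Maps between free modules and their syzygies\<close>

definition lincomb :: "nat \<Rightarrow> (nat \<Rightarrow> nat \<Rightarrow> 'a::comm_ring_1) \<Rightarrow> (nat \<Rightarrow> 'a) \<Rightarrow> nat \<Rightarrow> 'a" where
  "lincomb b g c = (\<Sum>j<b. smul (c j) (g j))"

lemma lincomb_apply: "lincomb b g c i = (\<Sum>j<b. c j * g j i)"
  by (simp add: lincomb_def sum_fun_apply smul_def)

lemma lincomb_add: "lincomb b g (c + e) = lincomb b g c + lincomb b g e"
  by (simp add: lincomb_def fm.scale_left_distrib sum.distrib)

lemma lincomb_diff: "lincomb b g (c - e) = lincomb b g c - lincomb b g e"
  by (simp add: lincomb_def fm.scale_left_diff_distrib sum_subtractf)

lemma lincomb_smul: "lincomb b g (smul r c) = smul r (lincomb b g c)"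
  by (simp add: lincomb_def smul_apply fm.scale_sum_right fm.scale_scale)

lemma lincomb_0: "lincomb b g 0 = 0"
  by (simp add: lincomb_def)

lemma lincomb_sum: "lincomb b g (\<Sum>i\<in>A. f i) = (\<Sum>i\<in>A. lincomb b g (f i))"
  by (induction A rule: infinite_finite_induct)
    (simp_all only: sum.infinite sum.empty sum.insert not_False_eq_True lincomb_add lincomb_0)

lemma lincomb_cong: "(\<And>j. j < b \<Longrightarrow> c j = e j) \<Longrightarrow> lincomb b g c = lincomb b g e"
  by (simp add: lincomb_def)

lemma vcomp_lincomb:
  assumes g: "\<forall>j<b'. hvec b a (a' j) (g j)"
  shows "vcomp b a q (lincomb b' g c) = lincomb b' g (vcomp b' a' q c)"
  unfolding lincomb_def vcomp_sum
proof (rule sum.cong[OF refl])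
  fix j assume "j \<in> {..<b'}"
  hence j: "j < b'" by simp
  have "vcomp b' a' q c j = (if a' j \<le> q then hcomp (q - a' j) (c j) else 0)"
    using j by (simp add: vcomp_def)
  thus "vcomp b a q (smul (c j) (g j)) = smul (vcomp b' a' q c j) (g j)"
    using vcomp_smul_hvec[OF g[rule_format, OF j], of q "c j"] by (simp split: if_splits)
qed

lemma hvec_lincomb:
  assumes g: "\<forall>j<b'. hvec b a (a' j) (g j)" and c: "hvec b' a' q c"
  shows "hvec b a q (lincomb b' g c)"
  using hvec_vcomp[of b a q "lincomb b' g c"] vcomp_lincomb[OF g, of q c] vcomp_hvec[OF c, of q] by simp

text \<open>\<open>lincomb b g\<close> ignores entries from \<open>b\<close> on. Requiring
  \<open>vec b c\<close> makes the kernel a submodule of the free module of rank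
  \<open>b\<close>.\<close>

definition syzygies :: "nat \<Rightarrow> (nat \<Rightarrow> nat \<Rightarrow> 'a::comm_ring_1) \<Rightarrow> (nat \<Rightarrow> 'a) set" where
  "syzygies b g = {c. vec b c \<and> lincomb b g c = 0}"

lemma graded_submodule_syzygies:
  assumes g: "\<forall>j<b'. hvec b a (a' j) (g j)"
  shows "graded_submodule b' a' (syzygies b' g)"
  unfolding graded_submodule_def
proof (intro conjI ballI allI)
  show "fm.subspace (syzygies b' g)"
    by (rule fm.subspaceI)
      (auto simp: syzygies_def vec_def lincomb_add lincomb_0 lincomb_smul, simp add: smul_def)
  fix v q assume v: "v \<in> syzygies b' g"
  thus "vec b' v" by (simp add: syzygies_def)
  show "vcomp b' a' q v \<in> syzygies b' g"
    using v vcomp_lincomb[OF g, of q v] hvec_vcomp[of b' a' q v]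
    by (simp add: syzygies_def vcomp_0 hvec_def)
qed

lemma in_span_family_iff:
  assumes "bij_betw g {..<b} G"
  shows "v \<in> fm.span G \<longleftrightarrow> (\<exists>c. v = lincomb b g c)"
proof -
  have fin: "finite G" using assms bij_betw_finite by blast
  have inj: "inj_on g {..<b}" and im: "g ` {..<b} = G" using assms by (auto simp: bij_betw_def)
  have span: "fm.span G = range (\<lambda>u. \<Sum>v\<in>G. smul (u v) v)" by (rule fm.span_finite[OF fin])
  have eq: "(\<Sum>v\<in>G. smul (u v) v) = lincomb b g (\<lambda>j. u (g j))" for u
    unfolding im[symmetric] lincomb_def sum.reindex[OF inj] by simp
  show ?thesis
  proof
    assume "v \<in> fm.span G"
    then obtain u where "v = (\<Sum>v\<in>G. smul (u v) v)" unfolding span by (rule rangeE)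
    thus "\<exists>c. v = lincomb b g c" using eq by (intro exI) (rule trans)
  next
    assume "\<exists>c. v = lincomb b g c"
    then obtain c where "v = lincomb b g c" ..
    also have "lincomb b g c = lincomb b g (\<lambda>j. c (the_inv_into {..<b} g (g j)))"
      by (rule lincomb_cong) (simp add: the_inv_into_f_f[OF inj])
    also have "\<dots> = (\<Sum>v\<in>G. smul (c (the_inv_into {..<b} g v)) v)" by (rule eq[symmetric])
    also have "\<dots> \<in> fm.span G" by (intro fm.span_sum fm.span_scale fm.span_base)
    finally show "v \<in> fm.span G" .
  qed
qed

context regular_forms
begin

text \<open>With F the free module and \<aa> the ideal \<open>lin k\<close>, the intersection of N
  with \<aa>F is \<aa>N in degrees from \<open>m\<close> on. Equivalently, Tor_1(F/N, R/\<aa>)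
  vanishes in those degrees.\<close>

definition cap_prop :: "nat \<Rightarrow> (nat \<Rightarrow> nat) \<Rightarrow> (nat \<Rightarrow> ('x, 'k) mpoly) set \<Rightarrow> nat \<Rightarrow> bool" where
  "cap_prop b a N m \<longleftrightarrow> (\<forall>k\<le>n. \<forall>q\<ge>m. \<forall>v\<in>N. hvec b a q v \<longrightarrow> (\<forall>i. v i \<in> lin k) \<longrightarrow>
     (\<exists>z. (\<forall>i. z i \<in> N) \<and> v = (\<Sum>i<k. smul (l i) (z i))))"

lemma cap_propD:
  assumes "cap_prop b a N m" "k \<le> n" "m \<le> q" "v \<in> N" "hvec b a q v" "\<And>i. v i \<in> lin k"
  shows "\<exists>z. (\<forall>i. z i \<in> N) \<and> v = (\<Sum>i<k. smul (l i) (z i))"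
  using assms unfolding cap_prop_def by blast

text \<open>
  The condition \<open>cap_prop\<close> is an elementary form of the vanishing of Koszul homology. It is inherited
  by syzygy modules with \<open>m\<close> increased by one, which bounds the degrees of all syzygies.
\<close>

definition stage :: "nat \<Rightarrow> (nat \<Rightarrow> nat) \<Rightarrow> (nat \<Rightarrow> ('x, 'k) mpoly) set \<Rightarrow> nat \<Rightarrow> bool" where
  "stage b a N m \<longleftrightarrow> graded_submodule b a N \<and> cap_prop b a N m \<and> 0 < m \<and>
     (\<forall>v\<in>N. \<forall>i. v i \<in> irrelevant_ideal)"

definition generators :: "nat \<Rightarrow> (nat \<Rightarrow> nat) \<Rightarrow> (nat \<Rightarrow> ('x, 'k) mpoly) set \<Rightarrow> nat \<Rightarrow>
    (nat \<Rightarrow> ('x, 'k) mpoly) set \<Rightarrow> bool" where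
  "generators b a N m G \<longleftrightarrow> finite G \<and> (\<forall>g\<in>G. \<exists>q<m. hvec b a q g) \<and> fm.span G = N"

text \<open>All entries of \<open>N\<close> lie in the irrelevant ideal, which is contained in
  \<open>lin n\<close>. So the case \<open>k = n\<close> of \<open>cap_prop\<close> expresses
  elements of degree at least \<open>m\<close> through elements of \<open>N\<close> of one degree
  less, and bases of the pieces below \<open>m\<close> generate.\<close>

lemma generators_exist:
  assumes st: "stage b a N m"
  shows "\<exists>G. generators b a N m G"
proof -
  have N: "fm.subspace N" "\<And>v. v \<in> N \<Longrightarrow> vec b v" "\<And>v q. v \<in> N \<Longrightarrow> vcomp b a q v \<in> N"
    and cap: "cap_prop b a N m" and m: "0 < m" and irr: "\<And>v i. v \<in> N \<Longrightarrow> v i \<in> irrelevant_ideal"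
    using st by (auto simp: stage_def graded_submodule_def)
  have "\<exists>B. finite B \<and> B \<subseteq> N \<inter> {v. hvec b a q v} \<and> N \<inter> {v. hvec b a q v} \<subseteq> fvs.span B" for q
  proof -
    obtain E where E: "finite E" "{v. hvec b a q v} \<subseteq> fvs.span (E :: (nat \<Rightarrow> ('x, 'k) mpoly) set)"
      using finite_dim_hvec by blast
    obtain B where B: "B \<subseteq> N \<inter> {v. hvec b a q v}" "fvs.independent B" "N \<inter> {v. hvec b a q v} \<subseteq> fvs.span B"
      by (rule fvs.maximal_independent_subset[of "N \<inter> {v. hvec b a q v}"])
    have "B \<subseteq> fvs.span E" using B(1) E(2) by auto
    hence "finite B" using fvs.independent_span_bound[OF E(1) B(2)] by simp
    thus ?thesis using B by blast
  qed
  then obtain B where B: "\<And>q. finite (B q)" "\<And>q. B q \<subseteq> N \<inter> {v. hvec b a q v}"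
    "\<And>q. N \<inter> {v. hvec b a q v} \<subseteq> fvs.span (B q)" by metis
  let ?G = "\<Union>q<m. B q"
  have sG: "fvs.subspace (fm.span ?G)" by (rule fm_fvs_subspace) (rule fm.subspace_span)
  have hom: "v \<in> fm.span ?G" if "v \<in> N" "hvec b a q v" for q v
    using that
  proof (induction q arbitrary: v rule: less_induct)
    case (less q)
    show ?case
    proof (cases "q < m")
      case True
      have "B q \<subseteq> fm.span ?G" using True fm.span_superset[of ?G] by blast
      hence "fvs.span (B q) \<subseteq> fm.span ?G" by (rule fvs.span_minimal[OF _ sG])
      moreover have "v \<in> fvs.span (B q)" by (rule subsetD[OF B(3)]) (use less.prems in simp)
      ultimately show ?thesis by (rule subsetD)
    next
      case False
      then obtain p where p: "q = Suc p" using m by (cases q) auto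
      have "\<forall>i. v i \<in> lin n" using irr[OF less.prems(1)] full by blast
      then obtain z where z: "\<forall>i. z i \<in> N" "v = (\<Sum>i<n. smul (l i) (z i))"
        using cap False less.prems unfolding cap_prop_def by (meson le_refl not_less)
      have "v = vcomp b a q v" using vcomp_hvec[OF less.prems(2), of q] by simp
      also have "\<dots> = (\<Sum>i<n. smul (l i) (vcomp b a p (z i)))"
        unfolding z(2) vcomp_sum
        by (intro sum.cong refl) (use vcomp_smul_form[OF linear, of _ b a p] p in simp)
      also have "\<dots> \<in> fm.span ?G"
      proof (intro fm.span_sum fm.span_scale)
        fix i
        show "vcomp b a p (z i) \<in> fm.span ?G"
          by (rule less.IH[OF _ N(3) hvec_vcomp]) (use p z(1) in simp_all)
      qed
      finally show ?thesis .
    qed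
  qed
  have "v \<in> fm.span ?G" if v: "v \<in> N" for v
  proof -
    obtain M where M: "v = (\<Sum>q<M. vcomp b a q v)" using sum_vcomp[OF N(2)[OF v]] by blast
    have "(\<Sum>q<M. vcomp b a q v) \<in> fm.span ?G"
      by (intro fm.span_sum hom[OF N(3)[OF v] hvec_vcomp])
    thus ?thesis using M by simp
  qed
  moreover have "?G \<subseteq> N" using B(2) by blast
  hence "fm.span ?G \<subseteq> N" by (rule fm.span_minimal[OF _ N(1)])
  ultimately have "fm.span ?G = N" by blast
  moreover have "\<forall>g\<in>?G. \<exists>q<m. hvec b a q g" using B(2) by blast
  moreover have "finite ?G" using B(1) by simp
  ultimately show ?thesis unfolding generators_def by blast
qed

text \<open>A syzygy with a nonzero constant term at place \<open>i\<close> expresses the generator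
  \<open>g i\<close> through the others, against the minimal number of generators.\<close>

lemma minimal_generators_syzygies:
  assumes G: "generators b a N m G" and min: "\<forall>G'. generators b a N m G' \<longrightarrow> card G \<le> card G'"
    and g: "bij_betw g {..<b'} G" and hg: "\<forall>j<b'. hvec b a (a' j) (g j)"
    and c: "c \<in> syzygies b' g"
  shows "c i \<in> irrelevant_ideal"
proof (cases "i < b'")
  case i: True
  show ?thesis
  proof (rule ccontr)
    assume "c i \<notin> irrelevant_ideal"
    hence nz: "lookup (c i) 0 \<noteq> 0" by (simp add: irrelevant_ideal_def)
    \<comment> \<open>In the degree of the generator \<open>g i\<close>, coordinate \<open>i\<close>
      of the component is just the constant term of \<open>c i\<close>, a unit.\<close>
    define e where "e = vcomp b' a' (a' i) c"
    have e: "lincomb b' g e = 0"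
      using vcomp_lincomb[OF hg, of "a' i" c] c by (simp add: e_def syzygies_def vcomp_0)
    have ei: "e i = single 0 (lookup (c i) 0)"
      unfolding e_def vcomp_def using i
      by (auto intro!: poly_mapping_eqI simp: lookup_hcomp lookup_single when_def mon_deg_eq_0_iff)
    define u :: "('x, 'k) mpoly" where "u = single 0 (inverse (lookup (c i) 0))"
    have ue: "u * e i = 1" unfolding u_def ei mult_single using nz by simp
    have gi: "g i \<in> G" using g i by (auto simp: bij_betw_def)
    have "smul (e i) (g i) + (\<Sum>j\<in>{..<b'} - {i}. smul (e j) (g j)) = 0"
      using e i unfolding lincomb_def by (simp add: sum.remove)
    hence "smul u (smul (e i) (g i) + (\<Sum>j\<in>{..<b'} - {i}. smul (e j) (g j))) = 0" by simp
    hence "g i + smul u (\<Sum>j\<in>{..<b'} - {i}. smul (e j) (g j)) = 0"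
      by (simp add: fm.scale_right_distrib fm.scale_scale ue)
    hence gi_eq: "g i = - smul u (\<Sum>j\<in>{..<b'} - {i}. smul (e j) (g j))" by (rule eq_neg_iff_add_eq_0[THEN iffD2])
    have "g j \<in> G - {g i}" if "j \<in> {..<b'} - {i}" for j
      using that g i by (auto simp: bij_betw_def dest: inj_onD)
    hence "g i \<in> fm.span (G - {g i})"
      by (subst gi_eq) (intro fm.span_neg fm.span_scale fm.span_sum fm.span_base)
    hence "G \<subseteq> fm.span (G - {g i})" using fm.span_superset[of "G - {g i}"] by blast
    hence "fm.span G \<subseteq> fm.span (G - {g i})" by (rule fm.span_minimal) simp
    moreover have "fm.span (G - {g i}) \<subseteq> fm.span G" by (rule fm.span_mono) blast
    ultimately have "generators b a N m (G - {g i})" using G by (auto simp: generators_def)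
    hence "card G \<le> card (G - {g i})" using min by blast
    moreover have "card (G - {g i}) < card G" using gi G by (intro card_Diff1_less) (auto simp: generators_def)
    ultimately show False by simp
  qed
next
  case False
  thus ?thesis using c by (simp add: syzygies_def vec_def irrelevant_ideal_def)
qed

text \<open>Let the syzygy \<open>u\<close> be \<open>l k * W\<close> modulo \<open>lin k\<close>.
  Applying the generators and cancelling \<open>l k\<close> by regularity puts the image of
  \<open>W\<close> into \<open>N\<close> with entries in \<open>lin k\<close>. The property of
  \<open>N\<close> writes it as a combination of \<open>l i\<close> with values in \<open>N\<close>,
  and lifting these values gives a correction \<open>s\<close> in \<open>lin k\<close> that makes
  \<open>W - s\<close> a syzygy. Subtracting \<open>l k\<close> times it leaves one form fewer. Here
  \<open>W\<close> lies one degree below \<open>u\<close>, whence the passage from \<open>m\<close>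
  to \<open>Suc m\<close>.\<close>

lemma cap_prop_syzygies:
  assumes cap: "cap_prop b a N m"
    and hg: "\<forall>j<b'. hvec b a (a' j) (g j)"
    and N: "\<And>v. v \<in> N \<longleftrightarrow> (\<exists>c. v = lincomb b' g c)"
  shows "cap_prop b' a' (syzygies b' g) (Suc m)"
proof -
  let ?K = "syzygies b' g"
  have gK: "graded_submodule b' a' ?K" by (rule graded_submodule_syzygies[OF hg])
  have sK: "fm.subspace ?K" and cK: "\<And>v q. v \<in> ?K \<Longrightarrow> vcomp b' a' q v \<in> ?K"
    using gK by (auto simp: graded_submodule_def)
  have comp_lin: "vcomp b' a' q v i \<in> lin k" if "k \<le> n" "\<forall>i. v i \<in> lin k" for q v k i
    using that homogeneous_idealD(2)[OF homogeneous_lin] idl.subspace_0[OF lin_subspace]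
    by (simp add: vcomp_def)
  have "\<exists>z. (\<forall>i. z i \<in> ?K) \<and> u = (\<Sum>i<k. smul (l i) (z i))"
    if "k \<le> n" "m \<le> p" "u \<in> ?K" "hvec b' a' (Suc p) u" "\<forall>i. u i \<in> lin k" for k p u
    using that
  proof (induction k arbitrary: u)
    case 0
    have "u i = 0" for i using "0.prems"(5) in_lin_ideal_iff[of "u i" 0 l] by simp
    hence "u = 0" by (intro ext) simp
    thus ?case by (intro exI[of _ "\<lambda>_. 0"] conjI allI fm.subspace_0[OF sK]) simp
  next
    case (Suc k)
    hence k: "k < n" "k \<le> n" by simp_all
    note lk = linear[OF k(1)]
    have "\<exists>w. u j - w * l k \<in> lin k" for j
      using Suc.prems(5) in_ideal_insert_iff[OF lin_subspace] unfolding add_forms_Suc by blast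
    then obtain w where w: "\<And>j. u j - w j * l k \<in> lin k" by metis
    define W where "W = vcomp b' a' p w"
    have hW: "hvec b' a' p W" unfolding W_def by (rule hvec_vcomp)
    have step: "(u - smul (l k) (vcomp b' a' p y)) i \<in> lin k" if "\<forall>i. (u - smul (l k) y) i \<in> lin k" for y i
    proof -
      have eq: "vcomp b' a' (Suc p) (u - smul (l k) y) = u - smul (l k) (vcomp b' a' p y)"
        using vcomp_smul_form[OF lk, of b' a' p y] vcomp_hvec[OF Suc.prems(4), of "Suc p"]
        by (simp add: vcomp_diff)
      have "vcomp b' a' (Suc p) (u - smul (l k) y) i \<in> lin k" by (rule comp_lin[OF k(2) that])
      thus ?thesis unfolding eq .
    qed
    have uW: "(u - smul (l k) W) i \<in> lin k" for i
      unfolding W_def by (rule step) (use w in \<open>simp add: smul_def mult.commute\<close>)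
    have "lincomb b' g u = 0" using Suc.prems(3) by (simp add: syzygies_def)
    hence "smul (l k) (lincomb b' g W) = - lincomb b' g (u - smul (l k) W)"
      by (simp add: lincomb_diff lincomb_smul)
    hence eqi: "smul (l k) (lincomb b' g W) i = (- lincomb b' g (u - smul (l k) W)) i" for i by (rule fun_cong)
    have eqL: "l k * lincomb b' g W i = - (\<Sum>j<b'. (u - smul (l k) W) j * g j i)" for i
      using eqi[of i] unfolding smul_apply uminus_apply lincomb_apply .
    have linL: "- (\<Sum>j<b'. (u - smul (l k) W) j * g j i) \<in> lin k" for i
    proof (intro idl.subspace_neg[OF lin_subspace] idl.subspace_sum[OF lin_subspace])
      fix j
      show "(u - smul (l k) W) j * g j i \<in> lin k"
        using idl.subspace_scale[OF lin_subspace uW[of j], of "g j i"] by (simp add: mult.commute)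
    qed
    have gW: "lincomb b' g W i \<in> lin k" for i by (rule regular[OF k(1)]) (simp only: eqL linL)
    have "lincomb b' g W \<in> N" unfolding N by (rule exI) (rule refl)
    from cap_propD[OF cap k(2) Suc.prems(2) this hvec_lincomb[OF hg hW] gW] obtain y where
      y: "\<forall>i. y i \<in> N" "lincomb b' g W = (\<Sum>i<k. smul (l i) (y i))" by (elim exE conjE)
    have "\<forall>i. \<exists>c. y i = lincomb b' g c" using y(1) unfolding N .
    then obtain c where c: "\<And>i. y i = lincomb b' g (c i)" by metis
    define c' where "c' i = (\<lambda>j. if j < b' then c i j else 0)" for i
    have c': "y i = lincomb b' g (c' i)" for i unfolding c by (rule lincomb_cong) (simp add: c'_def)
    define s where "s = (\<Sum>i<k. smul (l i) (c' i))"
    have s_lin: "s j \<in> lin k" for j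
    proof -
      have "s j = (\<Sum>i<k. c' i j * l i)" by (simp add: s_def sum_fun_apply smul_def mult.commute)
      thus ?thesis unfolding in_lin_ideal_iff by (intro exI[of _ "\<lambda>i. c' i j"])
    qed
    define z where "z = W - s"
    have "lincomb b' g s = (\<Sum>i<k. smul (l i) (y i))"
      by (simp add: s_def lincomb_sum lincomb_smul c')
    hence "lincomb b' g z = 0" using y(2) by (simp add: z_def lincomb_diff)
    moreover have "vec b' z"
      using hW by (simp add: z_def vec_def hvec_def s_def sum_fun_apply smul_def c'_def)
    ultimately have zK: "z \<in> ?K" by (simp add: syzygies_def)
    define Z where "Z = vcomp b' a' p z"
    have ZK: "Z \<in> ?K" unfolding Z_def by (rule cK[OF zK])
    have uz: "(u - smul (l k) z) i \<in> lin k" for i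
    proof -
      have "(u - smul (l k) W) i + l k * s i \<in> lin k"
        by (rule idl.subspace_add[OF lin_subspace uW idl.subspace_scale[OF lin_subspace s_lin]])
      thus ?thesis by (simp add: z_def smul_def algebra_simps)
    qed
    have uZ: "(u - smul (l k) Z) i \<in> lin k" for i
      unfolding Z_def by (rule step) (rule allI, rule uz)
    have uZK: "u - smul (l k) Z \<in> ?K"
      by (rule fm.subspace_diff[OF sK Suc.prems(3) fm.subspace_scale[OF sK ZK]])
    have "vcomp b' a' (Suc p) (u - smul (l k) Z) = u - smul (l k) Z"
    proof -
      have "vcomp b' a' p Z = Z" unfolding Z_def using vcomp_hvec[OF hvec_vcomp, of b' a' p p z] by simp
      thus ?thesis
        using vcomp_smul_form[OF lk, of b' a' p Z] vcomp_hvec[OF Suc.prems(4), of "Suc p"]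
        by (simp add: vcomp_diff)
    qed
    hence hZ: "hvec b' a' (Suc p) (u - smul (l k) Z)"
      using hvec_vcomp[of b' a' "Suc p" "u - smul (l k) Z"] by (simp only:)
    have "\<exists>x. (\<forall>i. x i \<in> ?K) \<and> u - smul (l k) Z = (\<Sum>i<k. smul (l i) (x i))"
      by (rule Suc.IH[OF k(2) Suc.prems(2) uZK hZ]) (rule allI, rule uZ)
    then obtain x where x: "\<forall>i. x i \<in> ?K" "u - smul (l k) Z = (\<Sum>i<k. smul (l i) (x i))"
      by (elim exE conjE)
    have "(\<Sum>i<Suc k. smul (l i) ((x(k := Z)) i)) = (\<Sum>i<k. smul (l i) (x i)) + smul (l k) Z" by simp
    also have "\<dots> = u" unfolding x(2)[symmetric] by (rule diff_add_cancel)
    finally have "u = (\<Sum>i<Suc k. smul (l i) ((x(k := Z)) i))" by (rule sym)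
    moreover have "\<forall>i. (x(k := Z)) i \<in> ?K" using x(1) ZK by simp
    ultimately show ?case by (intro exI[of _ "x(k := Z)"] conjI)
  qed
  note main = this
  show ?thesis
    unfolding cap_prop_def
  proof (intro allI impI ballI)
    fix k q v
    assume *: "k \<le> n" "Suc m \<le> q" "v \<in> ?K" "hvec b' a' q v" "\<forall>i. v i \<in> lin k"
    obtain p where p: "q = Suc p" using *(2) by (cases q) auto
    show "\<exists>z. (\<forall>i. z i \<in> ?K) \<and> v = (\<Sum>i<k. smul (l i) (z i))"
      by (rule main[of k p]) (use * p in simp_all)
  qed
qed

text \<open>One step of the resolution. A generating set of least cardinality makes the syzygies
  have entries in the irrelevant ideal; this is minimality, and also the condition in
  \<open>stage\<close> that lets the construction continue.\<close>

lemma stage_step: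
  assumes st: "stage b a N m"
  shows "\<exists>b' a' g. (\<forall>j<b'. hvec b a (a' j) (g j) \<and> a' j < m) \<and>
    (\<forall>v. v \<in> N \<longleftrightarrow> (\<exists>c. v = lincomb b' g c)) \<and> stage b' a' (syzygies b' g) (Suc m)"
proof -
  obtain G0 where G0: "generators b a N m G0" using generators_exist[OF st] ..
  from ex_has_least_nat[where P = "generators b a N m" and m = card, OF G0]
  obtain G where G: "generators b a N m G" and min: "\<forall>G'. generators b a N m G' \<longrightarrow> card G \<le> card G'"
    by (elim exE conjE)
  have "finite G" using G by (simp add: generators_def)
  then obtain g where g: "bij_betw g {..<card G} G"
    using ex_bij_betw_nat_finite[of G] by (auto simp: atLeast0LessThan)
  have "\<forall>j. \<exists>q. j < card G \<longrightarrow> q < m \<and> hvec b a q (g j)"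
    using G g by (auto simp: generators_def bij_betw_def)
  then obtain a' where a': "\<And>j. j < card G \<Longrightarrow> a' j < m \<and> hvec b a (a' j) (g j)" by metis
  hence hg: "\<forall>j<card G. hvec b a (a' j) (g j)" by blast
  have N: "v \<in> N \<longleftrightarrow> (\<exists>c. v = lincomb (card G) g c)" for v
    using in_span_family_iff[OF g, of v] G by (simp add: generators_def)
  have "stage (card G) a' (syzygies (card G) g) (Suc m)"
    unfolding stage_def
    using graded_submodule_syzygies[OF hg] cap_prop_syzygies[OF _ hg N] st
      minimal_generators_syzygies[OF G min g hg]
    by (auto simp: stage_def)
  thus ?thesis using a' N by blast
qed

end

section \<open>Regularity, saturation and degree of the truncated ideal\<close>

text \<open>The coefficient functions in \<open>minimal_free_resolution\<close> are unconstrained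
  outside the relevant indices, whereas \<open>syzygies\<close> contains only vectors that vanish
  there. Cutting off to \<open>c'\<close> reconciles the two.\<close>

lemma syzygies_exact_iff:
  fixes g g' :: "nat \<Rightarrow> nat \<Rightarrow> 'a::comm_ring_1"
  assumes g: "\<forall>j<b. vec b0 (g j)" and g': "\<forall>j<b'. vec b (g' j)"
    and ex: "\<And>v. v \<in> syzygies b g \<longleftrightarrow> (\<exists>c. v = lincomb b' g' c)"
  shows "(\<forall>i<b0. (\<Sum>j<b. g j i * c j) = 0) \<longleftrightarrow> (\<exists>e. \<forall>i<b. c i = (\<Sum>j<b'. g' j i * e j))"
proof -
  define c' where "c' j = (if j < b then c j else 0)" for j
  have lc: "lincomb b g c' i = (\<Sum>j<b. g j i * c j)" for i
    unfolding lincomb_apply by (intro sum.cong refl) (simp add: c'_def mult.commute)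
  have out: "(\<Sum>j<b. g j i * c j) = 0" if "\<not> i < b0" for i
    using g that by (intro sum.neutral) (auto simp: vec_def)
  have out': "(\<Sum>j<b'. g' j i * e j) = 0" if "\<not> i < b" for i e
    using g' that by (intro sum.neutral) (auto simp: vec_def)
  have "(\<forall>i<b0. (\<Sum>j<b. g j i * c j) = 0) \<longleftrightarrow> (\<forall>i. lincomb b g c' i = 0)"
    unfolding lc using out by blast
  also have "\<dots> \<longleftrightarrow> c' \<in> syzygies b g"
    by (auto simp: syzygies_def vec_def c'_def fun_eq_iff)
  also have "\<dots> \<longleftrightarrow> (\<exists>e. c' = lincomb b' g' e)" by (rule ex)
  also have "\<dots> \<longleftrightarrow> (\<exists>e. \<forall>i<b. c i = (\<Sum>j<b'. g' j i * e j))"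
  proof (intro ex_cong1)
    fix e
    have "lincomb b' g' e i = (\<Sum>j<b'. g' j i * e j)" for i
      unfolding lincomb_apply by (simp add: mult.commute)
    thus "c' = lincomb b' g' e \<longleftrightarrow> (\<forall>i<b. c i = (\<Sum>j<b'. g' j i * e j))"
      using out'[of _ e] by (auto simp: fun_eq_iff c'_def)
  qed
  finally show ?thesis .
qed

lemma homogeneous_ideal_subset_irrelevant:
  fixes J :: "('x, 'k::field) mpoly set"
  assumes J: "homogeneous_ideal J" "J \<noteq> UNIV"
  shows "J \<subseteq> irrelevant_ideal"
proof
  fix f assume f: "f \<in> J"
  note sJ = homogeneous_idealD(1)[OF J(1)]
  show "f \<in> irrelevant_ideal"
  proof (rule ccontr)
    assume "f \<notin> irrelevant_ideal"
    hence nz: "lookup f 0 \<noteq> 0" by (simp add: irrelevant_ideal_def)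
    have "hcomp 0 f = single 0 (lookup f 0)"
      by (rule poly_mapping_eqI) (auto simp: lookup_hcomp lookup_single when_def mon_deg_eq_0_iff)
    hence "single 0 (lookup f 0) \<in> J" using homogeneous_idealD(2)[OF J(1) f, of 0] by simp
    hence "single 0 (inverse (lookup f 0)) * single 0 (lookup f 0) \<in> J" by (rule idl.subspace_scale[OF sJ])
    hence "1 \<in> J" using nz by (simp add: mult_single)
    thus False using ideal_eq_UNIV[OF sJ] J(2) by simp
  qed
qed

context regular_forms
begin

text \<open>The ideal is viewed inside the free module with one generator, in degree 0. Since
  \<open>cap_cond J q\<close> speaks about elements of degree \<open>Suc q\<close>, the bound
  becomes \<open>Suc d\<close>.\<close>

lemma ideal_stage:
  assumes J: "homogeneous_ideal J" "J \<noteq> UNIV" and cap: "\<forall>q\<ge>d. cap_cond J q"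
  shows "stage 1 (\<lambda>_. 0) {v. vec 1 v \<and> v 0 \<in> J} (Suc d)"
proof -
  let ?N = "{v. vec 1 v \<and> v 0 \<in> J}"
  note sJ = homogeneous_idealD(1)[OF J(1)]
  have "graded_submodule 1 (\<lambda>_. 0) ?N"
    unfolding graded_submodule_def
  proof (intro conjI ballI allI)
    show "fm.subspace ?N"
      by (rule fm.subspaceI)
        (auto simp: vec_def smul_def idl.subspace_0[OF sJ] idl.subspace_add[OF sJ] idl.subspace_scale[OF sJ])
  qed (auto simp: vec_def vcomp_def homogeneous_idealD(2)[OF J(1)])
  moreover have "cap_prop 1 (\<lambda>_. 0) ?N (Suc d)"
    unfolding cap_prop_def
  proof (intro allI impI ballI)
    fix k q v
    assume *: "k \<le> n" "Suc d \<le> q" "v \<in> ?N" "hvec 1 (\<lambda>_. 0) q v" "\<forall>i. v i \<in> lin k"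
    obtain p where p: "q = Suc p" "d \<le> p" using *(2) by (cases q) auto
    have "v 0 \<in> J \<inter> forms (Suc p) \<inter> lin k"
      using * p(1) by (auto simp: hvec_def forms_def)
    hence "\<exists>z. (\<forall>i. z i \<in> J \<inter> forms p) \<and> v 0 = (\<Sum>i<k. z i * l i)"
      using cap[rule_format, OF p(2)] *(1) unfolding cap_cond_def by blast
    then obtain z where z: "\<forall>i. z i \<in> J \<inter> forms p" "v 0 = (\<Sum>i<k. z i * l i)" by (elim exE conjE)
    define y where "y i j = (if j = (0::nat) then z i else 0)" for i j
    have "v j = (\<Sum>i<k. smul (l i) (y i)) j" for j
    proof (cases "j = 0")
      case True
      thus ?thesis by (simp add: sum_fun_apply smul_def y_def z(2) mult.commute)
    next
      case False
      hence "v j = 0" using *(3) by (simp add: vec_def)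
      thus ?thesis using False by (simp add: sum_fun_apply smul_def y_def)
    qed
    hence "v = (\<Sum>i<k. smul (l i) (y i))" by (rule ext)
    moreover have "\<forall>i. y i \<in> ?N" using z(1) by (auto simp: y_def vec_def)
    ultimately show "\<exists>z. (\<forall>i. z i \<in> ?N) \<and> v = (\<Sum>i<k. smul (l i) (z i))" by blast
  qed
  moreover have "v i \<in> irrelevant_ideal" if "v \<in> ?N" for v i
  proof (cases "i = 0")
    case True
    thus ?thesis using that homogeneous_ideal_subset_irrelevant[OF J] by blast
  next
    case False
    thus ?thesis using that by (simp add: vec_def irrelevant_ideal_def)
  qed
  ultimately show ?thesis unfolding stage_def by blast
qed

text \<open>Dependent choice strings the steps together. \<open>P\<close> carries the degree bounds,
  and for \<open>p = 0\<close> also the link to the ideal; \<open>Q\<close> carries exactness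
  between consecutive maps. Generators at step \<open>p\<close> have degree below
  \<open>Suc d + p\<close>, hence at most \<open>d + p\<close>.\<close>

lemma regular_ideal_of_cap:
  assumes J: "homogeneous_ideal J" "J \<noteq> UNIV" and cap: "\<forall>q\<ge>d. cap_cond J q"
  shows "regular_ideal d J"
proof -
  let ?N = "{v :: nat \<Rightarrow> ('x, 'k) mpoly. vec 1 v \<and> v 0 \<in> J}"
  define P where "P p x = (case x of (b, a, g) \<Rightarrow> stage b a (syzygies b g) (Suc (Suc d) + p) \<and>
      (\<forall>j<b. a j < Suc d + p) \<and>
      (p = 0 \<longrightarrow> (\<forall>j<b. hvec 1 (\<lambda>_. 0) (a j) (g j)) \<and> (\<forall>v. v \<in> ?N \<longleftrightarrow> (\<exists>c. v = lincomb b g c))))"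
    for p and x :: "nat \<times> (nat \<Rightarrow> nat) \<times> (nat \<Rightarrow> nat \<Rightarrow> ('x, 'k) mpoly)"
  define Q where "Q (p::nat) x y = (case x of (b, a, g) \<Rightarrow> case y of (b', a', g') \<Rightarrow>
      (\<forall>j<b'. hvec b a (a' j) (g' j)) \<and> (\<forall>v. v \<in> syzygies b g \<longleftrightarrow> (\<exists>c. v = lincomb b' g' c)))"
    for p and x y :: "nat \<times> (nat \<Rightarrow> nat) \<times> (nat \<Rightarrow> nat \<Rightarrow> ('x, 'k) mpoly)"
  have base: "\<exists>x. P 0 x"
  proof -
    obtain b a g where "\<forall>j<b. hvec 1 (\<lambda>_. 0) (a j) (g j) \<and> a j < Suc d"
      "\<forall>v. v \<in> ?N \<longleftrightarrow> (\<exists>c. v = lincomb b g c)" "stage b a (syzygies b g) (Suc (Suc d))"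
      using stage_step[OF ideal_stage[OF J cap]] by (elim exE conjE)
    hence "P 0 (b, a, g)" unfolding P_def by simp
    thus ?thesis ..
  qed
  have step: "\<exists>y. P (Suc p) y \<and> Q p x y" if "P p x" for p x
  proof -
    obtain b a g where x: "x = (b, a, g)" by (cases x)
    have "stage b a (syzygies b g) (Suc (Suc d) + p)" using that unfolding P_def x by simp
    from stage_step[OF this] obtain b' a' g' where
      "\<forall>j<b'. hvec b a (a' j) (g' j) \<and> a' j < Suc (Suc d) + p"
      "\<forall>v. v \<in> syzygies b g \<longleftrightarrow> (\<exists>c. v = lincomb b' g' c)"
      "stage b' a' (syzygies b' g') (Suc (Suc (Suc d) + p))" by (elim exE conjE)
    hence "P (Suc p) (b', a', g') \<and> Q p x (b', a', g')" unfolding P_def Q_def x by simp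
    thus ?thesis by blast
  qed
  from dependent_nat_choice[of P Q, OF base step] obtain F where
    F: "\<And>p. P p (F p)" "\<And>p. Q p (F p) (F (Suc p))" by blast
  define b where "b p = fst (F p)" for p
  define a where "a p = fst (snd (F p))" for p
  define G where "G p = snd (snd (F p))" for p
  have Fp: "F p = (b p, a p, G p)" for p by (simp add: b_def a_def G_def)
  have st: "stage (b p) (a p) (syzygies (b p) (G p)) (Suc (Suc d) + p)" for p
    using F(1)[of p] unfolding Fp P_def by simp
  have deg: "a p j < Suc d + p" if "j < b p" for p j
    using F(1)[of p] that unfolding Fp P_def by simp
  have h0: "hvec 1 (\<lambda>_. 0) (a 0 j) (G 0 j)" if "j < b 0" for j
    using F(1)[of 0] that unfolding Fp P_def by simp
  have N0: "v \<in> ?N \<longleftrightarrow> (\<exists>c. v = lincomb (b 0) (G 0) c)" for v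
    using F(1)[of 0] unfolding Fp P_def by simp
  have hS: "hvec (b p) (a p) (a (Suc p) j) (G (Suc p) j)" if "j < b (Suc p)" for p j
    using F(2)[of p] that unfolding Fp Q_def by simp
  have ex: "v \<in> syzygies (b p) (G p) \<longleftrightarrow> (\<exists>c. v = lincomb (b (Suc p)) (G (Suc p)) c)" for p v
    using F(2)[of p] unfolding Fp Q_def by simp
  have vS: "\<forall>j<b (Suc p). vec (b p) (G (Suc p) j)" for p
    using hS by (simp add: hvec_def)
  have v0: "\<forall>j<b 0. vec 1 (G 0 j)"
    using h0 by (simp add: hvec_def)
  have "minimal_free_resolution J b a (\<lambda>j. G 0 j 0) (\<lambda>p i j. G (Suc p) j i)"
    unfolding minimal_free_resolution_def
  proof (intro conjI allI impI ballI)
    fix j assume "j < b 0"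
    thus "G 0 j 0 \<in> forms (a 0 j)" using h0[of j] by (simp add: hvec_def forms_def)
  next
    fix p i j m assume "i < b p" "j < b (Suc p)" "m \<in> keys (G (Suc p) j i)"
    thus "a p i + mon_deg m = a (Suc p) j" using hS[of j p] by (simp add: hvec_def)
  next
    show "J = {\<Sum>j<b 0. c j * G 0 j 0 |c. True}"
    proof (intro equalityI subsetI)
      fix f assume "f \<in> J"
      hence "(\<lambda>i. if i = 0 then f else 0) \<in> ?N" by (simp add: vec_def)
      then obtain c where c: "(\<lambda>i. if i = 0 then f else 0) = lincomb (b 0) (G 0) c"
        unfolding N0 by (rule exE)
      have "f = lincomb (b 0) (G 0) c 0" using fun_cong[OF c, of 0] by simp
      thus "f \<in> {\<Sum>j<b 0. c j * G 0 j 0 |c. True}" unfolding lincomb_apply by blast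
    next
      fix f assume "f \<in> {\<Sum>j<b 0. c j * G 0 j 0 |c. True}"
      then obtain c where f: "f = lincomb (b 0) (G 0) c 0" unfolding lincomb_apply by blast
      have "lincomb (b 0) (G 0) c \<in> ?N" unfolding N0 by (rule exI) (rule refl)
      thus "f \<in> J" unfolding f by simp
    qed
  next
    fix c
    show "((\<Sum>j<b 0. c j * G 0 j 0) = 0) = (\<exists>e. \<forall>i<b 0. c i = (\<Sum>j<b 1. G (Suc 0) j i * e j))"
      using syzygies_exact_iff[OF v0 vS[where p = 0] ex[where p = 0], of c]
      by (simp add: mult.commute)
  next
    fix p c
    show "(\<forall>i<b p. (\<Sum>j<b (Suc p). G (Suc p) j i * c j) = 0) =
      (\<exists>e. \<forall>j<b (Suc p). c j = (\<Sum>k<b (Suc (Suc p)). G (Suc (Suc p)) k j * e k))"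
      by (rule syzygies_exact_iff[OF vS vS ex])
  next
    fix p i j assume j: "j < b (Suc p)"
    \<comment> \<open>As the image of a unit vector, a column of the next matrix is itself a syzygy,
      so the condition in \<open>stage\<close> applies to its entries.\<close>
    have "G (Suc p) j = lincomb (b (Suc p)) (G (Suc p)) (\<lambda>i. if i = j then 1 else 0)"
    proof
      fix i
      have "lincomb (b (Suc p)) (G (Suc p)) (\<lambda>i. if i = j then 1 else 0) i
          = (\<Sum>k<b (Suc p). if k = j then G (Suc p) k i else 0)"
        unfolding lincomb_apply by (intro sum.cong refl) auto
      also have "\<dots> = G (Suc p) j i" using j by (simp add: sum.delta)
      finally show "G (Suc p) j i = lincomb (b (Suc p)) (G (Suc p)) (\<lambda>i. if i = j then 1 else 0) i" ..
    qed
    hence "G (Suc p) j \<in> syzygies (b p) (G p)" unfolding ex by (rule exI[where x = "\<lambda>i. if i = j then 1 else 0"])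
    thus "G (Suc p) j i \<in> irrelevant_ideal" using st[of p] unfolding stage_def by blast
  qed
  moreover have "\<forall>p. \<forall>j<b p. a p j \<le> d + p" using deg by (simp add: less_Suc_eq_le)
  ultimately show ?thesis unfolding regular_ideal_def by blast
qed

end

lemma homogeneous_truncated_ideal:
  fixes I :: "('x, 'k::comm_ring_1) mpoly set"
  assumes I: "homogeneous_ideal I"
  shows "homogeneous_ideal (truncated_ideal I d)" "truncated_ideal I d \<subseteq> I"
    "t \<le> d \<Longrightarrow> forms t \<inter> truncated_ideal I d = forms t \<inter> I"
proof -
  note sI = homogeneous_idealD(1)[OF I]
  let ?S = "{f \<in> I. \<forall>m\<in>keys f. mon_deg m \<le> d}"
  show sub: "truncated_ideal I d \<subseteq> I"
    unfolding truncated_ideal_def by (rule idl.span_minimal[OF _ sI]) blast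
  show "forms t \<inter> truncated_ideal I d = forms t \<inter> I" if "t \<le> d" for t
  proof
    show "forms t \<inter> truncated_ideal I d \<subseteq> forms t \<inter> I" using sub by blast
    show "forms t \<inter> I \<subseteq> forms t \<inter> truncated_ideal I d"
    proof
      fix f assume f: "f \<in> forms t \<inter> I"
      hence "f \<in> ?S" using that by (auto simp: forms_def)
      hence "f \<in> truncated_ideal I d" unfolding truncated_ideal_def by (rule idl.span_base)
      thus "f \<in> forms t \<inter> truncated_ideal I d" using f by blast
    qed
  qed
  \<comment> \<open>Components of elements of \<open>?S\<close> again lie in \<open>I\<close>, so
    the truncated ideal has homogeneous generators.\<close>
  let ?T = "{f \<in> I. \<exists>t\<le>d. f \<in> forms t}"
  have "truncated_ideal I d = idl.span ?T"
  proof
    show "truncated_ideal I d \<subseteq> idl.span ?T"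
      unfolding truncated_ideal_def
    proof (rule idl.span_minimal)
      show "?S \<subseteq> idl.span ?T"
      proof
        fix f assume f: "f \<in> ?S"
        have "f = (\<Sum>t\<le>d. hcomp t f)" by (rule sum_hcomp) (use f in auto)
        moreover have "(\<Sum>t\<le>d. hcomp t f) \<in> idl.span ?T"
          by (intro idl.span_sum idl.span_base) (use f homogeneous_idealD(2)[OF I] hcomp_in_forms in blast)
        ultimately show "f \<in> idl.span ?T" by simp
      qed
    qed simp
    show "idl.span ?T \<subseteq> truncated_ideal I d"
      unfolding truncated_ideal_def by (rule idl.span_mono) (auto simp: forms_def)
  qed
  moreover have "homogeneous_ideal (idl.span ?T)" by (rule homogeneous_ideal_span) blast
  ultimately show "homogeneous_ideal (truncated_ideal I d)" by simp
qed

lemma hcomp_high: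
  assumes "\<forall>m\<in>keys f. mon_deg m \<le> d" "d < t"
  shows "hcomp t f = 0"
  using assms by (intro hcomp_eq_0) auto

context regular_forms
begin

text \<open>A generator has no component of degree \<open>Suc q\<close>, as \<open>q\<close> is at
  least \<open>d\<close>. In that degree it is therefore always multiplied by something of positive
  degree, from which one linear form can be split off.\<close>

lemma truncated_ideal_generation:
  assumes I: "homogeneous_ideal I" and q: "d \<le> q"
    and f: "f \<in> truncated_ideal I d \<inter> forms (Suc q)"
  shows "\<exists>g. (\<forall>i. g i \<in> truncated_ideal I d \<inter> forms q) \<and> f = (\<Sum>i<n. g i * l i)"
proof -
  let ?J = "truncated_ideal I d"
  note hJ = homogeneous_truncated_ideal(1)[OF I, of d]
  note sJ = homogeneous_idealD(1)[OF hJ]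
  define D where "D = {f. \<exists>g. (\<forall>i. g i \<in> ?J \<inter> forms q) \<and> f = (\<Sum>i<n. g i * l i)}"
  have D0: "0 \<in> D" unfolding D_def
    by (rule CollectI, rule exI[of _ "\<lambda>_. 0"]) (simp add: idl.subspace_0[OF sJ])
  have Dadd: "f + h \<in> D" if fD: "f \<in> D" and hD: "h \<in> D" for f h
  proof -
    obtain g where g: "\<forall>i. g i \<in> ?J \<inter> forms q" "f = (\<Sum>i<n. g i * l i)"
      using fD unfolding D_def by blast
    obtain g' where g': "\<forall>i. g' i \<in> ?J \<inter> forms q" "h = (\<Sum>i<n. g' i * l i)"
      using hD unfolding D_def by blast
    have "\<forall>i. g i + g' i \<in> ?J \<inter> forms q" using g(1) g'(1) by (simp add: idl.subspace_add[OF sJ] forms_add)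
    moreover have "f + h = (\<Sum>i<n. (g i + g' i) * l i)" by (simp add: g(2) g'(2) distrib_right sum.distrib)
    ultimately show ?thesis unfolding D_def by (intro CollectI exI[of _ "\<lambda>i. g i + g' i"] conjI)
  qed
  have Dsum: "sum h A \<in> D" if "\<And>i. i \<in> A \<Longrightarrow> h i \<in> D" for h and A :: "nat set"
    using that by (induction A rule: infinite_finite_induct) (auto intro: D0 Dadd)
  have Dprod: "a * s \<in> D" if a: "a \<in> forms (Suc i)" and s: "s \<in> ?J" "s \<in> forms j" and ij: "i + j = q" for a s i j
  proof -
    have "a \<in> add_forms {0} n l" using a forms_subset_irrelevant[of "Suc i"] full by auto
    from add_forms_homogeneous_repr[OF homogeneous_zero_ideal linear_1 this a]
    obtain r where r: "\<forall>i'. r i' \<in> forms i" "a = (\<Sum>i'<n. r i' * l i')" by auto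
    have "\<forall>i'. r i' * s \<in> ?J \<inter> forms q"
      using r(1) forms_mult[OF _ s(2), of _ i] ij idl.subspace_scale[OF sJ s(1)] by auto
    moreover have "a * s = (\<Sum>i'<n. (r i' * s) * l i')"
      unfolding r(2) sum_distrib_right by (intro sum.cong refl) (simp add: mult.assoc mult.commute[of s])
    ultimately show ?thesis unfolding D_def by (intro CollectI exI[of _ "\<lambda>i. r i * s"] conjI)
  qed
  have "f \<in> ?J" using f by simp
  hence "hcomp (Suc q) f \<in> D"
    unfolding truncated_ideal_def
  proof (induction rule: idl.span_induct_alt)
    case base
    show ?case using D0 by simp
  next
    case (step r s y)
    have sd: "\<forall>m\<in>keys s. mon_deg m \<le> d" and sJ': "s \<in> ?J"
      using step(1) idl.span_base[OF step(1)] unfolding truncated_ideal_def by auto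
    have "(\<Sum>i\<le>Suc q. hcomp i r * hcomp (Suc q - i) s) \<in> D"
    proof (rule Dsum)
      fix i assume i: "i \<in> {..Suc q}"
      show "hcomp i r * hcomp (Suc q - i) s \<in> D"
      proof (cases i)
        case 0
        hence "hcomp (Suc q - i) s = 0" using q by (intro hcomp_high[OF sd]) simp
        thus ?thesis using D0 by simp
      next
        case (Suc j)
        have "j + (Suc q - i) = q" using Suc i by simp
        thus ?thesis
          using Dprod[OF _ homogeneous_idealD(2)[OF hJ sJ'] hcomp_in_forms, of "hcomp i r" j] Suc by simp
      qed
    qed
    thus ?case using Dadd step(2) by (simp add: hcomp_add hcomp_mult)
  qed
  thus ?thesis using f by (simp add: hcomp_same D_def)
qed

text \<open>Up to degree \<open>d\<close> saturation is inherited from \<open>I\<close>. Above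
  \<open>d\<close>, a form multiplied into \<open>J\<close> by all monomials of degree
  \<open>k\<close> is multiplied into \<open>J\<close> by \<open>l 0 ^ k\<close>, and the colon
  condition for index 0 cancels the factors \<open>l 0\<close> one by one.\<close>

lemma saturated_of_colon_cond:
  assumes J: "homogeneous_ideal J" "J \<subseteq> I" and I: "saturated I"
    and low: "\<And>t. t \<le> d \<Longrightarrow> forms t \<inter> J = forms t \<inter> I"
    and T: "\<And>q. d \<le> q \<Longrightarrow> colon_cond J q" and n: "0 < n"
  shows "saturated J"
  unfolding saturated_def
proof (intro allI impI, elim exE)
  fix f k assume k: "\<forall>m. mon_deg m = k \<longrightarrow> single m 1 * f \<in> J"
  note sJ = homogeneous_idealD(1)[OF J(1)]
  show "f \<in> J"
  proof (rule in_ideal_if_hcomp[OF sJ])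
    fix t
    define h where "h = hcomp t f"
    have hf: "h \<in> forms t" by (simp add: h_def)
    have kh: "single m 1 * h \<in> J" if m: "mon_deg m = k" for m
    proof -
      have "hcomp (t + k) (single m 1 * f) \<in> J" using k m by (intro homogeneous_idealD(2)[OF J(1)]) blast
      thus ?thesis using hcomp_form_mult[OF single_in_forms[OF m], of "t + k" 1 f] by (simp add: h_def)
    qed
    have "h \<in> J"
    proof (cases "t \<le> d")
      case True
      have "h \<in> I" using I kh J(2) unfolding saturated_def by blast
      thus ?thesis using low[OF True] hf by blast
    next
      case False
      have pow: "l 0 ^ j \<in> forms j" for j
      proof (induction j)
        case (Suc j)
        thus ?case using forms_mult[OF linear[OF n] Suc] by simp
      qed (simp add: one_in_forms)
      have "(\<Sum>m\<in>keys (l 0 ^ k). single m (lookup (l 0 ^ k) m)) * h \<in> J"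
        unfolding sum_distrib_right
      proof (rule idl.subspace_sum[OF sJ])
        fix m assume m: "m \<in> keys (l 0 ^ k)"
        hence "single m 1 * h \<in> J" using pow[of k] by (intro kh) (auto simp: forms_def)
        hence "single 0 (lookup (l 0 ^ k) m) * (single m 1 * h) \<in> J" by (rule idl.subspace_scale[OF sJ])
        thus "single m (lookup (l 0 ^ k) m) * h \<in> J" by (simp add: mult_single flip: mult.assoc)
      qed
      hence "l 0 ^ k * h \<in> J" using poly_mapping_sum_single[of "l 0 ^ k"] by simp
      thus "h \<in> J"
      proof (induction k)
        case (Suc j)
        have "l 0 * (l 0 ^ j * h) \<in> add_forms J 0 l" using Suc.prems add_forms_0[OF sJ] by (simp add: mult.assoc)
        moreover have "l 0 ^ j * h \<in> forms (j + t)" by (rule forms_mult[OF pow hf])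
        ultimately have "l 0 ^ j * h \<in> add_forms J 0 l"
          using T[of "j + t"] False n unfolding colon_cond_def by simp
        thus ?case using Suc.IH add_forms_0[OF sJ] by simp
      qed simp
    qed
    thus "hcomp t f \<in> J" by (simp add: h_def)
  qed
qed

lemma hilbert_fun_colon_cond:
  assumes J: "homogeneous_ideal J" and T: "colon_cond J q" and k: "k < n"
  shows "hilbert_fun (add_forms J k l) (Suc q) =
    hilbert_fun (add_forms J (Suc k) l) (Suc q) + hilbert_fun (add_forms J k l) q"
proof -
  have hk: "homogeneous_ideal (add_forms J k l)"
    by (rule homogeneous_add_forms[OF J]) (use linear k in simp)
  have "forms q \<inter> colon (add_forms J k l) (l k) = forms q \<inter> add_forms J k l"
    using T k subset_colon[OF add_forms_subspace, of J k l "l k"]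
    unfolding colon_cond_def by (auto simp: in_colon_iff)
  hence "hilbert_fun (colon (add_forms J k l) (l k)) q = hilbert_fun (add_forms J k l) q"
    by (intro hilbert_fun_cong homogeneous_idealD(1)[OF homogeneous_colon[OF hk linear[OF k]]]
        add_forms_subspace)
  thus ?thesis using hilbert_fun_exact[OF hk linear[OF k], of q] unfolding add_forms_Suc by simp
qed

end

text \<open>The hypothesis is A + u B + \<sigma> u (u + 1) / 2, the twofold sum of the constant
  \<sigma>, doubled to stay within the natural numbers. Growth of exact order \<open>t ^ 2\<close>
  gives dimension two, and the leading coefficient \<sigma> / 2 times 2! gives the degree.\<close>

lemma quadratic_hilbert_fun:
  fixes J :: "('x::finite, 'k::field) mpoly set"
  assumes J: "homogeneous_ideal J" and \<sigma>: "0 < \<sigma>"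
    and h: "\<And>u. 2 * hilbert_fun J (d + u) = 2 * A + 2 * u * B + \<sigma> * u * (u + 1)"
  shows "has_proj_dim J 2" "has_proj_degree J (int \<sigma>)"
proof -
  let ?h = "hilbert_fun J"
  have up: "?h t \<le> (A + B + \<sigma> + sum ?h {..<d}) * Suc t ^ 2" for t
  proof (cases "t < d")
    case True
    hence "?h t \<le> sum ?h {..<d}" by (intro member_le_sum) auto
    also have "\<dots> \<le> A + B + \<sigma> + sum ?h {..<d}" by simp
    also have "\<dots> \<le> (A + B + \<sigma> + sum ?h {..<d}) * Suc t ^ 2" by simp
    finally show ?thesis .
  next
    case False
    define u where "u = t - d"
    have t: "t = d + u" using False by (simp add: u_def)
    have s1: "1 \<le> Suc t ^ 2" and s2: "u \<le> Suc t ^ 2" and s3: "u * (u + 1) \<le> Suc t ^ 2"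
    proof -
      show "1 \<le> Suc t ^ 2" by simp
      have "u * (u + 1) \<le> Suc t * Suc t" by (intro mult_le_mono) (simp_all add: t)
      thus "u * (u + 1) \<le> Suc t ^ 2" by (simp add: power2_eq_square)
      thus "u \<le> Suc t ^ 2" by (rule le_trans[rotated]) simp
    qed
    have "2 * ?h t = 2 * A + 2 * u * B + \<sigma> * u * (u + 1)" unfolding t by (rule h)
    also have "\<dots> = 2 * (A * 1) + 2 * (B * u) + \<sigma> * (u * (u + 1))" by (simp add: algebra_simps)
    also have "\<dots> \<le> 2 * (A * Suc t ^ 2) + 2 * (B * Suc t ^ 2) + \<sigma> * Suc t ^ 2"
      using s1 s2 s3 by (intro add_mono mult_le_mono2)
    also have "\<dots> \<le> 2 * ((A + B + \<sigma> + sum ?h {..<d}) * Suc t ^ 2)"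
      by (simp add: add_mult_distrib add_mult_distrib2)
    finally show ?thesis by simp
  qed
  have "Suc t * ?h t \<le> (A + B + \<sigma> + sum ?h {..<d}) * Suc t ^ Suc 2" for t
    using mult_le_mono2[OF up[of t], of "Suc t"] by (simp only: power_Suc mult.left_commute)
  hence g3: "growth_le (Suc 2) J" unfolding growth_le_def by blast
  have g2: "\<not> growth_le 2 J"
  proof
    assume "growth_le 2 J"
    then obtain C where C: "\<And>t. Suc t * ?h t \<le> C * Suc t ^ 2" unfolding growth_le_def by blast
    have C': "?h t \<le> C * Suc t" for t
    proof -
      have "Suc t * ?h t \<le> Suc t * (C * Suc t)"
        using C[of t] by (simp only: power2_eq_square mult.left_commute)
      thus ?thesis by (simp only: Suc_mult_le_cancel1)
    qed
    \<comment> \<open>With linear growth, u (u + 1) would be at most 2 C (d + u + 1), hence at most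
      2 C (d + 2) (u + 1); this \<open>u\<close> is one more than the resulting bound.\<close>
    define u where "u = 2 * C * (d + 2) + 1"
    have "u * (u + 1) \<le> \<sigma> * (u * (u + 1))" using \<sigma> by simp
    also have "\<dots> \<le> 2 * ?h (d + u)" unfolding h by (simp add: algebra_simps)
    also have "\<dots> \<le> 2 * (C * Suc (d + u))" by (intro mult_le_mono2 C')
    also have "\<dots> = 2 * C * Suc (d + u)" by simp
    also have "\<dots> \<le> 2 * C * ((d + 2) * (u + 1))" by (intro mult_le_mono2) (simp add: algebra_simps)
    also have "\<dots> = (2 * C * (d + 2)) * (u + 1)" by (simp only: mult.assoc)
    also have "\<dots> < u * (u + 1)" unfolding u_def by simp
    finally show False by simp
  qed
  show dim: "has_proj_dim J 2" by (rule has_proj_dimI[OF J g3 g2])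
  \<comment> \<open>The term u (u + 1) / 2 contributes to both the linear and the quadratic
    coefficient; the composition replaces \<open>u\<close> by \<open>t - d\<close>.\<close>
  define p :: "rat poly" where "p = pcompose [:of_nat A, of_nat B + of_nat \<sigma> / 2, of_nat \<sigma> / 2:] [:- of_nat d, 1:]"
  have "of_nat (?h t) = poly p (of_nat t)" if "d \<le> t" for t
  proof -
    define u where "u = t - d"
    have t: "t = d + u" using that by (simp add: u_def)
    have "(2::rat) * of_nat (?h t) = of_nat (2 * ?h t)" by simp
    also have "\<dots> = of_nat (2 * A + 2 * u * B + \<sigma> * u * (u + 1))" unfolding t h ..
    also have "\<dots> = 2 * of_nat A + 2 * of_nat u * of_nat B + of_nat \<sigma> * of_nat u * (of_nat u + 1)"
      by (simp add: distrib_left)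
    finally show ?thesis
      by (simp add: p_def poly_pcompose t algebra_simps)
  qed
  hence ev: "\<forall>\<^sub>F t in sequentially. of_nat (?h t) = poly p (of_nat t)"
    unfolding eventually_sequentially by blast
  have "lead_coeff p = of_nat \<sigma> / 2"
    unfolding p_def using \<sigma> by (subst lead_coeff_comp) auto
  hence "of_int (int \<sigma>) = fact 2 * lead_coeff p" by (simp add: fact_2)
  thus "has_proj_degree J (int \<sigma>)" unfolding has_proj_degree_def using dim ev by blast
qed

lemma independent_of_chain:
  fixes L :: "nat \<Rightarrow> ('x, 'k::field) mpoly"
  assumes "\<And>k. k < r \<Longrightarrow> L k \<notin> vs.span (L ` {..<k})"
  shows "inj_on L {..<r} \<and> vs.independent (L ` {..<r})"
  using assms
proof (induction r)
  case (Suc r)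
  hence IH: "inj_on L {..<r}" "vs.independent (L ` {..<r})" by simp_all
  have "L r \<notin> vs.span (L ` {..<r})" using Suc.prems by simp
  moreover from this have "L r \<notin> L ` {..<r}" using vs.span_base by metis
  ultimately show ?case using IH unfolding lessThan_Suc image_insert
    by (simp add: vs.independent_insertI)
qed (simp add: vs.independent_empty)

lemma add_forms_cong: "(\<And>i. i < k \<Longrightarrow> l i = L i) \<Longrightarrow> add_forms J k l = add_forms J k L"
  unfolding add_forms_def by (metis (no_types, lifting) image_cong lessThan_iff)

theorem theorem6p7:
  fixes I_Z :: "('x::finite, 'k::field_char_0) mpoly set"
    and d :: nat and s :: int
  assumes "CARD('x) > 3"
    and "homogeneous_ideal I_Z" and "saturated I_Z" and "has_proj_dim I_Z 0"
    and "weak_lefschetz I_Z"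
    and "hilbert_diff2 I_Z d = s" and "hilbert_diff2 I_Z (d + 1) = s"
    and "red_max 2 I_Z > d" and "d > red_max 3 I_Z"
  shows "homogeneous_ideal (truncated_ideal I_Z d)
    \<and> saturated (truncated_ideal I_Z d)
    \<and> has_proj_dim (truncated_ideal I_Z d) 2
    \<and> has_proj_degree (truncated_ideal I_Z d) s
    \<and> regular_ideal d (truncated_ideal I_Z d)"
proof -
  let ?I = I_Z and ?J = "truncated_ideal I_Z d"
  note hI = assms(2)
  note sI = homogeneous_idealD(1)[OF hI]
  note hJ = homogeneous_truncated_ideal(1)[OF hI, of d]
  note sJ = homogeneous_idealD(1)[OF hJ]
  have JI: "?J \<subseteq> ?I" by (rule homogeneous_truncated_ideal(2)[OF hI])
  have nU: "?I \<noteq> UNIV" by (rule zero_dim_bounded(2)[OF hI assms(4)])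
  note art = general_section_artinian[OF hI assms(3,4)]
  obtain c0 N where N: "forms N \<subseteq> add_forms ?I 1 (forms_of c0)"
    using for_general_forms_ex[OF art] by auto
  \<comment> \<open>One artinian section by a single form is enough to give both
    \<open>red_max 2\<close> and \<open>red_max 3\<close> their generic meaning.\<close>
  have N2: "forms N \<subseteq> add_forms ?I 2 (forms_of c0)" and N3: "forms N \<subseteq> add_forms ?I 3 (forms_of c0)"
    using N add_forms_mono_index[of 1 2 ?I "forms_of c0"] add_forms_mono_index[of 1 3 ?I "forms_of c0"]
    by auto
  have "for_general_forms 3 (\<lambda>L. \<forall>f. L 0 * f \<in> ?I \<longrightarrow> f \<in> ?I)"
    by (rule for_general_forms_mono[OF art]) simp_all
  moreover have "for_general_forms 3 (\<lambda>L. \<forall>t.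
     mult_injective (add_forms ?I 1 L) (L 1) t \<or> mult_surjective (add_forms ?I 1 L) (L 1) t)"
    by (rule for_general_forms_mono[OF assms(5)[unfolded weak_lefschetz_def]]) simp_all
  moreover have "for_general_forms 3 (\<lambda>L. hilbert_fun (add_forms ?I 2 L) (red_max 2 ?I) \<noteq> 0)"
    by (rule for_general_forms_mono[OF red_max_generic[OF hI nU N2]]) simp_all
  moreover have "for_general_forms 3 (\<lambda>L. \<forall>k. hilbert_fun (add_forms ?I 3 L) k \<noteq> 0 \<longrightarrow> k \<le> red_max 3 ?I)"
    by (rule for_general_forms_mono[OF red_max_generic[OF hI nU N3]]) simp_all
  ultimately have "\<exists>c. ((\<forall>f. forms_of c 0 * f \<in> ?I \<longrightarrow> f \<in> ?I) \<and>
     (\<forall>t. mult_injective (add_forms ?I 1 (forms_of c)) (forms_of c 1) t \<or>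
       mult_surjective (add_forms ?I 1 (forms_of c)) (forms_of c 1) t)) \<and>
     hilbert_fun (add_forms ?I 2 (forms_of c)) (red_max 2 ?I) \<noteq> 0 \<and>
     (\<forall>k. hilbert_fun (add_forms ?I 3 (forms_of c)) k \<noteq> 0 \<longrightarrow> k \<le> red_max 3 ?I)"
    by (intro for_general_forms_ex for_general_forms_conj)
  then obtain c where c: "\<forall>f. forms_of c 0 * f \<in> ?I \<longrightarrow> f \<in> ?I"
     "\<forall>t. mult_injective (add_forms ?I 1 (forms_of c)) (forms_of c 1) t \<or>
       mult_surjective (add_forms ?I 1 (forms_of c)) (forms_of c 1) t"
     "hilbert_fun (add_forms ?I 2 (forms_of c)) (red_max 2 ?I) \<noteq> 0"
     "\<forall>k. hilbert_fun (add_forms ?I 3 (forms_of c)) k \<noteq> 0 \<longrightarrow> k \<le> red_max 3 ?I"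
    by (elim exE conjE)
  define L where "L = forms_of c"
  have L1: "L i \<in> forms (Suc 0)" for i by (simp add: L_def)
  let ?A = "\<lambda>k. add_forms ?I k L"
  let ?h = "\<lambda>k. hilbert_fun (?A k)"
  have hA: "homogeneous_ideal (?A k)" for k by (rule homogeneous_add_forms[OF hI]) (use L1 in simp)
  have A0: "?A 0 = ?I" by (rule add_forms_0[OF sI])
  have A_mono: "?A j \<subseteq> ?A k" if "j \<le> k" for j k by (rule add_forms_mono_index[OF that])
  have nz: "L 0 * f \<in> ?I \<Longrightarrow> f \<in> ?I" for f using c(1) by (simp add: L_def)
  \<comment> \<open>The quotient by two forms is nonzero in degree \<open>red_max 2 I_Z\<close>,
    which is at least \<open>d + 1\<close>, and hence in all lower degrees.\<close>
  have not2: "\<not> forms t \<subseteq> ?A 2" if "t \<le> d + 1" for t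
  proof
    assume "forms t \<subseteq> ?A 2"
    hence "forms (red_max 2 ?I) \<subseteq> ?A 2"
      using forms_subset_upward[OF add_forms_subspace, of t ?I 2 L "red_max 2 ?I"] that assms(8) by simp
    thus False using c(3) hilbert_fun_eq_0_iff[OF add_forms_subspace, of ?I 2 L "red_max 2 ?I"]
      by (simp add: L_def)
  qed
  have "?h 3 d = 0" using c(4) assms(9) unfolding L_def by (meson not_less)
  hence "forms d \<subseteq> ?A 3" using hilbert_fun_eq_0_iff[OF add_forms_subspace] by blast
  hence all3: "forms q \<subseteq> ?A 3" if "d \<le> q" for q
    using forms_subset_upward[OF add_forms_subspace _ that] by blast
  have inj: "f \<in> ?A 1" if t: "t \<le> d" and f: "f \<in> forms t" "L 1 * f \<in> ?A 1" for t f
  proof -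
    \<comment> \<open>Surjectivity in degree \<open>t\<close> would make the quotient by both forms
      vanish in degree \<open>t + 1\<close>, which is at most \<open>d + 1\<close>; so the Lefschetz
      alternative leaves injectivity.\<close>
    have "\<not> mult_surjective (?A 1) (L 1) t"
    proof
      assume surj: "mult_surjective (?A 1) (L 1) t"
      have "forms (Suc t) \<subseteq> ?A 2"
      proof
        fix g :: "('x, 'k) mpoly" assume "g \<in> forms (Suc t)"
        then obtain f where "g - L 1 * f \<in> ?A 1" using surj unfolding mult_surjective_def by blast
        hence "g - f * L 1 \<in> ?A 1" by (simp add: mult.commute)
        hence "g \<in> ideal_insert (?A 1) (L 1)" using in_ideal_insert_iff[OF add_forms_subspace] by blast
        thus "g \<in> ?A 2" using add_forms_Suc[of ?I 1 L] by (simp add: numeral_2_eq_2)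
      qed
      thus False using not2[of "Suc t"] t by simp
    qed
    hence "mult_injective (?A 1) (L 1) t" using c(2) unfolding L_def by blast
    thus ?thesis using f unfolding mult_injective_def by blast
  qed
  have A2: "?A 2 = ideal_insert (?A 1) (L 1)" using add_forms_Suc[of ?I 1 L] by (simp add: numeral_2_eq_2)
  have A3: "?A 3 = ideal_insert (?A 2) (L 2)" using add_forms_Suc[of ?I 2 L] by (simp add: numeral_3_eq_3 numeral_2_eq_2)
  have A1: "?A 1 = ideal_insert ?I (L 0)" using add_forms_Suc[of ?I 0 L] A0 by simp
  have "colon ?I (L 0) = ?I" using subset_colon[OF sI, of "L 0"] nz by (auto simp: in_colon_iff)
  hence h01: "hilbert_fun ?I (Suc t) = ?h 1 (Suc t) + hilbert_fun ?I t" for t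
    using hilbert_fun_exact[OF hI L1, of t 0] unfolding A1 by simp
  have h12: "?h 1 (Suc t) = ?h 2 (Suc t) + ?h 1 t" if "t \<le> d" for t
  proof -
    have "forms t \<inter> colon (?A 1) (L 1) = forms t \<inter> ?A 1"
      using subset_colon[OF add_forms_subspace, of ?I 1 L "L 1"] inj[OF that] by (auto simp: in_colon_iff)
    hence "hilbert_fun (colon (?A 1) (L 1)) t = ?h 1 t"
      by (intro hilbert_fun_cong homogeneous_idealD(1)[OF homogeneous_colon[OF hA L1]] add_forms_subspace)
    thus ?thesis using hilbert_fun_exact[OF hA L1, of 1 t 1] unfolding A2 by simp
  qed
  have "diff_fun (\<lambda>t. int (hilbert_fun ?I t)) = (\<lambda>t. int (?h 1 t))"
  proof
    fix t
    show "diff_fun (\<lambda>t. int (hilbert_fun ?I t)) t = int (?h 1 t)"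
    proof (cases t)
      case 0
      thus ?thesis using hilbert_fun_insert_low[OF hI L1, of 0 0] by (simp add: diff_fun_def A1 del: One_nat_def)
    next
      case (Suc u)
      thus ?thesis using h01[of u] by (simp add: diff_fun_def)
    qed
  qed
  hence diff2: "hilbert_diff2 ?I (Suc t) = int (?h 2 (Suc t))" if "t \<le> d" for t
    using h12[OF that] unfolding hilbert_diff2_def by (simp add: diff_fun_def)
  \<comment> \<open>\<open>diff2\<close> covers positive degrees only; \<open>d\<close> is positive
    because it exceeds \<open>red_max 3 I_Z\<close>.\<close>
  obtain d' where d': "d = Suc d'" using assms(9) by (cases d) auto
  have h2d: "int (?h 2 d) = s" using diff2[of d'] assms(6) d' by simp
  have h2d1: "int (?h 2 (Suc d)) = s" using diff2[of d] assms(7) by simp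
  have spos: "0 < ?h 2 d"
    using not2[of d] hilbert_fun_eq_0_iff[OF add_forms_subspace, of ?I 2 L d] by auto
  \<comment> \<open>The cokernel of the third multiplication is zero in degree \<open>d + 1\<close>,
    so equality of the two values of \<open>?h 2\<close> leaves no room for a kernel.\<close>
  have "?h 2 (Suc d) = ?h 3 (Suc d) + hilbert_fun (colon (?A 2) (L 2)) d"
    using hilbert_fun_exact[OF hA L1, of 2 d 2] unfolding A3 by simp
  moreover have "?h 3 (Suc d) = 0" using hilbert_fun_eq_0_iff[OF add_forms_subspace] all3[of "Suc d"] by auto
  ultimately have "?h 2 d = hilbert_fun (colon (?A 2) (L 2)) d" using h2d h2d1 by simp
  hence eq2: "forms d \<inter> ?A 2 = forms d \<inter> colon (?A 2) (L 2)"
    using subset_colon[OF add_forms_subspace, of ?I 2 L "L 2"]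
    by (intro hilbert_fun_eq_imp add_forms_subspace homogeneous_idealD(1)[OF homogeneous_colon[OF hA L1]]) auto
  have inj3: "f \<in> ?A 2" if "f \<in> forms d" "L 2 * f \<in> ?A 2" for f
  proof -
    have "f \<in> forms d \<inter> colon (?A 2) (L 2)" using that by (simp add: in_colon_iff)
    hence "f \<in> forms d \<inter> ?A 2" by (simp only: eq2)
    thus ?thesis by simp
  qed
  \<comment> \<open>Truncation does not change the ideal in degree \<open>d\<close>, and in a
    homogeneous representation of \<open>f\<close> the part in \<open>I_Z\<close> has degree exactly
    \<open>d\<close>.\<close>
  have cmp: "f \<in> add_forms ?J k L" if f: "f \<in> forms d" "f \<in> ?A k" for f k
  proof -
    have f': "f \<in> forms (Suc d')" using f(1) d' by simp
    obtain g r where g: "g \<in> ?I \<inter> forms (Suc d')" "f = g + (\<Sum>i<k. r i * L i)"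
      using add_forms_homogeneous_repr[OF hI L1[folded One_nat_def] f(2) f'] by blast
    have "g \<in> forms d \<inter> ?J" unfolding homogeneous_truncated_ideal(3)[OF hI order_refl] using g(1) d' by auto
    hence "f - (\<Sum>i<k. r i * L i) \<in> ?J" using g(2) by simp
    thus ?thesis unfolding in_add_forms_iff[OF sJ] by (intro exI[of _ r])
  qed
  have AJ: "add_forms ?J k L \<subseteq> ?A k" for k by (rule add_forms_mono[OF JI])
  \<comment> \<open>A form dependent on its predecessors would act as zero on the quotient.
    Injectivity would then force the unit ideal for the first form, and for the others vanishing in
    degree \<open>d\<close>, against \<open>not2\<close>.\<close>
  have new: "L k \<notin> vs.span (L ` {..<k})" if "k < 3" for k
  proof
    assume "L k \<in> vs.span (L ` {..<k})"
    moreover have "vs.span (L ` {..<k}) \<subseteq> ?A k"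
    proof (rule vs.span_minimal)
      show "L ` {..<k} \<subseteq> ?A k" by (rule image_subsetI) (simp add: form_in_add_forms)
    qed (rule ideal_vs_subspace[OF add_forms_subspace])
    ultimately have Lk: "L k \<in> ?A k" by blast
    hence Lf: "L k * f \<in> ?A k" for f
      using idl.subspace_scale[OF add_forms_subspace Lk, of f] by (simp add: mult.commute)
    consider "k = 0" | "k = 1" | "k = 2" using \<open>k < 3\<close> by linarith
    thus False
    proof cases
      case 1
      hence "1 \<in> ?I" using nz[of 1] Lf[of 1] A0 by simp
      thus False using ideal_eq_UNIV[OF sI] nU by simp
    next
      case 2
      hence "forms d \<subseteq> ?A 1" using inj[OF order_refl] Lf by auto
      thus False using A_mono[of 1 2] not2[of d] by auto
    next
      case 3
      hence "forms d \<subseteq> ?A 2" using inj3 Lf by auto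
      thus False using not2[of d] by simp
    qed
  qed
  have "\<exists>l n. 3 \<le> n \<and> (\<forall>i<3. l i = L i) \<and> regular_forms l n"
    using independent_of_chain[of 3 L, OF new] L1 by (intro regular_forms_extend) auto
  then obtain l n where n: "3 \<le> n" and lL: "\<forall>i<3. l i = L i" and reg: "regular_forms l n"
    by (elim exE conjE)
  interpret regular_forms l n by (rule reg)
  have eqf: "add_forms X k l = add_forms X k L" if "k \<le> 3" for X k
    by (rule add_forms_cong) (use lL that in simp)
  have Td: "colon_cond ?J d"
    unfolding colon_cond_def
  proof (intro allI ballI impI)
    fix k f assume k: "k < n" and f: "f \<in> forms d" and lf: "l k * f \<in> add_forms ?J k l"
    show "f \<in> add_forms ?J k l"
    proof (cases "k < 3")
      case True
      have lf': "L k * f \<in> ?A k" using lf AJ[of k] eqf[of k ?J] lL True by auto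
      consider "k = 0" | "k = 1" | "k = 2" using True by linarith
      hence "f \<in> ?A k"
      proof cases
        case 1
        thus ?thesis using lf' nz A0 by simp
      next
        case 2
        thus ?thesis using lf' inj[OF order_refl f] by simp
      next
        case 3
        thus ?thesis using lf' inj3[OF f] by simp
      qed
      thus ?thesis using cmp[OF f] eqf[of k ?J] True by simp
    next
      case False
      \<comment> \<open>From the fourth form on, the ideal already contains every form of degree
        \<open>d\<close>.\<close>
      have "f \<in> add_forms ?J 3 l" using cmp[OF f, of 3] all3[OF order_refl] f eqf[of 3 ?J] by auto
      thus ?thesis using add_forms_mono_index[of 3 k ?J l] False by auto
    qed
  qed
  have T: "colon_cond ?J q" if "d \<le> q" for q
    by (rule colon_cond_upward[OF hJ Td _ that]) (rule truncated_ideal_generation[OF hI])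
  have JU: "?J \<noteq> UNIV" using JI nU by auto
  have reg_J: "regular_ideal d ?J"
    by (rule regular_ideal_of_cap[OF hJ JU]) (use T colon_imp_cap[OF hJ] in blast)
  have sat_J: "saturated ?J"
    by (rule saturated_of_colon_cond[OF hJ JI assms(3) homogeneous_truncated_ideal(3)[OF hI] T])
      (use n in auto)
  \<comment> \<open>Each \<open>?g k\<close> arises by summing \<open>?g (Suc k)\<close> from degree
    \<open>d\<close> on. Starting from the zero function for \<open>k = 3\<close>, this produces a
    constant, a linear and finally a quadratic function.\<close>
  let ?g = "\<lambda>k. hilbert_fun (add_forms ?J k l)"
  have rec: "?g k (Suc q) = ?g (Suc k) (Suc q) + ?g k q" if "k < 3" "d \<le> q" for k q
    by (rule hilbert_fun_colon_cond[OF hJ T[OF that(2)]]) (use that n in simp)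
  have "forms d \<subseteq> add_forms ?J 3 l" using cmp[of _ 3] all3[of d] eqf[of 3 ?J] by auto
  hence g3: "?g 3 q = 0" if "d \<le> q" for q
    using forms_subset_upward[OF add_forms_subspace _ that] hilbert_fun_eq_0_iff[OF add_forms_subspace] by blast
  have "forms d \<inter> add_forms ?J 2 L = forms d \<inter> ?A 2" using cmp[of _ 2] AJ[of 2] by auto
  hence "?g 2 d = ?h 2 d"
    unfolding eqf[of 2 ?J, simplified] by (intro hilbert_fun_cong add_forms_subspace)
  hence g2: "?g 2 (d + u) = ?h 2 d" for u
  proof (induction u)
    case (Suc u)
    have "?g 2 (Suc (d + u)) = ?g 2 (d + u)"
      using rec[of 2 "d + u"] g3[of "Suc (d + u)"] by (simp add: numeral_3_eq_3 numeral_2_eq_2)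
    thus ?case using Suc by simp
  qed simp
  have g1: "?g 1 (d + u) = ?g 1 d + ?h 2 d * u" for u
  proof (induction u)
    case (Suc u)
    have "?g 1 (Suc (d + u)) = ?g 2 (d + Suc u) + ?g 1 (d + u)"
      using rec[of 1 "d + u"] by (simp add: numeral_2_eq_2)
    thus ?case using Suc g2[of "Suc u"] by simp
  qed simp
  have g0: "2 * hilbert_fun ?J (d + u) = 2 * hilbert_fun ?J d + 2 * u * ?g 1 d + ?h 2 d * u * (u + 1)" for u
  proof (induction u)
    case (Suc u)
    have "hilbert_fun ?J (Suc (d + u)) = ?g 1 (d + Suc u) + hilbert_fun ?J (d + u)"
      using rec[of 0 "d + u"] add_forms_0[OF sJ] by simp
    thus ?case using Suc g1[of "Suc u"] by (simp add: algebra_simps)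
  qed simp
  have "has_proj_dim ?J 2" "has_proj_degree ?J (int (?h 2 d))"
    by (rule quadratic_hilbert_fun[OF hJ spos g0])+
  thus ?thesis using hJ sat_J reg_J h2d by simp
qed

end
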